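(* Let $a,T,L>0$, let $n\ge1$, $\beta_k>0$ and $x_k\in(0,L)$ for $k=1,\dots,n$, and let $\varphi\in H_0^1((0,L))$ and $\psi\in L^2((0,L))$. Then the initial-boundary value problem $$u_{tt}-a^2u_{xx}=\sum_{k=1}^n-\beta_k u(x_k,t)\,\delta_{x=x_k},\quad (x,t)\in(0,L)\times(0,T],$$ $$u(0,t)=0,\quad u(L,t)=0,\quad t\in(0,T],$$ $$u(x,0)=\varphi(x),\quad u_t(x,0)=\psi(x),\quad x\in[0,L],$$ admits a unique weak solution $u\in L^\infty(0,T;H_0^1((0,L)))$.
   Context: $\delta_{x=x_k}$ is the Dirac measure supported at $x=x_k$. Primes denote derivatives with respect to $t$ (in the sense of distributions with values in the relevant space), and $\langle\cdot,\cdot\rangle$ is the duality pairing between $H^{-1}((0,L))$ and $H_0^1((0,L))$. Define the bilinear form $$B[u,v;t]=\int_0^L a^2u_x(x,t)v_x(x,t)\,dx+\sum_{k=1}^n L\beta_k u(x_k,t)v(x_k,t)$$ (for $v\in H_0^1((0,L))$ independent of $t$, $v(x,t)$ is read as $v(x)$). A function $u\in L^2(0,T;H_0^1((0,L)))$ is called a weak solution of the problem if: (H1) $u'\in L^2(0,T;L^2((0,L)))$ and $u''\in L^2(0,T;H^{-1}((0,L)))$; (H2) for each $v\in H_0^1((0,L))$, $\langle u'',v\rangle+B[u,v;t]=0$ for a.e. $t\in[0,T]$; (H3) $u(0)=\varphi\in H_0^1((0,L))$ and $u'(0)=\psi\in L^2((0,L))$. *)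

theory Defs
  imports "HOL-Analysis.Analysis" "HOL-Library.Function_Algebras"
begin

text \<open>
  Elements of \<open>L\<^sup>2((0,L))\<close> and \<open>H\<^sub>0\<^sup>1((0,L))\<close> are represented by functions \<open>real \<Rightarrow> real\<close>, elements of
  \<open>H\<^sup>-\<^sup>1((0,L))\<close> by functionals \<open>(real \<Rightarrow> real) \<Rightarrow> real\<close>. Both live in the pointwise vector space
  structure on functions; equality in the respective space means that the difference has norm 0
  (so functions on the interval are identified when they agree almost everywhere).
\<close>

instantiation "fun" :: (type, real_vector) real_vector
begin

definition scaleR_fun :: "real \<Rightarrow> ('a \<Rightarrow> 'b) \<Rightarrow> 'a \<Rightarrow> 'b"
  where "scaleR_fun c f = (\<lambda>x. c *\<^sub>R f x)"

instance
  by standard (simp_all add: scaleR_fun_def fun_eq_iff scaleR_add_right scaleR_add_left)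

end


subsection \<open>Test functions and the spaces on the interval\<close>

definition test_function_on :: "real set \<Rightarrow> (real \<Rightarrow> real) \<Rightarrow> bool"
  where "test_function_on S \<theta> \<longleftrightarrow>
    (\<forall>n x. (deriv ^^ n) \<theta> differentiable (at x)) \<and>
    (\<exists>K. compact K \<and> K \<subseteq> S \<and> (\<forall>x. x \<notin> K \<longrightarrow> \<theta> x = 0))"

definition L2 :: "real \<Rightarrow> (real \<Rightarrow> real) set"
  where "L2 L = {f \<in> borel_measurable (lebesgue_on {0<..<L}).
    integrable (lebesgue_on {0<..<L}) (\<lambda>x. (f x)\<^sup>2)}"

definition L2_norm :: "real \<Rightarrow> (real \<Rightarrow> real) \<Rightarrow> real"
  where "L2_norm L f = sqrt (LINT x|lebesgue_on {0<..<L}. (f x)\<^sup>2)"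

definition has_weak_deriv :: "real \<Rightarrow> (real \<Rightarrow> real) \<Rightarrow> (real \<Rightarrow> real) \<Rightarrow> bool"
  where "has_weak_deriv L f g \<longleftrightarrow>
    (\<forall>\<theta>. test_function_on {0<..<L} \<theta> \<longrightarrow>
      (LINT x|lebesgue_on {0<..<L}. f x * deriv \<theta> x) =
      - (LINT x|lebesgue_on {0<..<L}. g x * \<theta> x))"

definition H1 :: "real \<Rightarrow> (real \<Rightarrow> real) set"
  where "H1 L = {f \<in> L2 L. \<exists>g \<in> L2 L. has_weak_deriv L f g}"

text \<open>The weak derivative is determined almost everywhere on \<open>(0,L)\<close>; we pick a representative.\<close>

definition weak_deriv :: "real \<Rightarrow> (real \<Rightarrow> real) \<Rightarrow> real \<Rightarrow> real"
  where "weak_deriv L f = (SOME g. g \<in> L2 L \<and> has_weak_deriv L f g)"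

definition H1_norm :: "real \<Rightarrow> (real \<Rightarrow> real) \<Rightarrow> real"
  where "H1_norm L f = sqrt ((L2_norm L f)\<^sup>2 + (L2_norm L (weak_deriv L f))\<^sup>2)"

definition H10 :: "real \<Rightarrow> (real \<Rightarrow> real) set"
  where "H10 L = {f \<in> H1 L. \<exists>\<theta>. (\<forall>i::nat. test_function_on {0<..<L} (\<theta> i)) \<and>
    (\<lambda>i. H1_norm L (f - \<theta> i)) \<longlonglongrightarrow> 0}"

text \<open>
  Point values of an \<open>H\<^sup>1\<close> function at \<open>x \<in> (0,L)\<close> are those of its continuous representative,
  which is unique on the open interval.
\<close>

definition cont_rep :: "real \<Rightarrow> (real \<Rightarrow> real) \<Rightarrow> real \<Rightarrow> real"
  where "cont_rep L f = (SOME g. continuous_on {0<..<L} g \<and>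
    (AE x in lebesgue_on {0<..<L}. g x = f x))"

definition H_minus1 :: "real \<Rightarrow> ((real \<Rightarrow> real) \<Rightarrow> real) set"
  where "H_minus1 L = {F.
    (\<forall>f \<in> H10 L. \<forall>g \<in> H10 L. F (f + g) = F f + F g) \<and>
    (\<forall>c. \<forall>f \<in> H10 L. F (c *\<^sub>R f) = c * F f) \<and>
    (\<exists>C. \<forall>f \<in> H10 L. \<bar>F f\<bar> \<le> C * H1_norm L f)}"

definition H_minus1_norm :: "real \<Rightarrow> ((real \<Rightarrow> real) \<Rightarrow> real) \<Rightarrow> real"
  where "H_minus1_norm L F = (SUP v \<in> {v \<in> H10 L. H1_norm L v \<le> 1}. \<bar>F v\<bar>)"

text \<open>The embedding of \<open>L\<^sup>2((0,L))\<close> into \<open>H\<^sup>-\<^sup>1((0,L))\<close>.\<close>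

definition L2_functional :: "real \<Rightarrow> (real \<Rightarrow> real) \<Rightarrow> (real \<Rightarrow> real) \<Rightarrow> real"
  where "L2_functional L f = (\<lambda>v. LINT x|lebesgue_on {0<..<L}. f x * v x)"


subsection \<open>Functions of time with values in a seminormed space\<close>

text \<open>
  The space is given by its carrier \<open>X\<close> and its norm \<open>N\<close>. The library's Bochner integral requires
  the norm and the carrier to come from the type, so its definition is repeated for \<open>X\<close> and \<open>N\<close>.
\<close>

definition simple_in :: "'t measure \<Rightarrow> 'b::real_vector set \<Rightarrow> ('t \<Rightarrow> 'b) \<Rightarrow> bool"
  where "simple_in M X s \<longleftrightarrow> Bochner_Integration.simple_bochner_integrable M s \<and> s ` space M \<subseteq> X"

definition strongly_measurable ::
    "'t measure \<Rightarrow> 'b::real_vector set \<Rightarrow> ('b \<Rightarrow> real) \<Rightarrow> ('t \<Rightarrow> 'b) \<Rightarrow> bool"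
  where "strongly_measurable M X N f \<longleftrightarrow>
    (AE t in M. f t \<in> X) \<and>
    (\<exists>s. (\<forall>i::nat. simple_in M X (s i)) \<and> (AE t in M. (\<lambda>i. N (f t - s i t)) \<longlonglongrightarrow> 0))"

definition has_integral_in ::
    "'t measure \<Rightarrow> 'b::real_vector set \<Rightarrow> ('b \<Rightarrow> real) \<Rightarrow> ('t \<Rightarrow> 'b) \<Rightarrow> 'b \<Rightarrow> bool"
  where "has_integral_in M X N f I \<longleftrightarrow>
    strongly_measurable M X N f \<and> I \<in> X \<and>
    (\<exists>s. (\<forall>i::nat. simple_in M X (s i)) \<and>
      (\<lambda>i. \<integral>\<^sup>+t. ennreal (N (f t - s i t)) \<partial>M) \<longlonglongrightarrow> 0 \<and>
      (\<lambda>i. N (Bochner_Integration.simple_bochner_integral M (s i) - I)) \<longlonglongrightarrow> 0)"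

definition L2_time :: "real \<Rightarrow> 'b::real_vector set \<Rightarrow> ('b \<Rightarrow> real) \<Rightarrow> (real \<Rightarrow> 'b) set"
  where "L2_time T X N = {f. strongly_measurable (lebesgue_on {0<..<T}) X N f \<and>
    integrable (lebesgue_on {0<..<T}) (\<lambda>t. (N (f t))\<^sup>2)}"

definition Linf_time :: "real \<Rightarrow> 'b::real_vector set \<Rightarrow> ('b \<Rightarrow> real) \<Rightarrow> (real \<Rightarrow> 'b) set"
  where "Linf_time T X N = {f. strongly_measurable (lebesgue_on {0<..<T}) X N f \<and>
    (\<exists>C. AE t in lebesgue_on {0<..<T}. N (f t) \<le> C)}"

text \<open>\<open>g\<close> is the derivative of \<open>f\<close> in the sense of \<open>X\<close>-valued distributions on \<open>(0,T)\<close>.\<close>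

definition has_distr_deriv ::
    "real \<Rightarrow> 'b::real_vector set \<Rightarrow> ('b \<Rightarrow> real) \<Rightarrow> (real \<Rightarrow> 'b) \<Rightarrow> (real \<Rightarrow> 'b) \<Rightarrow> bool"
  where "has_distr_deriv T X N f g \<longleftrightarrow>
    (\<forall>\<theta>. test_function_on {0<..<T} \<theta> \<longrightarrow>
      (\<exists>I. has_integral_in (lebesgue_on {0<..<T}) X N (\<lambda>t. deriv \<theta> t *\<^sub>R f t) I \<and>
           has_integral_in (lebesgue_on {0<..<T}) X N (\<lambda>t. \<theta> t *\<^sub>R g t) (- I)))"

text \<open>
  \<open>f(0) = f0\<close>, for \<open>f\<close> known up to null sets only: the representative of \<open>f\<close> that is continuous
  on \<open>[0,T]\<close> with values in \<open>X\<close> exists and takes the value \<open>f0\<close> at 0.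
\<close>

definition has_initial_value ::
    "real \<Rightarrow> 'b::real_vector set \<Rightarrow> ('b \<Rightarrow> real) \<Rightarrow> (real \<Rightarrow> 'b) \<Rightarrow> 'b \<Rightarrow> bool"
  where "has_initial_value T X N f f0 \<longleftrightarrow>
    (\<exists>w. (\<forall>t\<in>{0..T}. w t \<in> X) \<and>
      (\<forall>t\<in>{0..T}. ((\<lambda>s. N (w s - w t)) \<longlongrightarrow> 0) (at t within {0..T})) \<and>
      (AE t in lebesgue_on {0<..<T}. N (w t - f t) = 0) \<and>
      N (w 0 - f0) = 0)"


subsection \<open>Weak solutions\<close>

text \<open>The form \<open>B[u,v;t]\<close>, with \<open>w\<close> standing for \<open>u(\<cdot>,t)\<close>.\<close>

definition B_form ::
    "real \<Rightarrow> real \<Rightarrow> nat \<Rightarrow> (nat \<Rightarrow> real) \<Rightarrow> (nat \<Rightarrow> real) \<Rightarrow> (real \<Rightarrow> real) \<Rightarrow> (real \<Rightarrow> real) \<Rightarrow> real"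
  where "B_form a L n \<beta> x w v =
    (LINT y|lebesgue_on {0<..<L}. a\<^sup>2 * weak_deriv L w y * weak_deriv L v y) +
    (\<Sum>k=1..n. L * \<beta> k * cont_rep L w (x k) * cont_rep L v (x k))"

text \<open>
  \<open>u1\<close> and \<open>u2\<close> are \<open>u'\<close> and \<open>u''\<close>. Initial values are understood for \<open>u \<in> C([0,T]; L\<^sup>2((0,L)))\<close>
  and \<open>u' \<in> C([0,T]; H\<^sup>-\<^sup>1((0,L)))\<close>.
\<close>

definition weak_solution ::
    "real \<Rightarrow> real \<Rightarrow> real \<Rightarrow> nat \<Rightarrow> (nat \<Rightarrow> real) \<Rightarrow> (nat \<Rightarrow> real) \<Rightarrow>
     (real \<Rightarrow> real) \<Rightarrow> (real \<Rightarrow> real) \<Rightarrow> (real \<Rightarrow> real \<Rightarrow> real) \<Rightarrow> bool"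
  where "weak_solution a T L n \<beta> x \<phi> \<psi> u \<longleftrightarrow>
    u \<in> L2_time T (H10 L) (H1_norm L) \<and>
    (\<exists>u1 u2.
      has_distr_deriv T (L2 L) (L2_norm L) u u1 \<and>
      u1 \<in> L2_time T (L2 L) (L2_norm L) \<and>
      has_distr_deriv T (H_minus1 L) (H_minus1_norm L) (\<lambda>t. L2_functional L (u1 t)) u2 \<and>
      u2 \<in> L2_time T (H_minus1 L) (H_minus1_norm L) \<and>
      (\<forall>v \<in> H10 L. AE t in lebesgue_on {0<..<T}. u2 t v + B_form a L n \<beta> x (u t) v = 0) \<and>
      has_initial_value T (L2 L) (L2_norm L) u \<phi> \<and>
      has_initial_value T (H_minus1 L) (H_minus1_norm L) (\<lambda>t. L2_functional L (u1 t))
        (L2_functional L \<psi>))"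

end

theory Submission
  imports Defs "HOL-Complex_Analysis.Great_Picard" "HOL-Real_Asymp.Real_Asymp"
begin

text \<open>
  The problem reads \<open>u'' + A u = 0\<close>, where \<open>A\<close> maps \<open>H\<^sub>0\<^sup>1\<close> to \<open>H\<^sup>-\<^sup>1\<close> and comes from the form \<open>B\<close>. Point
  values are bounded functionals on \<open>H\<^sub>0\<^sup>1\<close> in one dimension, so \<open>B\<close> with its point loads is a
  symmetric form equivalent to the Dirichlet integral, and \<open>H\<^sub>0\<^sup>1\<close> embeds compactly into \<open>L\<^sup>2\<close>. Hence
  there are vectors \<open>e\<^sub>k \<in> H\<^sub>0\<^sup>1\<close> and numbers \<open>\<lambda>\<^sub>k > 0\<close> with \<open>B(e\<^sub>k, v) = \<lambda>\<^sub>k (e\<^sub>k, v)\<close> for all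
  \<open>v \<in> H\<^sub>0\<^sup>1\<close>, orthogonal for both forms and complete (\<open>minimizer_exists\<close>, \<open>B_eig\<close>, \<open>eig_complete\<close>).
  Tested with \<open>e\<^sub>k\<close> the equation becomes a harmonic oscillator, and both halves of the theorem are
  read off from these oscillators.

  Existence. With \<open>c\<^sub>k = (\<phi>, e\<^sub>k)\<close> and \<open>d\<^sub>k = (\<psi>, e\<^sub>k)\<close> let \<open>y\<^sub>k\<close> be the oscillation of
  frequency \<open>\<surd>\<lambda>\<^sub>k\<close> starting at \<open>c\<^sub>k\<close> with speed \<open>d\<^sub>k\<close>. Its energy \<open>\<lambda>\<^sub>k y\<^sub>k\<^sup>2 + y\<^sub>k'\<^sup>2\<close> is
  conserved and summable in \<open>k\<close> by Bessel's inequality, so \<open>u = \<Sum> y\<^sub>k e\<^sub>k\<close> converges in \<open>H\<^sub>0\<^sup>1\<close> and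
  \<open>\<Sum> y\<^sub>k' e\<^sub>k\<close> in \<open>L\<^sup>2\<close>, both uniformly in time. Uniform limits commute with everything that has to
  be checked, so measurability, continuity and the distributional derivatives in time reduce to
  scalar facts about \<open>y\<^sub>k\<close> (\<open>series_integral\<close>, \<open>series_weak_solution\<close>).

  Uniqueness. The energy estimate is not available for a weak solution, as \<open>u'\<close> is no admissible
  test function. The \<open>e\<^sub>k\<close> are: they do not depend on time. For any weak solution \<open>w\<close> the scalar
  function \<open>(w(t), e\<^sub>k)\<close> solves the oscillator equation in the sense of distributions, hence
  classically by the lemma of du Bois-Reymond, and the initial values make it equal to \<open>y\<^sub>k\<close>
  (\<open>harmonic_oscillator_unique\<close>, \<open>weak_solution_coeff\<close>). By completeness \<open>w(t) = u(t)\<close> for almost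
  every \<open>t\<close>.

  Test functions enter in two ways. An explicit bump family proves the fundamental lemma of the
  calculus of variations (\<open>fundamental_lemma\<close>, \<open>du_bois_reymond\<close>). And \<open>H\<^sub>0\<^sup>1\<close> is the closure of the
  test functions, for which a function is the primitive of its derivative; this passes to the
  closure (\<open>H10_eq_primitive\<close>) and yields the continuous representative, the Poincare inequality
  and compactness.
\<close>

section \<open>Smooth functions\<close>

definition smooth :: "(real \<Rightarrow> real) \<Rightarrow> bool" where
  "smooth f \<longleftrightarrow> (\<forall>n x. (deriv ^^ n) f differentiable (at x))"

text \<open>Smoothness is a greatest fixed point, so it is enough to exhibit a class of differentiable functions
  that contains the derivatives of its members.\<close>

lemma smooth_coinduct:
  assumes "P f"
    and step: "\<And>f. P f \<Longrightarrow> \<exists>f'. (\<forall>x. (f has_real_derivative f' x) (at x)) \<and> P f'"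
  shows "smooth f"
proof -
  have "P f \<Longrightarrow> (deriv ^^ n) f differentiable (at x)" for n f x
  proof (induction n arbitrary: f)
    case 0
    then show ?case using step real_differentiable_def by fastforce
  next
    case (Suc n)
    from step[OF Suc.prems] obtain f' where "\<And>x. (f has_real_derivative f' x) (at x)" "P f'" by blast
    then have "deriv f = f'" "P f'" by (auto intro: DERIV_imp_deriv)
    then show ?case using Suc.IH[of f'] by (simp only: funpow_Suc_right o_apply)
  qed
  then show ?thesis using assms(1) by (simp add: smooth_def)
qed

lemma smooth_DERIV: "smooth f \<Longrightarrow> (f has_real_derivative deriv f x) (at x)"
  unfolding smooth_def by (metis DERIV_deriv_iff_real_differentiable funpow_0)

lemma smooth_deriv: "smooth f \<Longrightarrow> smooth (deriv f)"
  unfolding smooth_def by (metis comp_apply funpow_Suc_right)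

lemma smooth_continuous_on: "smooth f \<Longrightarrow> continuous_on S f"
  by (meson DERIV_isCont continuous_at_imp_continuous_on smooth_DERIV)

lemma smooth_if_deriv:
  assumes "\<And>x. (f has_real_derivative g x) (at x)" "smooth g"
  shows "smooth f"
proof (rule smooth_coinduct[where P = "\<lambda>h. h = f \<or> smooth h"])
  show "\<exists>f'. (\<forall>x. (h has_real_derivative f' x) (at x)) \<and> (f' = f \<or> smooth f')" if "h = f \<or> smooth h" for h
    using that assms smooth_DERIV smooth_deriv by blast
qed simp

lemma smooth_add:
  assumes "smooth f" "smooth g"
  shows "smooth (\<lambda>x. f x + g x)"
proof (rule smooth_coinduct[where P = "\<lambda>h. \<exists>f g. smooth f \<and> smooth g \<and> h = (\<lambda>x. f x + g x)"])
  fix h assume "\<exists>f g. smooth f \<and> smooth g \<and> h = (\<lambda>x. f x + g x)"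
  then obtain f g where fg: "smooth f" "smooth g" and h: "h = (\<lambda>x. f x + g x)" by blast
  have "\<forall>x. (h has_real_derivative deriv f x + deriv g x) (at x)"
    unfolding h using fg by (auto intro!: derivative_eq_intros smooth_DERIV)
  then show "\<exists>f'. (\<forall>x. (h has_real_derivative f' x) (at x)) \<and> (\<exists>f g. smooth f \<and> smooth g \<and> f' = (\<lambda>x. f x + g x))"
    using smooth_deriv[OF fg(1)] smooth_deriv[OF fg(2)]
    by (intro exI[of _ "\<lambda>x. deriv f x + deriv g x"]) auto
qed (use assms in blast)

lemma smooth_affine:
  assumes "smooth f"
  shows "smooth (\<lambda>x. c * f (a * x + b))"
proof (rule smooth_coinduct[where P = "\<lambda>h. \<exists>f c. smooth f \<and> h = (\<lambda>x. c * f (a * x + b))"])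
  fix h assume "\<exists>f c. smooth f \<and> h = (\<lambda>x. c * f (a * x + b))"
  then obtain f c where f: "smooth f" and h: "h = (\<lambda>x. c * f (a * x + b))" by blast
  have "\<forall>x. (h has_real_derivative (c * a) * deriv f (a * x + b)) (at x)"
    unfolding h using f by (auto intro!: derivative_eq_intros DERIV_chain2[where f = f] smooth_DERIV)
  then show "\<exists>f'. (\<forall>x. (h has_real_derivative f' x) (at x)) \<and> (\<exists>f c. smooth f \<and> f' = (\<lambda>x. c * f (a * x + b)))"
    using smooth_deriv[OF f]
    by (intro exI[of _ "\<lambda>x. c * a * deriv f (a * x + b)"]) auto
qed (use assms in blast)

text \<open>The class of products is not closed under differentiation, that of sums of products is.\<close>

inductive product_sum :: "(real \<Rightarrow> real) \<Rightarrow> bool" where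
  "smooth f \<Longrightarrow> smooth g \<Longrightarrow> product_sum (\<lambda>x. f x * g x)"
| "product_sum f \<Longrightarrow> product_sum g \<Longrightarrow> product_sum (\<lambda>x. f x + g x)"

lemma product_sum_deriv:
  "product_sum h \<Longrightarrow> \<exists>h'. (\<forall>x. (h has_real_derivative h' x) (at x)) \<and> product_sum h'"
proof (induction rule: product_sum.induct)
  case (1 f g)
  then have "\<forall>x. ((\<lambda>x. f x * g x) has_real_derivative deriv f x * g x + f x * deriv g x) (at x)"
    by (auto intro!: derivative_eq_intros smooth_DERIV)
  moreover have "product_sum (\<lambda>x. deriv f x * g x + f x * deriv g x)"
    using 1 by (intro product_sum.intros smooth_deriv)
  ultimately show ?case by (intro exI[of _ "\<lambda>x. deriv f x * g x + f x * deriv g x"] conjI)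
next
  case (2 f g)
  then obtain f' g' where fg: "\<And>x. (f has_real_derivative f' x) (at x)" "product_sum f'"
    "\<And>x. (g has_real_derivative g' x) (at x)" "product_sum g'" by blast
  then have "\<forall>x. ((\<lambda>x. f x + g x) has_real_derivative f' x + g' x) (at x)"
    by (auto intro!: derivative_eq_intros)
  then show ?case using product_sum.intros(2)[OF fg(2) fg(4)]
    by (intro exI[of _ "\<lambda>x. f' x + g' x"] conjI)
qed

lemma smooth_mult:
  assumes "smooth f" "smooth g"
  shows "smooth (\<lambda>x. f x * g x)"
  using product_sum.intros(1)[OF assms] product_sum_deriv by (rule smooth_coinduct[where P = product_sum])

section \<open>Bump functions\<close>

text \<open>The derivatives of \<open>exp (-1/x)\<close>, extended by 0 to \<open>x \<le> 0\<close>, are linear combinations of these functions.\<close>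

definition flat :: "nat \<Rightarrow> real \<Rightarrow> real" where
  "flat n x = (if x > 0 then (1 / x) ^ n * exp (- (1 / x)) else 0)"

lemma flat_nonpos [simp]: "x \<le> 0 \<Longrightarrow> flat n x = 0"
  by (simp add: flat_def)

lemma flat_div_tendsto_0: "((\<lambda>h. flat n h / h) \<longlongrightarrow> 0) (at 0)"
proof (rule filterlim_split_at)
  show "((\<lambda>h. flat n h / h) \<longlongrightarrow> 0) (at_left 0)"
    by (rule tendsto_eventually) (auto simp: eventually_at_left_field intro!: exI[of _ "-1"])
  have "((\<lambda>h. (1 / h) ^ Suc n / exp (1 / h)) \<longlongrightarrow> (0::real)) (at_right 0)"
    using filterlim_compose[OF tendsto_power_div_exp_0[of "Suc n"] filterlim_inverse_at_top_right]
    by (simp add: inverse_eq_divide)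
  moreover have "\<forall>\<^sub>F h in at_right 0. (1 / h) ^ Suc n / exp (1 / h) = flat n h / (h::real)"
    using eventually_at_right_less[of "0::real"]
    by eventually_elim (simp add: flat_def exp_minus field_simps)
  ultimately show "((\<lambda>h. flat n h / h) \<longlongrightarrow> 0) (at_right 0)"
    by (rule Lim_transform_eventually)
qed

lemma flat_deriv: "(flat n has_real_derivative (flat (n + 2) x - n * flat (n + 1) x)) (at x)"
proof (cases x "0::real" rule: linorder_cases)
  case less
  have "((\<lambda>_. 0) has_real_derivative 0) (at x)" by simp
  then have "(flat n has_real_derivative 0) (at x)"
  proof (rule has_field_derivative_transform_within_open[where S = "{..<0}"])
  qed (use less in auto)
  then show ?thesis using less by simp
next
  case equal
  have "(flat n has_real_derivative 0) (at 0)"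
    unfolding DERIV_def using flat_div_tendsto_0[of n] by simp
  then show ?thesis using equal by simp
next
  case greater
  have "((\<lambda>x. (1 / x) ^ n * exp (- (1 / x))) has_real_derivative (flat (n + 2) x - n * flat (n + 1) x)) (at x)"
  proof -
    have "((\<lambda>x. (1 / x) ^ n * exp (- (1 / x))) has_real_derivative 
       (real n * (1 / x) ^ (n - 1) * (- (1 / x\<^sup>2)) * exp (- (1 / x)) + (1 / x) ^ n * (exp (- (1 / x)) * (1 / x\<^sup>2)))) (at x)"
      using greater by (auto intro!: derivative_eq_intros simp: power2_eq_square)
    moreover have "real n * (1 / x) ^ (n - 1) * (- (1 / x\<^sup>2)) * exp (- (1 / x)) + (1 / x) ^ n * (exp (- (1 / x)) * (1 / x\<^sup>2))
      = flat (n + 2) x - n * flat (n + 1) x"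
      using greater by (cases n) (auto simp: flat_def power2_eq_square algebra_simps add_divide_distrib)
    ultimately show ?thesis by simp
  qed
  then show ?thesis
  proof (rule has_field_derivative_transform_within_open[where S = "{0<..}"])
  qed (use greater in \<open>auto simp: flat_def\<close>)
qed

inductive flat_span :: "(real \<Rightarrow> real) \<Rightarrow> bool" where
  "flat_span (flat n)"
| "flat_span f \<Longrightarrow> flat_span g \<Longrightarrow> flat_span (\<lambda>x. a * f x + b * g x)"

lemma flat_span_deriv:
  "flat_span h \<Longrightarrow> \<exists>h'. (\<forall>x. (h has_real_derivative h' x) (at x)) \<and> flat_span h'"
proof (induction rule: flat_span.induct)
  case (1 n)
  have "flat_span (\<lambda>x. 1 * flat (n + 2) x + (- real n) * flat (n + 1) x)" by (intro flat_span.intros)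
  then have "flat_span (\<lambda>x. flat (n + 2) x - n * flat (n + 1) x)" by simp
  then show ?case using flat_deriv
    by (intro exI[of _ "\<lambda>x. flat (n + 2) x - n * flat (n + 1) x"] conjI allI)
next
  case (2 f g a b)
  then obtain f' g' where fg: "\<And>x. (f has_real_derivative f' x) (at x)" "flat_span f'"
    "\<And>x. (g has_real_derivative g' x) (at x)" "flat_span g'" by blast
  then have "\<forall>x. ((\<lambda>x. a * f x + b * g x) has_real_derivative a * f' x + b * g' x) (at x)"
    by (auto intro!: derivative_eq_intros)
  then show ?case using flat_span.intros(2)[OF fg(2) fg(4)]
    by (intro exI[of _ "\<lambda>x. a * f' x + b * g' x"] conjI)
qed

lemma smooth_flat: "smooth (flat n)"
  using flat_span.intros(1) flat_span_deriv by (rule smooth_coinduct[where P = flat_span])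

text \<open>Rescaling makes the graph steeper with \<open>i\<close>, so that the functions tend to the indicator of \<open>(c, d)\<close>
  while staying between 0 and 1. The shift by 1 keeps the support in a compact part of the open
  interval.\<close>

definition bump :: "real \<Rightarrow> real \<Rightarrow> nat \<Rightarrow> real \<Rightarrow> real" where
  "bump c d i x = flat 0 (real (Suc i) * (x - c) - 1) * flat 0 (real (Suc i) * (d - x) - 1)"

lemma smooth_bump: "smooth (bump c d i)"
proof -
  have "smooth (\<lambda>x. (1 * flat 0 (real (Suc i) * x + (- real (Suc i) * c - 1))) *
     (1 * flat 0 ((- real (Suc i)) * x + (real (Suc i) * d - 1))))"
    by (intro smooth_mult smooth_affine smooth_flat)
  also have "(\<lambda>x. (1 * flat 0 (real (Suc i) * x + (- real (Suc i) * c - 1))) *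
     (1 * flat 0 ((- real (Suc i)) * x + (real (Suc i) * d - 1)))) = bump c d i"
    unfolding bump_def fun_eq_iff by (auto simp: algebra_simps)
  finally show ?thesis .
qed

lemma bump_range: "0 \<le> bump c d i x" "bump c d i x \<le> 1"
  by (auto simp: bump_def flat_def intro!: mult_le_one)

lemma bump_interval: "{c + 1 / real (Suc i)..d - 1 / real (Suc i)} \<subseteq> {c<..<d}"
proof
  fix x assume "x \<in> {c + 1 / real (Suc i)..d - 1 / real (Suc i)}"
  moreover have "0 < 1 / real (Suc i)" by simp
  ultimately show "x \<in> {c<..<d}" unfolding atLeastAtMost_iff greaterThanLessThan_iff by linarith
qed

lemma bump_support: "x \<notin> {c + 1 / real (Suc i)..d - 1 / real (Suc i)} \<Longrightarrow> bump c d i x = 0"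
proof -
  assume "x \<notin> {c + 1 / real (Suc i)..d - 1 / real (Suc i)}"
  then have "x - c < 1 / real (Suc i) \<or> d - x < 1 / real (Suc i)" by auto
  then have "real (Suc i) * (x - c) - 1 \<le> 0 \<or> real (Suc i) * (d - x) - 1 \<le> 0" by (auto simp: field_simps)
  then show ?thesis unfolding bump_def by (metis flat_nonpos mult_zero_left mult_zero_right)
qed

lemma test_function_bump:
  assumes "{c<..<d} \<subseteq> S"
  shows "test_function_on S (bump c d i)"
  unfolding test_function_on_def
proof (intro conjI exI[of _ "{c + 1 / real (Suc i)..d - 1 / real (Suc i)}"] allI impI)
  show "(deriv ^^ n) (bump c d i) differentiable at x" for n x using smooth_bump by (auto simp: smooth_def)
  have "{c + 1 / real (Suc i)..d - 1 / real (Suc i)} \<subseteq> {c<..<d}"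
    by (rule bump_interval)
  then show "{c + 1 / real (Suc i)..d - 1 / real (Suc i)} \<subseteq> S" using assms by blast
qed (use bump_support in auto)

lemma bump_tendsto: "(\<lambda>i. bump c d i x) \<longlonglongrightarrow> indicator {c<..<d} x"
proof (cases "x \<in> {c<..<d}")
  case True
  have lim: "(\<lambda>i. flat 0 (real (Suc i) * y - 1)) \<longlonglongrightarrow> 1" if "y > 0" for y
  proof -
    have "filterlim (\<lambda>i. real (Suc i) * y - 1) at_top sequentially"
      using that by real_asymp
    then have top: "filterlim (\<lambda>i. real (Suc i) * y - 1) at_top sequentially" .
    have "((\<lambda>z. exp (- (1 / z))) \<longlongrightarrow> 1) (at_top :: real filter)"
      by real_asymp
    then have "((\<lambda>z. flat 0 z) \<longlongrightarrow> 1) at_top"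
    proof (rule Lim_transform_eventually)
      show "\<forall>\<^sub>F x in at_top. exp (- (1 / x)) = flat 0 x"
        using eventually_gt_at_top[of "0::real"] by eventually_elim (simp add: flat_def)
    qed
    then show ?thesis by (rule filterlim_compose[OF _ top])
  qed
  have "(\<lambda>i. bump c d i x) \<longlonglongrightarrow> 1 * 1"
    unfolding bump_def using True by (intro tendsto_mult lim) auto
  then show ?thesis using True by simp
next
  case False
  have "bump c d i x = 0" for i
    using False bump_interval by (intro bump_support) blast
  then show ?thesis using False by simp
qed

section \<open>Test functions\<close>

lemma test_function_smooth: "test_function_on S \<theta> \<Longrightarrow> smooth \<theta>"
  by (simp add: test_function_on_def smooth_def)

text \<open>The compact support is enlarged to an interval; it may also be empty.\<close>

lemma test_function_support:
  assumes "test_function_on {a<..<b} \<theta>"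
  obtains c d where "a < c" "c \<le> d" "d < b" "\<And>x. x \<notin> {c..d} \<Longrightarrow> \<theta> x = 0" | "\<And>x. \<theta> x = 0"
proof -
  obtain K where K: "compact K" "K \<subseteq> {a<..<b}" "\<And>x. x \<notin> K \<Longrightarrow> \<theta> x = 0"
    using assms by (auto simp: test_function_on_def)
  show thesis
  proof (cases "K = {}")
    case True
    then show ?thesis using K that(2) by blast
  next
    case False
    obtain c d where cd: "c \<in> K" "d \<in> K" "\<And>x. x \<in> K \<Longrightarrow> c \<le> x \<and> x \<le> d"
      using compact_attains_inf[OF K(1) False] compact_attains_sup[OF K(1) False] by meson
    show ?thesis
    proof (rule that(1)[of c d])
      show "\<theta> x = 0" if "x \<notin> {c..d}" for x using that cd(3) K(3) by auto
    qed (use cd K(2) in auto)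
  qed
qed

lemma test_function_outside: "test_function_on S \<theta> \<Longrightarrow> x \<notin> S \<Longrightarrow> \<theta> x = 0"
  unfolding test_function_on_def by blast

lemma test_function_bounded:
  assumes "test_function_on S \<theta>"
  obtains C where "\<And>x. \<bar>\<theta> x\<bar> \<le> C"
proof -
  obtain K where K: "compact K" "\<And>x. x \<notin> K \<Longrightarrow> \<theta> x = 0"
    using assms by (auto simp: test_function_on_def)
  have "compact (\<theta> ` K)"
    using K(1) smooth_continuous_on[OF test_function_smooth[OF assms]] by (intro compact_continuous_image)
  then obtain C where C: "C > 0" "\<And>y. y \<in> \<theta> ` K \<Longrightarrow> norm y \<le> C" by (meson bounded_pos compact_imp_bounded)
  have "\<bar>\<theta> x\<bar> \<le> C" for x using C K(2)[of x] by (cases "x \<in> K") auto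
  then show ?thesis by (rule that)
qed

lemma test_function_deriv:
  assumes "test_function_on S \<theta>"
  shows "test_function_on S (deriv \<theta>)"
proof -
  obtain K where K: "compact K" "K \<subseteq> S" "\<And>x. x \<notin> K \<Longrightarrow> \<theta> x = 0"
    using assms by (auto simp: test_function_on_def)
  have "deriv \<theta> x = 0" if "x \<notin> K" for x
  proof -
    have "((\<lambda>_. 0) has_real_derivative 0) (at x)" by simp
    then have "(\<theta> has_real_derivative 0) (at x)"
      by (rule has_field_derivative_transform_within_open[where S = "- K"])
         (use that K in \<open>auto intro: compact_imp_closed\<close>)
    then show ?thesis by (rule DERIV_imp_deriv)
  qed
  then show ?thesis using smooth_deriv[OF test_function_smooth[OF assms]] K
    unfolding test_function_on_def smooth_def by blast
qed

lemma test_function_add: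
  assumes "test_function_on S f" "test_function_on S g"
  shows "test_function_on S (\<lambda>x. f x + g x)"
proof -
  obtain K where K: "compact K" "K \<subseteq> S" "\<And>x. x \<notin> K \<Longrightarrow> f x = 0"
    using assms by (auto simp: test_function_on_def)
  obtain K' where K': "compact K'" "K' \<subseteq> S" "\<And>x. x \<notin> K' \<Longrightarrow> g x = 0"
    using assms by (auto simp: test_function_on_def)
  show ?thesis
    using smooth_add[OF test_function_smooth[OF assms(1)] test_function_smooth[OF assms(2)]] K K'
    unfolding test_function_on_def smooth_def[symmetric]
    by (intro conjI exI[of _ "K \<union> K'"]) auto
qed

lemma test_function_scale:
  assumes "test_function_on S f"
  shows "test_function_on S (\<lambda>x. c * f x)"
  using smooth_affine[OF test_function_smooth[OF assms], of c 1 0] assms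
  unfolding test_function_on_def smooth_def[symmetric] by auto

lemma test_function_zero: "test_function_on S (\<lambda>x. 0)"
  using smooth_affine[OF smooth_flat, of 0] unfolding test_function_on_def smooth_def[symmetric] by auto

section \<open>Semi-inner products\<close>

text \<open>Elements of the function spaces are functions rather than classes modulo null sets, so all forms
  are only positive semidefinite, and they are bilinear on a carrier only.\<close>

locale semi_inner =
  fixes S :: "'v::real_vector set" and ip :: "'v \<Rightarrow> 'v \<Rightarrow> real"
  assumes subsp: "subspace S"
    and commute: "u \<in> S \<Longrightarrow> v \<in> S \<Longrightarrow> ip u v = ip v u"
    and add_left: "u \<in> S \<Longrightarrow> v \<in> S \<Longrightarrow> w \<in> S \<Longrightarrow> ip (u + v) w = ip u w + ip v w"
    and scale_left: "u \<in> S \<Longrightarrow> v \<in> S \<Longrightarrow> ip (c *\<^sub>R u) v = c * ip u v"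
    and nonneg: "u \<in> S \<Longrightarrow> 0 \<le> ip u u"
begin

abbreviation sq :: "'v \<Rightarrow> real" where "sq u \<equiv> ip u u"

lemma closed [simp, intro]:
  "0 \<in> S" "u \<in> S \<Longrightarrow> v \<in> S \<Longrightarrow> u + v \<in> S" "u \<in> S \<Longrightarrow> v \<in> S \<Longrightarrow> u - v \<in> S"
  "u \<in> S \<Longrightarrow> c *\<^sub>R u \<in> S" "(\<And>i. i \<in> I \<Longrightarrow> f i \<in> S) \<Longrightarrow> sum f I \<in> S"
  using subsp by (auto intro: subspace_0 subspace_add subspace_diff subspace_scale subspace_sum)

lemma add_right: "u \<in> S \<Longrightarrow> v \<in> S \<Longrightarrow> w \<in> S \<Longrightarrow> ip w (u + v) = ip w u + ip w v"
  using add_left[of u v w] commute by (metis closed(2))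

lemma scale_right: "u \<in> S \<Longrightarrow> v \<in> S \<Longrightarrow> ip v (c *\<^sub>R u) = c * ip v u"
  using scale_left[of u v c] commute by (metis closed(4))

lemma diff_left: "u \<in> S \<Longrightarrow> v \<in> S \<Longrightarrow> w \<in> S \<Longrightarrow> ip (u - v) w = ip u w - ip v w"
  using add_left[of "u - v" v w] by simp

lemma diff_right: "u \<in> S \<Longrightarrow> v \<in> S \<Longrightarrow> w \<in> S \<Longrightarrow> ip w (u - v) = ip w u - ip w v"
  using add_right[of "u - v" v w] by simp

lemma zero_left [simp]: "v \<in> S \<Longrightarrow> ip 0 v = 0"
  using scale_left[of 0 v 0] by simp

lemma zero_right [simp]: "v \<in> S \<Longrightarrow> ip v 0 = 0"
  using scale_right[of 0 v 0] by simp

lemma sum_left: "finite I \<Longrightarrow> (\<And>i. i \<in> I \<Longrightarrow> f i \<in> S) \<Longrightarrow> v \<in> S \<Longrightarrow> ip (sum f I) v = (\<Sum>i\<in>I. ip (f i) v)"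
  by (induction I rule: finite_induct) (auto simp: add_left)

lemma sum_right: "finite I \<Longrightarrow> (\<And>i. i \<in> I \<Longrightarrow> f i \<in> S) \<Longrightarrow> v \<in> S \<Longrightarrow> ip v (sum f I) = (\<Sum>i\<in>I. ip v (f i))"
  by (induction I rule: finite_induct) (auto simp: add_right)

lemmas bilinear = add_left add_right diff_left diff_right scale_left scale_right

lemma sq_add: "u \<in> S \<Longrightarrow> v \<in> S \<Longrightarrow> sq (u + v) = sq u + 2 * ip u v + sq v"
  using commute[of u v] by (simp add: bilinear)

lemma sq_diff: "u \<in> S \<Longrightarrow> v \<in> S \<Longrightarrow> sq (u - v) = sq u - 2 * ip u v + sq v"
  using commute[of u v] by (simp add: bilinear)

lemma sq_add_le: "u \<in> S \<Longrightarrow> v \<in> S \<Longrightarrow> sq (u + v) \<le> 2 * sq u + 2 * sq v"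
  using nonneg[of "u - v"] by (simp add: sq_add sq_diff)

lemma sq_scale: "u \<in> S \<Longrightarrow> sq (c *\<^sub>R u) = c\<^sup>2 * sq u"
  by (simp add: bilinear power2_eq_square)

lemma sq_minus_commute: "u \<in> S \<Longrightarrow> v \<in> S \<Longrightarrow> sq (u - v) = sq (v - u)"
  using commute[of u v] by (simp add: bilinear)

lemma cauchy_schwarz:
  assumes [simp]: "u \<in> S" "v \<in> S"
  shows "(ip u v)\<^sup>2 \<le> sq u * sq v"
proof (cases "sq v = 0")
  case True
  have "ip u v = 0"
  proof (rule ccontr)
    assume nz: "ip u v \<noteq> 0"
    define c where "c = (sq u + 1) / (2 * ip u v)"
    have "0 \<le> sq (u - c *\<^sub>R v)" by (rule nonneg) simp
    also have "\<dots> = sq u - 2 * c * ip u v"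
      using True by (simp add: sq_diff scale_left scale_right)
    also have "\<dots> = -1" using nz by (simp add: c_def field_simps)
    finally show False by simp
  qed
  then show ?thesis using True by simp
next
  case False
  then have pos: "sq v > 0" using nonneg[of v] by simp
  define c where "c = ip u v / sq v"
  have "0 \<le> sq (u - c *\<^sub>R v)" by (rule nonneg) simp
  also have "\<dots> = sq u - 2 * c * ip u v + c\<^sup>2 * sq v"
    by (simp add: sq_diff scale_left scale_right power2_eq_square)
  also have "\<dots> = sq u - (ip u v)\<^sup>2 / sq v"
    using pos by (simp add: c_def power2_eq_square field_simps)
  finally show ?thesis using pos by (simp add: field_simps)
qed

lemma abs_ip_le: "u \<in> S \<Longrightarrow> v \<in> S \<Longrightarrow> \<bar>ip u v\<bar> \<le> sqrt (sq u) * sqrt (sq v)"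
  using cauchy_schwarz[of u v] by (metis real_sqrt_abs real_sqrt_le_iff real_sqrt_mult)

lemma triangle:
  assumes [simp]: "u \<in> S" "v \<in> S"
  shows "sqrt (sq (u + v)) \<le> sqrt (sq u) + sqrt (sq v)"
proof (rule real_le_lsqrt)
  show "0 \<le> sqrt (sq u) + sqrt (sq v)" by (simp add: nonneg)
  show "sq (u + v) \<le> (sqrt (sq u) + sqrt (sq v))\<^sup>2"
    using abs_ip_le[of u v] by (simp add: sq_add power2_sum nonneg)
qed

lemma ip_eq_0_if_sq_eq_0: "u \<in> S \<Longrightarrow> v \<in> S \<Longrightarrow> sq u = 0 \<Longrightarrow> ip u v = 0"
  using abs_ip_le[of u v] by simp

lemma ip_tendsto:
  assumes "\<And>i. s i \<in> S" "p \<in> S" "v \<in> S" "((\<lambda>i. sq (s i - p)) \<longlongrightarrow> 0) F"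
  shows "((\<lambda>i. ip (s i) v) \<longlongrightarrow> ip p v) F"
proof -
  have "((\<lambda>i. ip (s i) v - ip p v) \<longlongrightarrow> 0) F"
  proof (rule Lim_null_comparison)
    show "\<forall>\<^sub>F i in F. norm (ip (s i) v - ip p v) \<le> sqrt (sq (s i - p)) * sqrt (sq v)"
      using assms abs_ip_le[of "s _ - p" v] by (auto simp: diff_left)
    show "((\<lambda>i. sqrt (sq (s i - p)) * sqrt (sq v)) \<longlongrightarrow> 0) F"
      using tendsto_mult_left_zero[OF tendsto_real_sqrt[OF assms(4), simplified]] by simp
  qed
  then show ?thesis by (simp add: LIM_zero_iff)
qed

lemma sq_tendsto:
  assumes "\<And>i. s i \<in> S" "p \<in> S" "((\<lambda>i. sq (s i - p)) \<longlongrightarrow> 0) F"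
  shows "((\<lambda>i. sq (s i)) \<longlongrightarrow> sq p) F"
proof -
  have "((\<lambda>i. sq (s i - p) + 2 * ip (s i) p - sq p) \<longlongrightarrow> 0 + 2 * ip p p - sq p) F"
    by (intro tendsto_intros assms ip_tendsto)
  moreover have "sq (s i - p) + 2 * ip (s i) p - sq p = sq (s i)" for i
    using assms by (simp add: sq_diff)
  ultimately show ?thesis by simp
qed

lemma sq_orthogonal_sum:
  assumes "finite I" "\<And>i. i \<in> I \<Longrightarrow> e i \<in> S" "\<And>i j. i \<in> I \<Longrightarrow> j \<in> I \<Longrightarrow> i \<noteq> j \<Longrightarrow> ip (e i) (e j) = 0"
  shows "sq (\<Sum>i\<in>I. c i *\<^sub>R e i) = (\<Sum>i\<in>I. (c i)\<^sup>2 * sq (e i))"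
  using assms
proof (induction I rule: finite_induct)
  case (insert i I)
  have "ip (c i *\<^sub>R e i) (\<Sum>i\<in>I. c i *\<^sub>R e i) = (\<Sum>j\<in>I. ip (c i *\<^sub>R e i) (c j *\<^sub>R e j))"
    using insert by (intro sum_right) auto
  also have "\<dots> = 0" using insert by (intro sum.neutral) (auto simp: scale_left scale_right)
  finally show ?case using insert by (subst sum.insert) (auto simp: sq_add sq_scale)
qed simp

text \<open>Stated for vectors that are not normalised and may have norm 0; in the latter case the condition on
  the coefficient is met by every \<open>c i\<close>, by the Cauchy--Schwarz inequality.\<close>

lemma bessel:
  assumes "finite I" "\<And>i. i \<in> I \<Longrightarrow> e i \<in> S" "\<And>i j. i \<in> I \<Longrightarrow> j \<in> I \<Longrightarrow> i \<noteq> j \<Longrightarrow> ip (e i) (e j) = 0"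
    and "v \<in> S" "\<And>i. i \<in> I \<Longrightarrow> ip v (e i) = c i * sq (e i)"
  shows "(\<Sum>i\<in>I. (c i)\<^sup>2 * sq (e i)) \<le> sq v"
proof -
  define p where "p = (\<Sum>i\<in>I. c i *\<^sub>R e i)"
  have [simp]: "p \<in> S" unfolding p_def using assms by auto
  have "ip v p = (\<Sum>i\<in>I. (c i)\<^sup>2 * sq (e i))"
    unfolding p_def using assms by (subst sum_right) (auto simp: scale_right power2_eq_square intro!: sum.cong)
  moreover have "sq p = (\<Sum>i\<in>I. (c i)\<^sup>2 * sq (e i))"
    unfolding p_def by (rule sq_orthogonal_sum) (use assms in auto)
  moreover have "0 \<le> sq (v - p)" using assms by (intro nonneg) auto
  ultimately show ?thesis using assms by (simp add: sq_diff)
qed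

end

text \<open>Completeness; the limit is determined up to vectors of norm 0.\<close>

locale semi_hilbert = semi_inner +
  assumes complete: "(\<And>i::nat. s i \<in> S) \<Longrightarrow>
    (\<And>\<epsilon>. \<epsilon> > 0 \<Longrightarrow> \<exists>N. \<forall>i\<ge>N. \<forall>j\<ge>N. ip (s i - s j) (s i - s j) < \<epsilon>) \<Longrightarrow>
    \<exists>p\<in>S. (\<lambda>i. ip (s i - p) (s i - p)) \<longlonglongrightarrow> 0"
begin

text \<open>Partial sums are Cauchy because orthogonality turns their distance into a section of the majorant.
  The explicit bound by its tail is what makes convergence uniform when the coefficients depend on
  time.\<close>

lemma orthogonal_series:
  assumes e: "\<And>i::nat. e i \<in> S" and orth: "\<And>i j. i \<noteq> j \<Longrightarrow> ip (e i) (e j) = 0"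
    and M: "\<And>i. (c i)\<^sup>2 * sq (e i) \<le> M i" and sM: "summable M"
  shows "\<exists>p\<in>S. \<forall>m. sq (p - (\<Sum>k<m. c k *\<^sub>R e k)) \<le> (\<Sum>k. M (k + m))"
proof -
  define P where "P m = (\<Sum>k<m. c k *\<^sub>R e k)" for m
  have [simp]: "P m \<in> S" for m unfolding P_def using e by auto
  have M0: "0 \<le> M i" for i using M[of i] nonneg[OF e[of i]] by (meson mult_nonneg_nonneg order_trans zero_le_power2)
  have dist: "sq (P n - P m) \<le> (\<Sum>k. M (k + m))" if "m \<le> n" for m n
  proof -
    have "P n - P m = (\<Sum>k=m..<n. c k *\<^sub>R e k)"
      unfolding P_def using that sum_diff_nat_ivl[of 0 m n "\<lambda>k. c k *\<^sub>R e k"]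
      by (simp add: lessThan_atLeast0)
    then have "sq (P n - P m) = (\<Sum>k=m..<n. (c k)\<^sup>2 * sq (e k))"
      using sq_orthogonal_sum[of "{m..<n}" e c] e orth by auto
    also have "\<dots> \<le> (\<Sum>k=m..<n. M k)" by (intro sum_mono M)
    also have "\<dots> = (\<Sum>k<n-m. M (k + m))"
      using sum.shift_bounds_nat_ivl[of M 0 m "n - m"] that by (simp add: lessThan_atLeast0)
    also have "\<dots> \<le> (\<Sum>k. M (k + m))"
      using sM M0 by (intro sum_le_suminf) (auto simp: summable_iff_shift)
    finally show ?thesis .
  qed
  have tail: "(\<lambda>m. \<Sum>k. M (k + m)) \<longlonglongrightarrow> 0"
    using suminf_exist_split2[OF sM] .
  have "\<exists>p\<in>S. (\<lambda>i. sq (P i - p)) \<longlonglongrightarrow> 0"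
  proof (rule complete)
    fix \<epsilon> :: real assume "\<epsilon> > 0"
    then obtain N where N: "\<And>m. m \<ge> N \<Longrightarrow> (\<Sum>k. M (k + m)) < \<epsilon>"
      using order_tendstoD(2)[OF tail] by (auto simp: eventually_sequentially)
    have "sq (P i - P j) < \<epsilon>" if "i \<ge> N" "j \<ge> N" for i j
    proof (cases "i \<le> j")
      case True
      then have "sq (P j - P i) < \<epsilon>" using dist[of i j] N[of i] that by linarith
      then show ?thesis by (simp add: sq_minus_commute[of "P i" "P j"])
    next
      case False
      then show ?thesis using dist[of j i] N[of j] that by linarith
    qed
    then show "\<exists>N. \<forall>i\<ge>N. \<forall>j\<ge>N. sq (P i - P j) < \<epsilon>" by blast
  qed simp
  then obtain p where p: "p \<in> S" "(\<lambda>i. sq (P i - p)) \<longlonglongrightarrow> 0" by blast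
  have "sq (p - P m) \<le> (\<Sum>k. M (k + m))" for m
  proof (rule LIMSEQ_le_const2)
    show "(\<lambda>n. sq (P n - P m)) \<longlonglongrightarrow> sq (p - P m)"
      by (rule sq_tendsto) (use p in \<open>auto simp: algebra_simps\<close>)
    show "\<exists>N. \<forall>n\<ge>N. sq (P n - P m) \<le> (\<Sum>k. M (k + m))" using dist by blast
  qed
  then show ?thesis using p(1) unfolding P_def by blast
qed

end

section \<open>Eigenvectors of a compact pair of forms\<close>

lemma tail_tendsto_0: "summable (M :: nat \<Rightarrow> real) \<Longrightarrow> (\<lambda>m. \<Sum>k. M (k + m)) \<longlonglongrightarrow> 0"
  by (rule suminf_exist_split2)

text \<open>The setting of the spectral theorem: a form \<open>B\<close> on \<open>V\<close> that dominates the inner product \<open>H\<close> of a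
  larger space, such that balls of \<open>B\<close> are precompact for \<open>H\<close>.\<close>

locale compact_pair = H: semi_hilbert W H + B: semi_hilbert V B
  for W :: "'v::real_vector set" and H :: "'v \<Rightarrow> 'v \<Rightarrow> real"
    and V :: "'v set" and B :: "'v \<Rightarrow> 'v \<Rightarrow> real" +
  fixes C :: real
  assumes sub: "V \<subseteq> W"
    and C_nonneg: "0 \<le> C" and poincare: "u \<in> V \<Longrightarrow> H u u \<le> C * B u u"
    and null: "u \<in> V \<Longrightarrow> H u u = 0 \<Longrightarrow> B u u = 0"
    and compact: "(\<And>i::nat. s i \<in> V) \<Longrightarrow> (\<And>i. B.sq (s i) \<le> M) \<Longrightarrow>
      \<exists>r::nat \<Rightarrow> nat. strict_mono r \<and> (\<forall>\<epsilon>>0. \<exists>N. \<forall>i\<ge>N. \<forall>j\<ge>N. H.sq (s (r i) - s (r j)) < \<epsilon>)"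
begin

lemma VW [simp, intro]: "v \<in> V \<Longrightarrow> v \<in> W" using sub by blast

lemma H_tendsto_0:
  assumes "\<And>i. s i \<in> V" "((\<lambda>i. B.sq (s i)) \<longlongrightarrow> 0) F"
  shows "((\<lambda>i. H.sq (s i)) \<longlongrightarrow> 0) F"
proof (rule tendsto_sandwich[where f = "\<lambda>_. 0"])
  show "((\<lambda>i. C * B.sq (s i)) \<longlongrightarrow> 0) F" using tendsto_mult_right_zero[OF assms(2)] .
qed (use assms(1) H.nonneg poincare in auto)

definition orth :: "'v set \<Rightarrow> 'v set" where "orth F = {v \<in> V. \<forall>f\<in>F. H f v = 0}"

lemma orthD: "v \<in> orth F \<Longrightarrow> v \<in> V" "v \<in> orth F \<Longrightarrow> f \<in> F \<Longrightarrow> H f v = 0"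
  by (auto simp: orth_def)

lemma subspace_orth: "F \<subseteq> V \<Longrightarrow> subspace (orth F)"
  unfolding orth_def subspace_def by (auto simp: H.bilinear VW subset_iff)

text \<open>A minimising sequence of the Rayleigh quotient has an \<open>H\<close>-Cauchy subsequence by compactness. By the
  parallelogram identity it is then also \<open>B\<close>-Cauchy, so the minimum is attained.\<close>

lemma minimizer_exists:
  assumes F: "F \<subseteq> V" and z: "z \<in> orth F" "H z z \<noteq> 0"
  shows "\<exists>e\<in>orth F. H e e = 1 \<and> (\<forall>v\<in>orth F. B e e * H v v \<le> B v v)"
proof -
  have N: "subspace (orth F)" by (rule subspace_orth[OF F])
  have normalise: "\<exists>w\<in>orth F. H w w = 1 \<and> B w w = B v v / H v v"
    if v: "v \<in> orth F" "H v v \<noteq> 0" for v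
  proof (intro bexI conjI)
    have [simp]: "v \<in> V" using v by (simp add: orth_def)
    have "H v v > 0" using v H.nonneg[of v] by auto
    then show "H.sq ((1 / sqrt (H v v)) *\<^sub>R v) = 1"
      "B.sq ((1 / sqrt (H v v)) *\<^sub>R v) = B v v / H v v"
      by (simp_all add: H.sq_scale B.sq_scale power_divide)
    show "(1 / sqrt (H v v)) *\<^sub>R v \<in> orth F" using N v by (simp add: subspace_scale)
  qed
  define A where "A = {B v v | v. v \<in> orth F \<and> H v v = 1}"
  define \<mu> where "\<mu> = Inf A"
  have "A \<noteq> {}" using normalise[OF z] unfolding A_def by blast
  have bdd: "bdd_below A" unfolding A_def
    by (rule bdd_belowI[of _ 0]) (auto dest!: orthD(1) intro: B.nonneg)
  have \<mu>0: "\<mu> \<ge> 0" unfolding \<mu>_def using \<open>A \<noteq> {}\<close>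
    by (intro cInf_greatest) (auto simp: A_def dest!: orthD(1) intro: B.nonneg)
  have \<mu>: "\<mu> * H v v \<le> B v v" if v: "v \<in> orth F" for v
  proof (cases "H v v = 0")
    case True
    then show ?thesis using B.nonneg[OF orthD(1)[OF v]] by simp
  next
    case False
    then have pos: "H v v > 0" using H.nonneg[OF VW[OF orthD(1)[OF v]]] by auto
    have "\<mu> \<le> B v v / H v v" unfolding \<mu>_def
      using normalise[OF v False] bdd by (intro cInf_lower) (auto simp: A_def, metis)
    then show ?thesis using pos by (simp add: field_simps)
  qed
  have "\<exists>v. v \<in> orth F \<and> H v v = 1 \<and> B v v < \<mu> + 1 / Suc n" for n
  proof -
    have "Inf A < \<mu> + 1 / Suc n" by (simp add: \<mu>_def)
    then obtain b where "b \<in> A" "b < \<mu> + 1 / Suc n" using \<open>A \<noteq> {}\<close> bdd by (meson cInf_lessD)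
    then show ?thesis unfolding A_def by blast
  qed
  then obtain s where s: "\<And>n. s n \<in> orth F" "\<And>n. H.sq (s n) = 1" "\<And>n. B.sq (s n) < \<mu> + 1 / Suc n"
    by metis
  have sV [simp]: "s n \<in> V" for n using s(1) orthD(1) by blast
  have sB: "B.sq (s n) \<le> \<mu> + 1" for n
    using s(3)[of n] by (smt (verit) divide_le_eq_1_pos of_nat_0_less_iff of_nat_1_eq_iff of_nat_Suc zero_less_Suc of_nat_0_le_iff)
  then obtain r :: "nat \<Rightarrow> nat" where r: "strict_mono r"
    and rC: "\<And>\<epsilon>. \<epsilon> > 0 \<Longrightarrow> \<exists>N. \<forall>i\<ge>N. \<forall>j\<ge>N. H.sq (s (r i) - s (r j)) < \<epsilon>"
    using compact[of s, OF sV sB] by blast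
  define w where "w i = s (r i)" for i
  have [simp]: "w i \<in> V" for i by (simp add: w_def)
  have wN: "w i \<in> orth F" and wH: "H.sq (w i) = 1" for i by (simp_all add: w_def s)
  have wB: "B.sq (w i) < \<mu> + 1 / Suc i" for i
  proof -
    have "1 / real (Suc (r i)) \<le> 1 / real (Suc i)"
      using seq_suble[OF r, of i] by (intro divide_left_mono) auto
    then show ?thesis using s(3)[of "r i"] by (simp add: w_def)
  qed
  \<comment> \<open>The parallelogram identity turns almost minimality into closeness in the energy.\<close>
  have par: "B.sq (w i - w j) \<le> 2 / Suc i + 2 / Suc j + \<mu> * H.sq (w i - w j)" for i j
  proof -
    have "\<mu> * H.sq (w i + w j) \<le> B.sq (w i + w j)"
      by (intro \<mu> subspace_add N wN)
    moreover have "H.sq (w i + w j) = 4 - H.sq (w i - w j)"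
      by (simp add: H.sq_add H.sq_diff wH)
    ultimately have "B.sq (w i - w j) \<le> 2 * B.sq (w i) + 2 * B.sq (w j) - \<mu> * (4 - H.sq (w i - w j))"
      by (simp add: B.sq_add B.sq_diff)
    then show ?thesis using wB[of i] wB[of j] by (simp add: algebra_simps)
  qed
  have "\<exists>p\<in>V. (\<lambda>i. B.sq (w i - p)) \<longlonglongrightarrow> 0"
  proof (rule B.complete)
    fix \<epsilon> :: real assume \<epsilon>: "\<epsilon> > 0"
    obtain N1 where N1: "\<And>i. i \<ge> N1 \<Longrightarrow> 1 / Suc i < \<epsilon> / 8"
      using order_tendstoD(2)[OF LIMSEQ_inverse_real_of_nat, of "\<epsilon> / 8"] \<epsilon>
      by (auto simp: eventually_sequentially inverse_eq_divide)
    obtain N2 where N2: "\<And>i j. i \<ge> N2 \<Longrightarrow> j \<ge> N2 \<Longrightarrow> H.sq (w i - w j) < \<epsilon> / (2 * (\<mu> + 1))"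
      using rC[of "\<epsilon> / (2 * (\<mu> + 1))"] \<epsilon> \<mu>0 unfolding w_def by auto
    have "B.sq (w i - w j) < \<epsilon>" if "i \<ge> max N1 N2" "j \<ge> max N1 N2" for i j
    proof -
      have "\<mu> * H.sq (w i - w j) \<le> (\<mu> + 1) * H.sq (w i - w j)"
        using H.nonneg[of "w i - w j"] by (simp add: distrib_right)
      also have "\<dots> < \<epsilon> / 2" using N2[of i j] that \<mu>0 by (simp add: field_simps)
      finally show ?thesis using par[of i j] N1[of i] N1[of j] that by simp
    qed
    then show "\<exists>N. \<forall>i\<ge>N. \<forall>j\<ge>N. B.sq (w i - w j) < \<epsilon>" by blast
  qed simp
  then obtain e where e [simp]: "e \<in> V" and lB: "(\<lambda>i. B.sq (w i - e)) \<longlonglongrightarrow> 0" by blast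
  have lH: "(\<lambda>i. H.sq (w i - e)) \<longlonglongrightarrow> 0" by (rule H_tendsto_0[OF _ lB]) simp
  have "H f e = 0" if f: "f \<in> F" for f
  proof -
    have [simp]: "f \<in> W" using f F by blast
    have "(\<lambda>i. H (w i) f) \<longlonglongrightarrow> H e f" by (rule H.ip_tendsto[OF _ _ _ lH]) simp_all
    moreover have "H (w i) f = 0" for i using orthD(2)[OF wN f] by (simp add: H.commute)
    ultimately show ?thesis by (simp add: H.commute LIMSEQ_const_iff)
  qed
  then have "e \<in> orth F" by (simp add: orth_def)
  moreover have "H e e = 1"
    using H.sq_tendsto[OF _ _ lH] by (simp add: wH LIMSEQ_const_iff)
  moreover have "B e e \<le> \<mu>"
  proof (rule LIMSEQ_le)
    show "(\<lambda>i. B.sq (w i)) \<longlonglongrightarrow> B e e" by (rule B.sq_tendsto[OF _ _ lB]) simp_all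
    show "(\<lambda>i. \<mu> + 1 / Suc i) \<longlonglongrightarrow> \<mu>"
      using LIMSEQ_inverse_real_of_nat_add by (simp add: inverse_eq_divide)
    show "\<exists>N. \<forall>n\<ge>N. B.sq (w n) \<le> \<mu> + 1 / Suc n" using wB less_imp_le by blast
  qed
  moreover have "B e e * H v v \<le> B v v" if "v \<in> orth F" for v
    using \<mu>[OF that] \<open>B e e \<le> \<mu>\<close> mult_right_mono[of "B e e" \<mu> "H v v"] H.nonneg[OF VW[OF orthD(1)[OF that]]]
    by linarith
  ultimately show ?thesis by blast
qed

text \<open>If the complement of the vectors found so far contains only vectors of \<open>H\<close>-norm 0, the zero vector is
  chosen, so that the sequence is infinite whatever the dimension of \<open>V\<close>.\<close>

definition next_eigen :: "'v set \<Rightarrow> 'v \<Rightarrow> bool" where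
  "next_eigen F e \<longleftrightarrow> e \<in> orth F \<and>
    (H e e = 1 \<and> (\<forall>v\<in>orth F. B e e * H v v \<le> B v v) \<or> e = 0 \<and> (\<forall>v\<in>orth F. H v v = 0))"

lemma next_eigen_sequence: "\<exists>e::nat \<Rightarrow> 'v. \<forall>k. next_eigen (e ` {..<k}) (e k)"
proof (rule dependent_wellorder_choice)
  show "\<exists>r. next_eigen (e ` {..<k}) r" if IH: "\<And>i. i < k \<Longrightarrow> next_eigen (e ` {..<i}) (e i)" for k :: nat and e
  proof -
    have F: "e ` {..<k} \<subseteq> V" using IH by (auto simp: next_eigen_def dest: orthD(1))
    show ?thesis
    proof (cases "\<exists>z\<in>orth (e ` {..<k}). H z z \<noteq> 0")
      case True
      then show ?thesis using minimizer_exists[OF F] unfolding next_eigen_def by blast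
    next
      case False
      then show ?thesis unfolding next_eigen_def using subspace_0[OF subspace_orth[OF F]] by blast
    qed
  qed
next
  show "next_eigen (f ` {..<k}) r = next_eigen (g ` {..<k}) r" if "\<And>i. i < k \<Longrightarrow> f i = g i" for r f g and k :: nat
  proof -
    have "f ` {..<k} = g ` {..<k}" using that by (intro image_cong) auto
    then show ?thesis by simp
  qed
qed

definition eig :: "nat \<Rightarrow> 'v" where
  "eig = (SOME e. \<forall>k. next_eigen (e ` {..<k}) (e k))"

text \<open>The value 1 at a zero vector keeps all eigenvalues positive, and frequencies can be divided by.\<close>

definition ev :: "nat \<Rightarrow> real" where
  "ev k = (if eig k = 0 then 1 else B.sq (eig k))"

lemma next_eigen_eig: "next_eigen (eig ` {..<k}) (eig k)"
  unfolding eig_def using someI_ex[OF next_eigen_sequence] by blast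

lemma eig_V [simp]: "eig k \<in> V"
  using next_eigen_eig[of k] orthD(1) unfolding next_eigen_def by blast

lemma eig_orth: "i \<noteq> j \<Longrightarrow> H (eig i) (eig j) = 0"
proof (induction i j rule: linorder_wlog)
  case (le i j)
  then show ?case using next_eigen_eig[of j] orthD(2) unfolding next_eigen_def by auto
qed (simp add: H.commute)

lemma eig_norm: "eig k \<noteq> 0 \<Longrightarrow> H.sq (eig k) = 1"
  using next_eigen_eig[of k] unfolding next_eigen_def by auto

lemma eig_sq: "H.sq (eig k) = 0 \<or> H.sq (eig k) = 1"
  using eig_norm by (cases "eig k = 0") auto

lemma eig_sq_le_1: "H.sq (eig k) \<le> 1"
  using eig_sq[of k] by auto

text \<open>Each \<open>eig k\<close> has \<open>H\<close>-norm 1 or 0, and in the second case it is the zero vector.\<close>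

lemma H_eig_mult_sq: "w \<in> W \<Longrightarrow> H w (eig k) * H.sq (eig k) = H w (eig k)"
  using eig_norm by (cases "eig k = 0") auto

lemma ev_pos: "ev k > 0"
proof (cases "eig k = 0")
  case False
  then have "B.sq (eig k) \<noteq> 0" using poincare[of "eig k"] eig_norm by auto
  then show ?thesis using False B.nonneg[of "eig k"] by (simp add: ev_def)
qed (simp add: ev_def)

text \<open>On the complement of the earlier eigenvectors this is the first variation of the minimum problem; on
  their span both sides vanish, by induction and symmetry.\<close>

lemma B_eig: "v \<in> V \<Longrightarrow> B (eig k) v = ev k * H (eig k) v"
proof (induction k arbitrary: v rule: less_induct)
  case (less k)
  show ?case
  proof (cases "eig k = 0")
    case True
    then show ?thesis using less.prems by simp
  next
    case nz: False
    define F where "F = eig ` {..<k}"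
    have F: "F \<subseteq> V" by (auto simp: F_def)
    have e: "eig k \<in> orth F" "\<And>v. v \<in> orth F \<Longrightarrow> ev k * H v v \<le> B v v"
      using next_eigen_eig[of k] nz unfolding next_eigen_def F_def ev_def by auto
    define p where "p = (\<Sum>i<k. H v (eig i) *\<^sub>R eig i)"
    have [simp]: "p \<in> V" "v \<in> V" using less.prems by (auto simp: p_def)
    have "B (eig k) p = (\<Sum>i<k. H v (eig i) * B (eig k) (eig i))"
      unfolding p_def by (subst B.sum_right) (auto simp: B.scale_right)
    also have "\<dots> = 0"
    proof (intro sum.neutral ballI)
      fix i assume "i \<in> {..<k}"
      then have "B (eig i) (eig k) = 0" using less.IH[of i "eig k"] eig_orth[of i k] by simp
      then show "H v (eig i) * B (eig k) (eig i) = 0" by (simp add: B.commute)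
    qed
    finally have Bp: "B (eig k) p = 0" .
    have "H (eig k) p = (\<Sum>i<k. H v (eig i) * H (eig k) (eig i))"
      unfolding p_def by (subst H.sum_right) (auto simp: H.scale_right)
    also have "\<dots> = 0" using eig_orth by (intro sum.neutral) auto
    finally have Hp: "H (eig k) p = 0" .
    have "H (eig i) p = H (eig i) v" if "i < k" for i
    proof -
      have "H (eig i) p = (\<Sum>j<k. H v (eig j) * H (eig i) (eig j))"
        unfolding p_def by (subst H.sum_right) (auto simp: H.scale_right)
      also have "\<dots> = (\<Sum>j<k. if j = i then H v (eig i) * H.sq (eig i) else 0)"
        using eig_orth by (intro sum.cong) auto
      also have "\<dots> = H v (eig i)" using that H_eig_mult_sq[of v i] by simp
      finally show ?thesis by (simp add: H.commute)
    qed
    then have vp: "v - p \<in> orth F" by (auto simp: orth_def F_def H.diff_right)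
    \<comment> \<open>On the complement of the earlier vectors \<open>B - ev k * H\<close> is a semi-inner product in which
        the minimiser has norm zero, so it is orthogonal to everything.\<close>
    interpret D: semi_inner "orth F" "\<lambda>u v. B u v - ev k * H u v"
    proof unfold_locales
      fix u v w and c :: real assume "u \<in> orth F"
      then have u: "u \<in> V" by (rule orthD)
      show "0 \<le> B u u - ev k * H u u" using e(2)[OF \<open>u \<in> orth F\<close>] by simp
      assume "v \<in> orth F"
      then have v: "v \<in> V" by (rule orthD)
      show "B u v - ev k * H u v = B v u - ev k * H v u" using u v by (simp add: B.commute H.commute)
      show "B (c *\<^sub>R u) v - ev k * H (c *\<^sub>R u) v = c * (B u v - ev k * H u v)"
        using u v by (simp add: B.scale_left H.scale_left algebra_simps)
      assume "w \<in> orth F"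
      then have w: "w \<in> V" by (rule orthD)
      show "B (u + v) w - ev k * H (u + v) w = B u w - ev k * H u w + (B v w - ev k * H v w)"
        using u v w by (simp add: B.add_left H.add_left algebra_simps)
    qed (rule subspace_orth[OF F])
    have "B.sq (eig k) - ev k * H.sq (eig k) = 0"
      using nz eig_norm by (simp add: ev_def)
    then have "B (eig k) (v - p) - ev k * H (eig k) (v - p) = 0"
      by (rule D.ip_eq_0_if_sq_eq_0[OF e(1) vp])
    then show ?thesis using Bp Hp by (simp add: B.diff_right H.diff_right)
  qed
qed

lemma B_eig_orth: "i \<noteq> j \<Longrightarrow> B (eig i) (eig j) = 0"
  by (simp add: B_eig eig_orth)

lemma B_eig_sq: "B.sq (eig i) = ev i * H.sq (eig i)"
  by (simp add: B_eig)

text \<open>A nonzero vector orthogonal to all \<open>eig k\<close> competes in every minimum problem, hence bounds all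
  energies \<open>B (eig k) (eig k)\<close>. Compactness then gives a Cauchy subsequence of an orthonormal
  sequence, whose members have distance \<open>\<surd>2\<close>.\<close>

lemma eig_complete:
  assumes v [simp]: "v \<in> V" and orth0: "\<And>k. H v (eig k) = 0"
  shows "H v v = 0"
proof (rule ccontr)
  assume nz: "H v v \<noteq> 0"
  have vo: "v \<in> orth (eig ` {..<k})" for k using orth0 by (auto simp: orth_def H.commute)
  have "eig k \<noteq> 0" for k using next_eigen_eig[of k] vo[of k] nz unfolding next_eigen_def by auto
  then have n1: "H.sq (eig k) = 1" for k using eig_norm by blast
  have pos: "H v v > 0" using nz H.nonneg[of v] by auto
  have Bk: "B.sq (eig k) \<le> B v v / H v v" for k
    using next_eigen_eig[of k] vo[of k] n1[of k] pos nz unfolding next_eigen_def by (auto simp: field_simps)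
  then obtain r :: "nat \<Rightarrow> nat" where r: "strict_mono r"
    and "\<And>\<epsilon>. \<epsilon> > 0 \<Longrightarrow> \<exists>N. \<forall>i\<ge>N. \<forall>j\<ge>N. H.sq (eig (r i) - eig (r j)) < \<epsilon>"
    using compact[of eig "B v v / H v v", OF eig_V Bk] by blast
  from this(2)[of 1] obtain N where N: "H.sq (eig (r N) - eig (r (Suc N))) < 1"
    by (meson le_Suc_eq less_numeral_extra(1) order_refl)
  have "r N \<noteq> r (Suc N)" using r by (metis n_not_Suc_n strict_mono_eq)
  then have "H.sq (eig (r N) - eig (r (Suc N))) = 2"
    by (simp add: H.sq_diff n1 eig_orth)
  then show False using N by simp
qed

lemma bessel_H:
  assumes "w \<in> W"
  shows "summable (\<lambda>k. (H w (eig k))\<^sup>2)"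
proof (rule bounded_imp_summable)
  fix n
  have "(\<Sum>k\<in>{..n}. (H w (eig k))\<^sup>2 * H.sq (eig k)) \<le> H w w"
    using assms by (intro H.bessel) (auto simp: eig_orth H_eig_mult_sq)
  moreover have "(H w (eig k))\<^sup>2 * H.sq (eig k) = (H w (eig k))\<^sup>2" for k
    using H_eig_mult_sq[OF assms, of k] by (simp add: power2_eq_square mult.assoc)
  ultimately show "(\<Sum>k\<le>n. (H w (eig k))\<^sup>2) \<le> H w w" by simp
qed simp

lemma bessel_B:
  assumes "v \<in> V"
  shows "summable (\<lambda>k. ev k * (H v (eig k))\<^sup>2)"
proof (rule bounded_imp_summable)
  fix n
  have hs: "H v (eig k) * H.sq (eig k) = H v (eig k)" for k using assms by (intro H_eig_mult_sq) auto
  have "(\<Sum>k\<in>{..n}. (H v (eig k))\<^sup>2 * B.sq (eig k)) \<le> B v v"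
    using assms
  proof (intro B.bessel)
    show "B v (eig k) = H v (eig k) * B.sq (eig k)" for k
      using assms hs[of k] by (simp add: B.commute[of v] B_eig H.commute algebra_simps)
  qed (auto simp: B_eig_orth)
  moreover have "(H v (eig k))\<^sup>2 * B.sq (eig k) = ev k * (H v (eig k))\<^sup>2" for k
    using hs[of k] by (simp add: B_eig_sq power2_eq_square mult.left_commute)
  ultimately show "(\<Sum>k\<le>n. ev k * (H v (eig k))\<^sup>2) \<le> B v v" by simp
qed (simp add: ev_pos less_imp_le)

lemma B_series:
  assumes "\<And>k. ev k * (c k)\<^sup>2 \<le> M k" "summable M"
  shows "\<exists>p\<in>V. \<forall>m. B.sq (p - (\<Sum>k<m. c k *\<^sub>R eig k)) \<le> (\<Sum>k. M (k + m))"
proof (rule B.orthogonal_series)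
  show "(c i)\<^sup>2 * B.sq (eig i) \<le> M i" for i
  proof -
    have "(c i)\<^sup>2 * B.sq (eig i) = (ev i * (c i)\<^sup>2) * H.sq (eig i)"
      by (simp add: B_eig_sq)
    also have "\<dots> \<le> (ev i * (c i)\<^sup>2) * 1"
      using eig_sq_le_1 ev_pos[of i] by (intro mult_left_mono) auto
    finally show ?thesis using assms(1)[of i] by simp
  qed
qed (auto simp: B_eig_orth assms)

lemma H_series:
  assumes "\<And>k. (c k)\<^sup>2 \<le> M k" "summable M"
  shows "\<exists>p\<in>W. \<forall>m. H.sq (p - (\<Sum>k<m. c k *\<^sub>R eig k)) \<le> (\<Sum>k. M (k + m))"
proof (rule H.orthogonal_series)
  show "(c i)\<^sup>2 * H.sq (eig i) \<le> M i" for i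
    using assms(1)[of i] mult_left_mono[OF eig_sq_le_1[of i], of "(c i)\<^sup>2"] by simp
qed (auto simp: eig_orth assms)

text \<open>The factor \<open>H (eig k) (eig k)\<close> accounts for zero vectors in the sequence.\<close>

lemma H_series_coeff:
  assumes [simp]: "p \<in> W" and p: "(\<lambda>m. H.sq (p - (\<Sum>k<m. c k *\<^sub>R eig k))) \<longlonglongrightarrow> 0"
  shows "H p (eig k) = c k * H.sq (eig k)"
proof -
  have "(\<lambda>m. H (\<Sum>k<m. c k *\<^sub>R eig k) (eig k)) \<longlonglongrightarrow> H p (eig k)"
  proof (rule H.ip_tendsto)
    show "(\<lambda>m. H.sq ((\<Sum>k<m. c k *\<^sub>R eig k) - p)) \<longlonglongrightarrow> 0"
      by (subst H.sq_minus_commute) (auto intro: p)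
  qed auto
  moreover have "\<forall>\<^sub>F m in sequentially. H (\<Sum>k<m. c k *\<^sub>R eig k) (eig k) = c k * H.sq (eig k)"
    using eventually_gt_at_top[of k]
  proof eventually_elim
    fix m assume "k < m"
    have "H (\<Sum>i<m. c i *\<^sub>R eig i) (eig k) = (\<Sum>i<m. c i * H (eig i) (eig k))"
      by (subst H.sum_left) (auto simp: H.scale_left)
    also have "\<dots> = (\<Sum>i<m. if i = k then c k * H.sq (eig k) else 0)"
      using eig_orth by (intro sum.cong) auto
    also have "\<dots> = c k * H.sq (eig k)" using \<open>k < m\<close> by simp
    finally show "H (\<Sum>k<m. c k *\<^sub>R eig k) (eig k) = c k * H.sq (eig k)" .
  qed
  ultimately show ?thesis by (rule LIMSEQ_unique[OF _ tendsto_eventually])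
qed

text \<open>The series of \<open>v\<close> converges in \<open>B\<close> by Bessel's inequality; its limit has the same coefficients as
  \<open>v\<close>, so it differs from \<open>v\<close> by a null vector.\<close>

lemma eig_expansion:
  assumes v: "v \<in> V"
  shows "(\<lambda>m. B.sq ((\<Sum>k<m. H v (eig k) *\<^sub>R eig k) - v)) \<longlonglongrightarrow> 0"
proof -
  define S where "S m = (\<Sum>k<m. H v (eig k) *\<^sub>R eig k)" for m
  have S: "S m \<in> V" for m by (auto simp: S_def)
  define M where "M k = ev k * (H v (eig k))\<^sup>2" for k
  have sM: "summable M" unfolding M_def using v by (rule bessel_B)
  obtain p where p: "p \<in> V" and pm: "\<And>m. B.sq (p - S m) \<le> (\<Sum>k. M (k + m))"
    using B_series[of "\<lambda>k. H v (eig k)" M] sM unfolding M_def S_def by blast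
  have limB: "(\<lambda>m. B.sq (p - S m)) \<longlonglongrightarrow> 0"
    by (rule tendsto_sandwich[OF _ _ tendsto_const tail_tendsto_0[OF sM]])
       (use p pm S in \<open>auto intro!: always_eventually B.nonneg\<close>)
  then have lim: "(\<lambda>m. H.sq (p - S m)) \<longlonglongrightarrow> 0"
    by (rule H_tendsto_0[rotated]) (use p S in auto)
  have coeff: "H p (eig k) = H v (eig k)" for k
    by (rule trans[OF H_series_coeff[OF VW[OF p] lim[unfolded S_def]] H_eig_mult_sq[OF VW[OF v]]])
  have vp: "v - p \<in> V" using v p by auto
  have "H.sq (v - p) = 0"
  proof (rule eig_complete[OF vp])
    show "H (v - p) (eig k) = 0" for k
      using coeff[of k] H.diff_left[OF VW[OF v] VW[OF p] VW[OF eig_V[of k]]] by simp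
  qed
  then have null_vp: "B.sq (v - p) = 0" by (rule null[OF vp])
  have "B.sq (S m - v) = B.sq (p - S m)" for m
  proof -
    have pS: "p - S m \<in> V" using p S by auto
    have "B.sq (S m - v) = B.sq ((v - p) + (p - S m))"
      using B.sq_minus_commute[OF S v] by simp
    also have "\<dots> = B.sq (p - S m)"
      unfolding B.sq_add[OF vp pS] using null_vp B.ip_eq_0_if_sq_eq_0[OF vp pS null_vp] by simp
    finally show ?thesis .
  qed
  then show ?thesis using limB by (simp add: S_def)
qed

text \<open>Continuous functionals on \<open>V\<close> that agree on the eigenvectors agree. With \<open>J = 0\<close> this says that a
  vector of \<open>W\<close> orthogonal to the eigenvectors is orthogonal to \<open>V\<close>.\<close>

lemma eig_determines:
  assumes p: "p \<in> W" and J: "J \<in> V" and eq: "\<And>k. H p (eig k) = B J (eig k)" and v: "v \<in> V"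
  shows "H p v = B J v"
proof -
  define S where "S m = (\<Sum>k<m. H v (eig k) *\<^sub>R eig k)" for m
  have S: "S m \<in> V" for m by (auto simp: S_def)
  have limB: "(\<lambda>m. B.sq (S m - v)) \<longlonglongrightarrow> 0" unfolding S_def by (rule eig_expansion[OF v])
  then have limH: "(\<lambda>m. H.sq (S m - v)) \<longlonglongrightarrow> 0"
    by (rule H_tendsto_0[rotated]) (use S v in auto)
  have "H (S m) p = B (S m) J" for m
  proof -
    have eq': "H (eig k) p = B (eig k) J" for k
      using eq[of k] H.commute[OF p VW[OF eig_V[of k]]] B.commute[OF J eig_V[of k]] by simp
    have "H (S m) p = (\<Sum>k<m. H (H v (eig k) *\<^sub>R eig k) p)"
      unfolding S_def using p by (intro H.sum_left) auto
    also have "\<dots> = (\<Sum>k<m. B (H v (eig k) *\<^sub>R eig k) J)"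
      using p J eq' by (intro sum.cong) (auto simp: H.scale_left B.scale_left)
    also have "\<dots> = B (S m) J" unfolding S_def using J by (intro B.sum_left[symmetric]) auto
    finally show ?thesis .
  qed
  moreover have "(\<lambda>m. H (S m) p) \<longlonglongrightarrow> H v p" by (rule H.ip_tendsto[OF _ _ p limH]) (use S v in auto)
  moreover have "(\<lambda>m. B (S m) J) \<longlonglongrightarrow> B v J" by (rule B.ip_tendsto[OF S v J limB])
  ultimately have "H v p = B v J" by (simp add: LIMSEQ_unique)
  then show ?thesis using H.commute[OF p VW[OF v]] B.commute[OF J v] by simp
qed

end

section \<open>Integrals of functions of time with values in a seminormed space\<close>

abbreviation interval_measure :: "real \<Rightarrow> real measure" where
  "interval_measure L \<equiv> lebesgue_on {0<..<L}"

lemma finite_interval_measure: "finite_measure (interval_measure L)"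
  by (rule finite_measure_lebesgue_on) (simp add: lmeasurable_interval)

abbreviation step_integrable :: "'t measure \<Rightarrow> ('t \<Rightarrow> 'b::real_vector) \<Rightarrow> bool" where
  "step_integrable \<equiv> Bochner_Integration.simple_bochner_integrable"

abbreviation step_integral :: "'t measure \<Rightarrow> ('t \<Rightarrow> 'b::real_vector) \<Rightarrow> 'b" where
  "step_integral \<equiv> Bochner_Integration.simple_bochner_integral"

locale seminormed =
  fixes X :: "'b::real_vector set" and N :: "'b \<Rightarrow> real"
  assumes subsp: "subspace X"
    and triangle: "u \<in> X \<Longrightarrow> v \<in> X \<Longrightarrow> N (u + v) \<le> N u + N v"
    and scale: "u \<in> X \<Longrightarrow> N (c *\<^sub>R u) = \<bar>c\<bar> * N u"
begin

lemma closed [simp, intro]: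
  "0 \<in> X" "u \<in> X \<Longrightarrow> v \<in> X \<Longrightarrow> u + v \<in> X" "u \<in> X \<Longrightarrow> v \<in> X \<Longrightarrow> u - v \<in> X"
  "u \<in> X \<Longrightarrow> c *\<^sub>R u \<in> X" "(\<And>i. i \<in> I \<Longrightarrow> f i \<in> X) \<Longrightarrow> sum f I \<in> X"
  using subsp by (auto intro: subspace_0 subspace_add subspace_diff subspace_scale subspace_sum)

lemma N_zero [simp]: "N 0 = 0"
  using scale[of 0 0] by simp

lemma N_minus: "u \<in> X \<Longrightarrow> N (- u) = N u"
  using scale[of u "-1"] by simp

lemma N_minus_commute: "u \<in> X \<Longrightarrow> v \<in> X \<Longrightarrow> N (u - v) = N (v - u)"
  using N_minus[of "u - v"] by simp

lemma N_nonneg: "u \<in> X \<Longrightarrow> 0 \<le> N u"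
  using triangle[of u "-u"] N_minus[of u] closed(4)[of u "-1"] by simp

lemma triangle3: "u \<in> X \<Longrightarrow> v \<in> X \<Longrightarrow> w \<in> X \<Longrightarrow> N (u - w) \<le> N (u - v) + N (v - w)"
  using triangle[of "u - v" "v - w"] by simp

lemma N_diff_add: "a \<in> X \<Longrightarrow> b \<in> X \<Longrightarrow> c \<in> X \<Longrightarrow> d \<in> X \<Longrightarrow> N ((a + b) - (c + d)) \<le> N (a - c) + N (b - d)"
  using triangle[of "a - c" "b - d"] by (simp add: algebra_simps)

lemma N_diff_abs: "u \<in> X \<Longrightarrow> v \<in> X \<Longrightarrow> \<bar>N u - N v\<bar> \<le> N (u - v)"
  using triangle[of "u - v" v] triangle[of "v - u" u] N_minus_commute[of u v] by simp

lemma simple_in_mem: "simple_in M X s \<Longrightarrow> t \<in> space M \<Longrightarrow> s t \<in> X"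
  by (auto simp: simple_in_def)

lemma simple_integral_mem:
  assumes "simple_in M X s"
  shows "step_integral M s \<in> X"
  unfolding simple_bochner_integral_def using assms by (auto simp: simple_in_def)

lemma simple_integral_linear_on:
  assumes s: "simple_in M X s"
    and add: "\<And>u v. u \<in> X \<Longrightarrow> v \<in> X \<Longrightarrow> \<Lambda> (u + v) = \<Lambda> u + \<Lambda> v"
    and sc: "\<And>c u. u \<in> X \<Longrightarrow> \<Lambda> (c *\<^sub>R u) = c *\<^sub>R \<Lambda> u"
  shows "step_integrable M (\<lambda>t. \<Lambda> (s t) :: 'c::real_vector)"
    and "step_integral M (\<lambda>t. \<Lambda> (s t)) = \<Lambda> (step_integral M s)"
proof -
  have \<Lambda>0: "\<Lambda> 0 = 0" using sc[of 0 0] by simp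
  show sb: "step_integrable M (\<lambda>t. \<Lambda> (s t))"
    using s \<Lambda>0 simple_bochner_integrable_compose2[of "\<lambda>x _. \<Lambda> x" M "s" "s"] by (simp add: simple_in_def)
  have fin: "finite (s ` space M)" "s ` space M \<subseteq> X" using s
    by (auto simp: simple_in_def simple_function_def elim: simple_bochner_integrable.cases)
  have "step_integral M (\<lambda>t. \<Lambda> (s t)) =
    (\<Sum>y\<in>s ` space M. measure M {x\<in>space M. s x = y} *\<^sub>R \<Lambda> y)"
    using s by (intro simple_bochner_integral_partition sb)
      (auto simp: simple_in_def elim: simple_bochner_integrable.cases)
  also have "\<dots> = \<Lambda> (step_integral M s)"
  proof -
    have "finite A \<Longrightarrow> A \<subseteq> X \<Longrightarrow> \<Lambda> (\<Sum>y\<in>A. \<mu> y *\<^sub>R y) = (\<Sum>y\<in>A. \<mu> y *\<^sub>R \<Lambda> y)" for A and \<mu> :: "'b \<Rightarrow> real"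
    proof (induction A rule: finite_induct)
      case (insert y A)
      have "(\<Sum>y\<in>A. \<mu> y *\<^sub>R y) \<in> X" using insert.prems by auto
      then show ?case using insert by (simp add: add sc)
    qed (simp add: \<Lambda>0)
    from this[OF fin] show ?thesis unfolding simple_bochner_integral_def by simp
  qed
  finally show "step_integral M (\<lambda>t. \<Lambda> (s t)) = \<Lambda> (step_integral M s)" .
qed

text \<open>The integrands of the existence proof are uniform limits of step functions with values in \<open>X\<close>. For
  these the vector-valued integral can be approximated along with the function, and the notion is
  stable under sums, uniform limits and bounded linear maps.\<close>

definition uniform_integral :: "'t measure \<Rightarrow> ('t \<Rightarrow> 'b) \<Rightarrow> 'b \<Rightarrow> bool" where
  "uniform_integral M f I \<longleftrightarrow> (\<forall>t\<in>space M. f t \<in> X) \<and> I \<in> X \<and>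
    (\<forall>\<epsilon>>0. \<exists>s. simple_in M X s \<and> (\<forall>t\<in>space M. N (f t - s t) \<le> \<epsilon>) \<and>
      N (step_integral M s - I) \<le> \<epsilon>)"

lemma uniform_integral_memD: "uniform_integral M f I \<Longrightarrow> t \<in> space M \<Longrightarrow> f t \<in> X"
  by (auto simp: uniform_integral_def)

lemma uniform_integral_seq:
  assumes "uniform_integral M f I"
  obtains s where "\<And>i::nat. simple_in M X (s i)" "\<And>i t. t \<in> space M \<Longrightarrow> N (f t - s i t) \<le> inverse (real (Suc i))"
    "\<And>i. N (step_integral M (s i) - I) \<le> inverse (real (Suc i))"
proof -
  have "\<exists>s. simple_in M X s \<and> (\<forall>t\<in>space M. N (f t - s t) \<le> inverse (real (Suc i))) \<and>
      N (step_integral M s - I) \<le> inverse (real (Suc i))" for i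
    using assms unfolding uniform_integral_def by (auto dest: spec[of _ "inverse (real (Suc i))"])
  then show ?thesis using that by metis
qed

lemma uniform_integral_strongly_measurable:
  assumes f: "uniform_integral M f I"
  shows "strongly_measurable M X N f"
proof -
  obtain s where s: "\<And>i::nat. simple_in M X (s i)" "\<And>i t. t \<in> space M \<Longrightarrow> N (f t - s i t) \<le> inverse (real (Suc i))"
    using f by (rule uniform_integral_seq) blast
  have "(\<lambda>i. N (f t - s i t)) \<longlonglongrightarrow> 0" if t: "t \<in> space M" for t
  proof (rule tendsto_sandwich[OF _ _ tendsto_const LIMSEQ_inverse_real_of_nat])
    show "\<forall>\<^sub>F i in sequentially. 0 \<le> N (f t - s i t)"
      using t simple_in_mem[OF s(1) t] uniform_integral_memD[OF f t] by (intro always_eventually allI N_nonneg) auto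
    show "\<forall>\<^sub>F i in sequentially. N (f t - s i t) \<le> inverse (real (Suc i))" using s(2)[OF t] by simp
  qed
  then show ?thesis
    unfolding strongly_measurable_def using s(1) uniform_integral_memD[OF f] by (auto intro!: AE_I2 exI[of _ s])
qed

lemma uniform_integral_N_measurable:
  assumes f: "uniform_integral M f I"
  shows "(\<lambda>t. N (f t)) \<in> borel_measurable M"
proof -
  obtain s where s: "\<And>i::nat. simple_in M X (s i)" "\<And>i t. t \<in> space M \<Longrightarrow> N (f t - s i t) \<le> inverse (real (Suc i))"
    using f by (rule uniform_integral_seq) blast
  show ?thesis
  proof (rule borel_measurable_LIMSEQ_metric)
    show "(\<lambda>t. N (s i t)) \<in> borel_measurable M" for i
    proof (rule borel_measurable_simple_function)
      have "simple_function M (s i)" using s(1)[of i]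
        by (auto simp: simple_in_def elim: simple_bochner_integrable.cases)
      then show "simple_function M (\<lambda>t. N (s i t))" by (rule simple_function_compose1)
    qed
    show "(\<lambda>i. N (s i t)) \<longlonglongrightarrow> N (f t)" if t: "t \<in> space M" for t
    proof -
      have "(\<lambda>i. N (s i t) - N (f t)) \<longlonglongrightarrow> 0"
      proof (rule Lim_null_comparison[OF _ LIMSEQ_inverse_real_of_nat])
        show "\<forall>\<^sub>F i in sequentially. norm (N (s i t) - N (f t)) \<le> inverse (real (Suc i))"
        proof (intro always_eventually allI)
          fix i
          have "norm (N (s i t) - N (f t)) \<le> N (f t - s i t)"
            using N_diff_abs[of "f t" "s i t"] simple_in_mem[OF s(1) t] uniform_integral_memD[OF f t] by simp
          then show "norm (N (s i t) - N (f t)) \<le> inverse (real (Suc i))" using s(2)[OF t, of i] by linarith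
        qed
      qed
      then show ?thesis by (simp add: LIM_zero_iff)
    qed
  qed
qed

lemma uniform_integral_has_integral_in:
  assumes f: "uniform_integral M f I" and M: "finite_measure M"
  shows "has_integral_in M X N f I"
proof -
  interpret finite_measure M by fact
  obtain s where s: "\<And>i::nat. simple_in M X (s i)" "\<And>i t. t \<in> space M \<Longrightarrow> N (f t - s i t) \<le> inverse (real (Suc i))"
    "\<And>i. N (step_integral M (s i) - I) \<le> inverse (real (Suc i))"
    using f by (rule uniform_integral_seq) blast
  have "(\<lambda>i. \<integral>\<^sup>+t. ennreal (N (f t - s i t)) \<partial>M) \<longlonglongrightarrow> 0"
  proof (rule tendsto_sandwich[OF _ _ tendsto_const])
    show "\<forall>\<^sub>F i in sequentially. (\<integral>\<^sup>+t. ennreal (N (f t - s i t)) \<partial>M) \<le> ennreal (inverse (real (Suc i)) * measure M (space M))"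
    proof (intro always_eventually allI)
      fix i
      have "(\<integral>\<^sup>+t. ennreal (N (f t - s i t)) \<partial>M) \<le> (\<integral>\<^sup>+t. ennreal (inverse (real (Suc i))) \<partial>M)"
        using s(2) by (intro nn_integral_mono ennreal_leI)
      also have "\<dots> = ennreal (inverse (real (Suc i)) * measure M (space M))"
        by (simp add: emeasure_eq_measure ennreal_mult)
      finally show "(\<integral>\<^sup>+t. ennreal (N (f t - s i t)) \<partial>M) \<le> ennreal (inverse (real (Suc i)) * measure M (space M))" .
    qed
    have "(\<lambda>i. inverse (real (Suc i)) * measure M (space M)) \<longlonglongrightarrow> 0"
      by (rule tendsto_mult_left_zero[OF LIMSEQ_inverse_real_of_nat])
    from tendsto_ennrealI[OF this] show "(\<lambda>i. ennreal (inverse (real (Suc i)) * measure M (space M))) \<longlonglongrightarrow> 0" by simp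
  qed simp
  moreover have "(\<lambda>i. N (step_integral M (s i) - I)) \<longlonglongrightarrow> 0"
  proof (rule tendsto_sandwich[OF _ _ tendsto_const LIMSEQ_inverse_real_of_nat])
    show "\<forall>\<^sub>F i in sequentially. 0 \<le> N (step_integral M (s i) - I)"
      using simple_integral_mem[OF s(1)] f by (intro always_eventually allI N_nonneg) (auto simp: uniform_integral_def)
  qed (use s(3) in auto)
  ultimately show ?thesis
    using s(1) f uniform_integral_strongly_measurable[OF f]
    unfolding has_integral_in_def uniform_integral_def by blast
qed

lemma simple_in_add: 
  assumes "simple_in M X s" "simple_in M X s'" shows "simple_in M X (\<lambda>t. s t + s' t)"
  using assms by (auto simp: simple_in_def intro: simple_bochner_integrable_compose2)

lemma uniform_integral_zero: "uniform_integral M (\<lambda>t. 0) 0"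
  unfolding uniform_integral_def
proof (intro conjI allI impI exI[of _ "\<lambda>_. 0"])
  show "simple_in M X (\<lambda>_. 0)" by (auto simp: simple_in_def intro!: simple_bochner_integrable.intros)
qed (auto simp: simple_bochner_integral_def image_constant_conv)

lemma uniform_integral_add:
  assumes f: "uniform_integral M f I" and g: "uniform_integral M g J"
  shows "uniform_integral M (\<lambda>t. f t + g t) (I + J)"
  unfolding uniform_integral_def
proof (intro conjI allI impI)
  fix \<epsilon> :: real assume "\<epsilon> > 0"
  then have e: "\<epsilon> / 2 > 0" by simp
  obtain s where s: "simple_in M X s" "\<And>t. t \<in> space M \<Longrightarrow> N (f t - s t) \<le> \<epsilon> / 2"
      "N (step_integral M s - I) \<le> \<epsilon> / 2"
    using f e unfolding uniform_integral_def by meson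
  obtain s' where s': "simple_in M X s'" "\<And>t. t \<in> space M \<Longrightarrow> N (g t - s' t) \<le> \<epsilon> / 2"
      "N (step_integral M s' - J) \<le> \<epsilon> / 2"
    using g e unfolding uniform_integral_def by meson
  have I: "I \<in> X" "J \<in> X" using f g by (auto simp: uniform_integral_def)
  show "\<exists>s. simple_in M X s \<and> (\<forall>t\<in>space M. N (f t + g t - s t) \<le> \<epsilon>) \<and>
             N (step_integral M s - (I + J)) \<le> \<epsilon>"
  proof (intro exI[of _ "\<lambda>t. s t + s' t"] conjI ballI)
    show "simple_in M X (\<lambda>t. s t + s' t)" using s s' by (intro simple_in_add)
    show "N (f t + g t - (s t + s' t)) \<le> \<epsilon>" if t: "t \<in> space M" for t
      using N_diff_add[OF uniform_integral_memD[OF f t] uniform_integral_memD[OF g t] simple_in_mem[OF s(1) t] simple_in_mem[OF s'(1) t]]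
        s(2)[OF t] s'(2)[OF t] by linarith
    have sum_eq: "step_integral M (\<lambda>t. s t + s' t)
      = step_integral M s + step_integral M s'"
      using s s' by (intro simple_bochner_integral_add) (auto simp: simple_in_def)
    show "N (step_integral M (\<lambda>t. s t + s' t) - (I + J)) \<le> \<epsilon>"
      unfolding sum_eq using N_diff_add[OF simple_integral_mem[OF s(1)] simple_integral_mem[OF s'(1)] I] s(3) s'(3) by linarith
  qed
qed (use f g in \<open>auto simp: uniform_integral_def\<close>)

lemma uniform_integral_scaleR:
  fixes g :: "'t \<Rightarrow> real"
  assumes M: "finite_measure M" and g [measurable]: "g \<in> borel_measurable M"
    and bd: "\<And>t. t \<in> space M \<Longrightarrow> \<bar>g t\<bar> \<le> K" and x: "x \<in> X"
  shows "uniform_integral M (\<lambda>t. g t *\<^sub>R x) ((LINT t|M. g t) *\<^sub>R x)"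
  unfolding uniform_integral_def
proof (intro conjI allI impI)
  interpret finite_measure M by fact
  have g_int: "integrable M g" by (rule integrable_const_bound[of _ K]) (use bd in auto)
  fix \<epsilon> :: real assume \<epsilon>: "\<epsilon> > 0"
  define \<mu> where "\<mu> = measure M (space M)"
  have \<mu>: "\<mu> \<ge> 0" by (simp add: \<mu>_def)
  \<comment> \<open>Rounding down to a multiple of \<open>\<delta>\<close> approximates \<open>g\<close> uniformly.\<close>
  \<comment> \<open>The summands 1 avoid division by zero for a null space or a vector of norm 0.\<close>
  define \<delta> where "\<delta> = \<epsilon> / ((\<mu> + 1) * (N x + 1))"
  have Nx: "N x \<ge> 0" by (rule N_nonneg[OF x])
  have \<delta>: "\<delta> > 0" using \<epsilon> \<mu> Nx by (simp add: \<delta>_def)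
  define s where "s t = \<delta> * real_of_int \<lfloor>g t / \<delta>\<rfloor>" for t
  have gs: "\<bar>g t - s t\<bar> \<le> \<delta>" for t
  proof -
    have "0 \<le> g t / \<delta> - real_of_int \<lfloor>g t / \<delta>\<rfloor>" "g t / \<delta> - real_of_int \<lfloor>g t / \<delta>\<rfloor> \<le> 1" by linarith+
    then have "\<bar>g t / \<delta> - real_of_int \<lfloor>g t / \<delta>\<rfloor>\<bar> \<le> 1" by simp
    then have "\<delta> * \<bar>g t / \<delta> - real_of_int \<lfloor>g t / \<delta>\<rfloor>\<bar> \<le> \<delta> * 1" using \<delta> by (intro mult_left_mono) auto
    moreover have "\<delta> * \<bar>g t / \<delta> - real_of_int \<lfloor>g t / \<delta>\<rfloor>\<bar> = \<bar>g t - s t\<bar>"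
    proof -
      have "g t - s t = \<delta> * (g t / \<delta> - real_of_int \<lfloor>g t / \<delta>\<rfloor>)" using \<delta> by (simp add: s_def right_diff_distrib)
      then show ?thesis using \<delta> by (simp add: abs_mult)
    qed
    ultimately show ?thesis by simp
  qed
  have sm [measurable]: "s \<in> borel_measurable M" unfolding s_def by measurable
  have "s ` space M \<subseteq> (\<lambda>i. \<delta> * real_of_int i) ` {\<lfloor>- K / \<delta>\<rfloor>..\<lfloor>K / \<delta>\<rfloor>}"
  proof
    fix y assume "y \<in> s ` space M"
    then obtain t where "t \<in> space M" and y: "y = s t" by blast
    then have "- K \<le> g t" "g t \<le> K" using bd[of t] by auto
    then have "- K / \<delta> \<le> g t / \<delta>" "g t / \<delta> \<le> K / \<delta>"
      using divide_right_mono[of "- K" "g t" \<delta>] divide_right_mono[of "g t" K \<delta>] \<delta> by simp_all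
    then have "\<lfloor>g t / \<delta>\<rfloor> \<in> {\<lfloor>- K / \<delta>\<rfloor>..\<lfloor>K / \<delta>\<rfloor>}" by (auto intro: floor_mono)
    then show "y \<in> (\<lambda>i. \<delta> * real_of_int i) ` {\<lfloor>- K / \<delta>\<rfloor>..\<lfloor>K / \<delta>\<rfloor>}" unfolding y s_def by blast
  qed
  then have "finite (s ` space M)" by (rule finite_subset) simp
  then have sf: "simple_function M s" using sm by (intro simple_function_borel_measurable)
  then have sb: "step_integrable M s"
    by (rule simple_bochner_integrable.intros) (simp add: emeasure_eq_measure)
  have s_int: "integrable M s" "(LINT t|M. s t) = step_integral M s"
    using has_bochner_integral_simple_bochner_integrable[OF sb] by (auto simp: has_bochner_integral_iff)
  have lin: "linear (\<lambda>r. r *\<^sub>R x)" by (simp add: linear_iff scaleR_add_left)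
  show "\<exists>s. simple_in M X s \<and> (\<forall>t\<in>space M. N (g t *\<^sub>R x - s t) \<le> \<epsilon>) \<and>
             N (step_integral M s - (LINT t|M. g t) *\<^sub>R x) \<le> \<epsilon>"
  proof (intro exI[of _ "\<lambda>t. s t *\<^sub>R x"] conjI ballI)
    show "simple_in M X (\<lambda>t. s t *\<^sub>R x)" using x
      by (auto simp: simple_in_def intro: simple_bochner_integrable_compose2[of "\<lambda>r _. r *\<^sub>R x", OF _ sb sb])
    have \<delta>1: "\<delta> * N x \<le> \<epsilon>" "\<delta> * \<mu> * N x \<le> \<epsilon>"
    proof -
      have "\<delta> * (N x) \<le> \<delta> * ((\<mu> + 1) * (N x + 1))" "\<delta> * (\<mu> * N x) \<le> \<delta> * ((\<mu> + 1) * (N x + 1))"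
        using \<delta> \<mu> Nx by (intro mult_left_mono, auto simp: algebra_simps)+
      moreover have "\<delta> * ((\<mu> + 1) * (N x + 1)) = \<epsilon>" using \<mu> Nx by (simp add: \<delta>_def)
      ultimately show "\<delta> * N x \<le> \<epsilon>" "\<delta> * \<mu> * N x \<le> \<epsilon>" by (simp_all add: mult.assoc)
    qed
    show "N (g t *\<^sub>R x - s t *\<^sub>R x) \<le> \<epsilon>" for t
    proof -
      have "N (g t *\<^sub>R x - s t *\<^sub>R x) = \<bar>g t - s t\<bar> * N x" using x by (simp add: scaleR_diff_left[symmetric] scale)
      also have "\<dots> \<le> \<delta> * N x" using gs Nx by (intro mult_right_mono)
      finally show ?thesis using \<delta>1 by simp
    qed
    have "\<bar>(LINT t|M. s t) - (LINT t|M. g t)\<bar> = \<bar>LINT t|M. s t - g t\<bar>"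
      using g_int s_int by simp
    also have "\<dots> \<le> (LINT t|M. \<bar>s t - g t\<bar>)" by (rule integral_abs_bound)
    also have "\<dots> \<le> (LINT t|M. \<delta>)"
      using g_int s_int gs by (intro integral_mono) (auto simp: abs_minus_commute)
    also have "\<dots> = \<delta> * \<mu>" by (simp add: \<mu>_def)
    finally have "\<bar>(LINT t|M. s t) - (LINT t|M. g t)\<bar> * N x \<le> \<delta> * \<mu> * N x" using Nx by (intro mult_right_mono)
    then show "N (step_integral M (\<lambda>t. s t *\<^sub>R x) - (LINT t|M. g t) *\<^sub>R x) \<le> \<epsilon>"
      using x \<delta>1 by (simp add: simple_bochner_integral_linear[OF lin sb] s_int(2) scaleR_diff_left[symmetric] scale)
  qed
qed (use x in auto)

lemma uniform_integral_sum:
  fixes g :: "nat \<Rightarrow> 't \<Rightarrow> real"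
  assumes M: "finite_measure M" and g: "\<And>k. g k \<in> borel_measurable M"
    and bd: "\<And>k t. t \<in> space M \<Longrightarrow> \<bar>g k t\<bar> \<le> K k" and x: "\<And>k. x k \<in> X"
  shows "uniform_integral M (\<lambda>t. \<Sum>k<m. g k t *\<^sub>R x k) (\<Sum>k<m. (LINT t|M. g k t) *\<^sub>R x k)"
proof (induction m)
  case (Suc m)
  then show ?case
    using uniform_integral_add[OF Suc uniform_integral_scaleR[OF M g bd x]] by simp
qed (simp add: uniform_integral_zero)

lemma uniform_integral_limit:
  assumes f: "\<And>m::nat. uniform_integral M (f m) (I m)"
    and g: "\<And>t. t \<in> space M \<Longrightarrow> g t \<in> X" and J: "J \<in> X"
    and fg: "\<And>m t. t \<in> space M \<Longrightarrow> N (g t - f m t) \<le> \<delta> m" and IJ: "\<And>m. N (J - I m) \<le> \<delta>' m"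
    and \<delta>: "\<delta> \<longlonglongrightarrow> 0" "\<delta>' \<longlonglongrightarrow> 0"
  shows "uniform_integral M g J"
  unfolding uniform_integral_def
proof (intro conjI allI impI)
  fix \<epsilon> :: real assume "\<epsilon> > 0"
  then have e: "\<epsilon> / 2 > 0" by simp
  obtain m where m: "\<delta> m < \<epsilon> / 2" "\<delta>' m < \<epsilon> / 2"
    using eventually_conj[OF order_tendstoD(2)[OF \<delta>(1) e] order_tendstoD(2)[OF \<delta>(2) e]]
    by (auto simp: eventually_sequentially)
  obtain s where s: "simple_in M X s" "\<And>t. t \<in> space M \<Longrightarrow> N (f m t - s t) \<le> \<epsilon> / 2"
      "N (step_integral M s - I m) \<le> \<epsilon> / 2"
    using f[of m] e unfolding uniform_integral_def by meson
  have I: "I m \<in> X" using f by (auto simp: uniform_integral_def)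
  show "\<exists>s. simple_in M X s \<and> (\<forall>t\<in>space M. N (g t - s t) \<le> \<epsilon>) \<and>
             N (step_integral M s - J) \<le> \<epsilon>"
  proof (intro exI[of _ s] conjI ballI s)
    show "N (g t - s t) \<le> \<epsilon>" if t: "t \<in> space M" for t
      using triangle3[OF g[OF t] uniform_integral_memD[OF f[of m] t] simple_in_mem[OF s(1) t]] fg[OF t, of m] s(2)[OF t] m
      by linarith
    show "N (step_integral M s - J) \<le> \<epsilon>"
      using triangle3[OF simple_integral_mem[OF s(1)] I J] N_minus_commute[OF I J] IJ[of m] s(3) m by linarith
  qed
qed (use g J in auto)

end

text \<open>Lebesgue measure is complete, so the values on the exceptional null set do not matter.\<close>

lemma borel_measurable_AE_limit:
  fixes f :: "nat \<Rightarrow> 'a::euclidean_space \<Rightarrow> real"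
  assumes S: "S \<in> sets lebesgue" and f [measurable]: "\<And>i. f i \<in> borel_measurable (lebesgue_on S)"
    and lim: "AE x in lebesgue_on S. (\<lambda>i. f i x) \<longlonglongrightarrow> g x"
  shows "g \<in> borel_measurable (lebesgue_on S)"
proof -
  define h where "h x = lim (\<lambda>i. f i x)" for x
  have h: "h \<in> borel_measurable (lebesgue_on S)" unfolding h_def by measurable
  have "AE x in lebesgue_on S. h x = g x" using lim by eventually_elim (simp add: h_def limI)
  then have "AE x in lebesgue. (if x \<in> S then h x else 0) = (if x \<in> S then g x else 0)"
    using S by (subst (asm) AE_restrict_space_iff) (auto elim: eventually_mono)
  moreover have "(\<lambda>x. if x \<in> S then h x else 0) \<in> borel_measurable lebesgue"
    using h S by (simp add: borel_measurable_if)
  ultimately have "(\<lambda>x. if x \<in> S then g x else 0) \<in> borel_measurable lebesgue"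
    by (rule borel_measurable_AE[rotated])
  then show ?thesis using S by (simp add: borel_measurable_if)
qed

context seminormed
begin

lemma strongly_measurable_functional:
  assumes S: "S \<in> sets lebesgue" and f: "strongly_measurable (lebesgue_on S) X N f"
    and diff: "\<And>u v. u \<in> X \<Longrightarrow> v \<in> X \<Longrightarrow> \<bar>\<Lambda> u - \<Lambda> v\<bar> \<le> C * N (u - v)"
  shows "(\<lambda>t. \<Lambda> (f t)) \<in> borel_measurable (lebesgue_on (S :: real set))"
proof -
  obtain s where s: "\<And>i::nat. simple_in (lebesgue_on S) X (s i)"
    and lim: "AE t in lebesgue_on S. (\<lambda>i. N (f t - s i t)) \<longlonglongrightarrow> 0" and fX: "AE t in lebesgue_on S. f t \<in> X"
    using f unfolding strongly_measurable_def by blast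
  show ?thesis
  proof (rule borel_measurable_AE_limit[OF S])
    show "(\<lambda>t. \<Lambda> (s i t)) \<in> borel_measurable (lebesgue_on S)" for i
    proof (rule borel_measurable_simple_function)
      have "simple_function (lebesgue_on S) (s i)" using s(1)[of i]
        by (auto simp: simple_in_def elim: simple_bochner_integrable.cases)
      then show "simple_function (lebesgue_on S) (\<lambda>t. \<Lambda> (s i t))" by (rule simple_function_compose1)
    qed
    show "AE t in lebesgue_on S. (\<lambda>i. \<Lambda> (s i t)) \<longlonglongrightarrow> \<Lambda> (f t)"
      using lim fX AE_space
    proof eventually_elim
      case (elim t)
      have "(\<lambda>i. \<Lambda> (s i t) - \<Lambda> (f t)) \<longlonglongrightarrow> 0"
      proof (rule Lim_null_comparison)
        show "(\<lambda>i. C * N (f t - s i t)) \<longlonglongrightarrow> 0" using tendsto_mult_right_zero[OF elim(1)] .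
        have "norm (\<Lambda> (s i t) - \<Lambda> (f t)) \<le> C * N (f t - s i t)" for i
          using diff[OF elim(2) simple_in_mem[OF s elim(3), of i]] by (simp add: abs_minus_commute)
        then show "\<forall>\<^sub>F i in sequentially. norm (\<Lambda> (s i t) - \<Lambda> (f t)) \<le> C * N (f t - s i t)" by simp
      qed
      then show ?case by (simp add: LIM_zero_iff)
    qed
  qed
qed

text \<open>A bounded functional commutes with the integral, because it maps an approximating sequence of step
  functions to one in the sense of the scalar Bochner integral.\<close>

lemma has_integral_in_functional:
  assumes S: "S \<in> sets lebesgue" and f: "has_integral_in (lebesgue_on S) X N f I"
    and add: "\<And>u v. u \<in> X \<Longrightarrow> v \<in> X \<Longrightarrow> \<Lambda> (u + v) = \<Lambda> u + \<Lambda> v"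
    and sc: "\<And>c u. u \<in> X \<Longrightarrow> \<Lambda> (c *\<^sub>R u) = c * \<Lambda> u"
    and bd: "\<And>u. u \<in> X \<Longrightarrow> \<bar>\<Lambda> u\<bar> \<le> C * N u"
  shows "has_bochner_integral (lebesgue_on (S :: real set)) (\<lambda>t. \<Lambda> (f t)) (\<Lambda> I :: real)"
proof -
  define M where "M = lebesgue_on S"
  have sm: "strongly_measurable M X N f" and I: "I \<in> X"
    using f by (auto simp: has_integral_in_def M_def)
  obtain s where s: "\<And>i::nat. simple_in M X (s i)"
    and lim: "(\<lambda>i. \<integral>\<^sup>+t. ennreal (N (f t - s i t)) \<partial>M) \<longlonglongrightarrow> 0"
    and Ilim: "(\<lambda>i. N (step_integral M (s i) - I)) \<longlonglongrightarrow> 0"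
    using f unfolding has_integral_in_def M_def by blast
  have fX: "AE t in M. f t \<in> X" using sm by (auto simp: strongly_measurable_def)
  have \<Lambda>diff: "\<Lambda> (u - v) = \<Lambda> u - \<Lambda> v" if "u \<in> X" "v \<in> X" for u v
    using add[of "u - v" v] that by simp
  have diff: "\<bar>\<Lambda> u - \<Lambda> v\<bar> \<le> C * N (u - v)" if "u \<in> X" "v \<in> X" for u v
    using bd[of "u - v"] \<Lambda>diff[OF that] that by simp
  have sc': "\<Lambda> (c *\<^sub>R u) = c *\<^sub>R \<Lambda> u" if "u \<in> X" for c u using sc[OF that] by simp
  note sb = simple_integral_linear_on(1)[OF s add sc'] and sbi = simple_integral_linear_on(2)[OF s add sc']
  have "has_bochner_integral M (\<lambda>t. \<Lambda> (f t)) (\<Lambda> I)"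
  proof (rule has_bochner_integral.intros)
    show "(\<lambda>t. \<Lambda> (f t)) \<in> borel_measurable M"
      unfolding M_def using strongly_measurable_functional[OF S sm[unfolded M_def] diff] .
    show "step_integrable M (\<lambda>t. \<Lambda> (s i t))" for i by (rule sb)
    show "(\<lambda>i. step_integral M (\<lambda>t. \<Lambda> (s i t))) \<longlonglongrightarrow> \<Lambda> I"
    proof -
      have "(\<lambda>i. \<Lambda> (step_integral M (s i)) - \<Lambda> I) \<longlonglongrightarrow> 0"
      proof (rule Lim_null_comparison)
        show "(\<lambda>i. C * N (step_integral M (s i) - I)) \<longlonglongrightarrow> 0"
          using tendsto_mult_right_zero[OF Ilim] .
        show "\<forall>\<^sub>F i in sequentially. norm (\<Lambda> (step_integral M (s i)) - \<Lambda> I)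
          \<le> C * N (step_integral M (s i) - I)"
          using diff[OF simple_integral_mem[OF s] I] by simp
      qed
      then show ?thesis by (simp add: LIM_zero_iff sbi)
    qed
    have Nm: "(\<lambda>t. N (f t - s i t)) \<in> borel_measurable M" for i
    proof -
      obtain r where r: "\<And>j::nat. simple_in M X (r j)"
        and rlim: "AE t in M. (\<lambda>j. N (f t - r j t)) \<longlonglongrightarrow> 0"
        using sm unfolding strongly_measurable_def by blast
      have "(\<lambda>t. N (f t - s i t)) \<in> borel_measurable (lebesgue_on S)"
      proof (rule borel_measurable_AE_limit[OF S])
        show "(\<lambda>t. N (r j t - s i t)) \<in> borel_measurable (lebesgue_on S)" for j
        proof (rule borel_measurable_simple_function)
          have "simple_function (lebesgue_on S) (s i)" "simple_function (lebesgue_on S) (r j)" using s(1)[of i] r[of j]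
            by (auto simp: simple_in_def M_def elim: simple_bochner_integrable.cases)
          then show "simple_function (lebesgue_on S) (\<lambda>t. N (r j t - s i t))"
            by (intro simple_function_compose2[of _ _ _ "\<lambda>x y. N (x - y)"])
        qed
        show "AE t in lebesgue_on S. (\<lambda>j. N (r j t - s i t)) \<longlonglongrightarrow> N (f t - s i t)"
          using rlim[unfolded M_def] fX[unfolded M_def] AE_space
        proof eventually_elim
          case (elim t)
          have mem: "r j t \<in> X" "s i t \<in> X" for j
            using simple_in_mem[OF r, unfolded M_def, OF elim(3)] simple_in_mem[OF s, unfolded M_def, OF elim(3)] by auto
          have "(\<lambda>j. N (r j t - s i t) - N (f t - s i t)) \<longlonglongrightarrow> 0"
          proof (rule Lim_null_comparison[OF _ elim(1)], intro always_eventually allI)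
            fix j show "norm (N (r j t - s i t) - N (f t - s i t)) \<le> N (f t - r j t)"
              using N_diff_abs[of "r j t - s i t" "f t - s i t"] N_minus_commute[of "r j t" "f t"] mem elim(2) by simp
          qed
          then show ?case by (simp add: LIM_zero_iff)
        qed
      qed
      then show ?thesis by (simp add: M_def)
    qed
    show "(\<lambda>i. \<integral>\<^sup>+ t. ennreal (norm (\<Lambda> (f t) - \<Lambda> (s i t))) \<partial>M) \<longlonglongrightarrow> 0"
    proof (rule tendsto_sandwich[OF _ _ tendsto_const])
      show "\<forall>\<^sub>F i in sequentially. (\<integral>\<^sup>+ t. ennreal (norm (\<Lambda> (f t) - \<Lambda> (s i t))) \<partial>M)
        \<le> ennreal \<bar>C\<bar> * (\<integral>\<^sup>+t. ennreal (N (f t - s i t)) \<partial>M)"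
      proof (intro always_eventually allI)
        fix i
        have "(\<integral>\<^sup>+ t. ennreal (norm (\<Lambda> (f t) - \<Lambda> (s i t))) \<partial>M) \<le> (\<integral>\<^sup>+t. ennreal \<bar>C\<bar> * ennreal (N (f t - s i t)) \<partial>M)"
        proof (rule nn_integral_mono_AE)
          show "AE t in M. ennreal (norm (\<Lambda> (f t) - \<Lambda> (s i t))) \<le> ennreal \<bar>C\<bar> * ennreal (N (f t - s i t))"
            using fX AE_space
          proof eventually_elim
            case (elim t)
            have [simp]: "s i t \<in> X" using simple_in_mem[OF s elim(2)] .
            have nn: "N (f t - s i t) \<ge> 0" using elim by (intro N_nonneg) auto
            have "norm (\<Lambda> (f t) - \<Lambda> (s i t)) \<le> C * N (f t - s i t)" using diff[of "f t" "s i t"] elim by simp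
            also have "\<dots> \<le> \<bar>C\<bar> * N (f t - s i t)" using nn by (intro mult_right_mono) auto
            finally show ?case using nn by (simp add: ennreal_mult[symmetric] ennreal_leI)
          qed
        qed
        also have "\<dots> = ennreal \<bar>C\<bar> * (\<integral>\<^sup>+t. ennreal (N (f t - s i t)) \<partial>M)"
          using Nm by (intro nn_integral_cmult) auto
        finally show "(\<integral>\<^sup>+ t. ennreal (norm (\<Lambda> (f t) - \<Lambda> (s i t))) \<partial>M)
          \<le> ennreal \<bar>C\<bar> * (\<integral>\<^sup>+t. ennreal (N (f t - s i t)) \<partial>M)" .
      qed
      show "(\<lambda>i. ennreal \<bar>C\<bar> * (\<integral>\<^sup>+t. ennreal (N (f t - s i t)) \<partial>M)) \<longlonglongrightarrow> 0"
        using ennreal_tendsto_cmult[OF _ lim, of "ennreal \<bar>C\<bar>"] by (simp add: less_top)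
    qed simp
  qed
  then show ?thesis by (simp add: M_def)
qed

text \<open>Function and integral may be changed by vectors of norm 0. This matters because a distributional
  derivative asks for one and the same vector \<open>I\<close> in both integrals.\<close>

lemma uniform_integral_null:
  assumes f: "uniform_integral M f I" and J: "J \<in> X" "N (I - J) = 0"
    and g: "\<And>t. t \<in> space M \<Longrightarrow> g t \<in> X" "\<And>t. t \<in> space M \<Longrightarrow> N (f t - g t) = 0"
  shows "uniform_integral M g J"
proof (rule uniform_integral_limit[where f = "\<lambda>_. f" and I = "\<lambda>_. I" and \<delta> = "\<lambda>_. 0" and \<delta>' = "\<lambda>_. 0"])
  have I: "I \<in> X" using f by (simp add: uniform_integral_def)
  show "N (J - I) \<le> 0" using I J N_minus_commute[of I J] by simp
  show "N (g t - f t) \<le> 0" if "t \<in> space M" for t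
    using uniform_integral_memD[OF f that] g[OF that] N_minus_commute[of "f t" "g t"] by simp
qed (use f J g in auto)

lemma uniform_integral_series:
  fixes g :: "nat \<Rightarrow> 't \<Rightarrow> real"
  assumes M: "finite_measure M" and x: "\<And>k. x k \<in> X"
    and g: "\<And>k. g k \<in> borel_measurable M" "\<And>k t. t \<in> space M \<Longrightarrow> \<bar>g k t\<bar> \<le> K k"
    and U: "\<And>t. t \<in> space M \<Longrightarrow> U t \<in> X" "\<And>m t. t \<in> space M \<Longrightarrow> N (U t - (\<Sum>k<m. g k t *\<^sub>R x k)) \<le> \<delta> m" "\<delta> \<longlonglongrightarrow> 0"
    and J: "J \<in> X" "\<And>m. N (J - (\<Sum>k<m. (LINT t|M. g k t) *\<^sub>R x k)) \<le> \<delta>' m" "\<delta>' \<longlonglongrightarrow> 0"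
  shows "uniform_integral M U J"
  by (rule uniform_integral_limit[OF uniform_integral_sum[OF M g x] U(1) J(1) U(2) J(2) U(3) J(3)])

lemma uniform_integral_time_spaces:
  assumes f: "uniform_integral (lebesgue_on {0<..<T}) f I" and b: "\<And>t. t \<in> {0<..<T} \<Longrightarrow> N (f t) \<le> C"
  shows "f \<in> L2_time T X N" "f \<in> Linf_time T X N"
proof -
  have sm: "strongly_measurable (lebesgue_on {0<..<T}) X N f" by (rule uniform_integral_strongly_measurable[OF f])
  interpret finite_measure "lebesgue_on {0<..<T}" by (rule finite_interval_measure)
  have nn: "0 \<le> N (f t)" if "t \<in> {0<..<T}" for t using uniform_integral_memD[OF f] that by (intro N_nonneg) simp
  have "integrable (lebesgue_on {0<..<T}) (\<lambda>t. (N (f t))\<^sup>2)"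
  proof (rule integrable_const_bound[of _ "C\<^sup>2"])
    show "AE t in lebesgue_on {0<..<T}. norm ((N (f t))\<^sup>2) \<le> C\<^sup>2"
      using b nn by (intro AE_I2) (auto intro!: power_mono)
    show "(\<lambda>t. (N (f t))\<^sup>2) \<in> borel_measurable (lebesgue_on {0<..<T})"
      using uniform_integral_N_measurable[OF f] by measurable
  qed
  then show "f \<in> L2_time T X N" using sm by (simp add: L2_time_def)
  show "f \<in> Linf_time T X N" using sm b by (auto simp: Linf_time_def intro!: exI[of _ C] AE_I2)
qed

text \<open>The three-epsilon argument for a uniform limit of continuous functions.\<close>

lemma series_continuous:
  fixes g :: "nat \<Rightarrow> real \<Rightarrow> real"
  assumes x: "\<And>k. x k \<in> X" and g: "\<And>k. isCont (g k) t"
    and U: "\<And>s. U s \<in> X" "\<And>m s. N (U s - (\<Sum>k<m. g k s *\<^sub>R x k)) \<le> \<delta> m" "\<delta> \<longlonglongrightarrow> 0"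
  shows "((\<lambda>s. N (U s - U t)) \<longlongrightarrow> 0) (at t within A)"
proof (rule tendstoI)
  fix e :: real assume e: "e > 0"
  define S where "S m s = (\<Sum>k<m. g k s *\<^sub>R x k)" for m s
  have S: "S m s \<in> X" for m s unfolding S_def using x by auto
  obtain m where m: "\<delta> m < e / 3"
    using order_tendstoD(2)[OF U(3), of "e / 3"] e by (auto simp: eventually_sequentially)
  have SS: "N (S m s - S m t) \<le> (\<Sum>k<m. \<bar>g k s - g k t\<bar> * N (x k))" for s
  proof -
    have "N (\<Sum>k<m. (g k s - g k t) *\<^sub>R x k) \<le> (\<Sum>k<m. \<bar>g k s - g k t\<bar> * N (x k))"
    proof (induction m)
      case (Suc m)
      have "N ((\<Sum>k<m. (g k s - g k t) *\<^sub>R x k) + (g m s - g m t) *\<^sub>R x m)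
        \<le> N (\<Sum>k<m. (g k s - g k t) *\<^sub>R x k) + N ((g m s - g m t) *\<^sub>R x m)"
        using x by (intro triangle) auto
      then show ?case using Suc x by (simp add: scale)
    qed simp
    then show ?thesis by (simp add: S_def scaleR_diff_left sum_subtractf)
  qed
  have "((\<lambda>s. \<Sum>k<m. \<bar>g k s - g k t\<bar> * N (x k)) \<longlongrightarrow> (\<Sum>k<m. \<bar>g k t - g k t\<bar> * N (x k))) (at t within A)"
    using g by (intro tendsto_intros) (simp add: isCont_def tendsto_within_subset[where S = UNIV])
  then have "\<forall>\<^sub>F s in at t within A. (\<Sum>k<m. \<bar>g k s - g k t\<bar> * N (x k)) < e / 3"
    using e by (intro order_tendstoD(2)) auto
  then show "\<forall>\<^sub>F s in at t within A. dist (N (U s - U t)) 0 < e"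
  proof eventually_elim
    case (elim s)
    have "N (U s - U t) \<le> N (U s - S m s) + (N (S m s - S m t) + N (S m t - U t))"
      using triangle3[of "U s" "S m s" "U t"] triangle3[of "S m s" "S m t" "U t"] U(1) S by force
    also have "N (S m t - U t) = N (U t - S m t)" by (rule N_minus_commute[OF S U(1)])
    finally have "N (U s - U t) < e" using U(2)[of s m] U(2)[of t m] SS[of s] elim m unfolding S_def by linarith
    then show ?case using N_nonneg[of "U s - U t"] U(1) by simp
  qed
qed

end

text \<open>One integral in \<open>H\<^sub>0\<^sup>1\<close> or \<open>L\<^sup>2\<close> thus yields those of its images in \<open>L\<^sup>2\<close> and \<open>H\<^sup>-\<^sup>1\<close>.\<close>

lemma uniform_integral_linear_image:
  assumes X: "seminormed X N" and Y: "seminormed Y N'"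
    and f: "seminormed.uniform_integral X N M f I"
    and mem: "\<And>u. u \<in> X \<Longrightarrow> \<Lambda> u \<in> Y"
    and add: "\<And>u v. u \<in> X \<Longrightarrow> v \<in> X \<Longrightarrow> \<Lambda> (u + v) = \<Lambda> u + \<Lambda> v"
    and sc: "\<And>c u. u \<in> X \<Longrightarrow> \<Lambda> (c *\<^sub>R u) = c *\<^sub>R \<Lambda> u"
    and bd: "\<And>u. u \<in> X \<Longrightarrow> N' (\<Lambda> u) \<le> C * N u"
  shows "seminormed.uniform_integral Y N' M (\<lambda>t. \<Lambda> (f t)) (\<Lambda> I)"
proof -
  interpret X: seminormed X N by (rule X)
  interpret Y: seminormed Y N' by (rule Y)
  have fX: "\<And>t. t \<in> space M \<Longrightarrow> f t \<in> X" and I: "I \<in> X" using f by (auto simp: X.uniform_integral_def)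
  have diff: "\<Lambda> (u - v) = \<Lambda> u - \<Lambda> v" if "u \<in> X" "v \<in> X" for u v
    using add[of "u - v" v] that by simp
  show ?thesis
    unfolding Y.uniform_integral_def
  proof (intro conjI allI impI ballI)
    fix \<epsilon> :: real assume \<epsilon>: "\<epsilon> > 0"
    define \<delta> where "\<delta> = \<epsilon> / (\<bar>C\<bar> + 1)"
    have \<delta>: "\<delta> > 0" using \<epsilon> by (simp add: \<delta>_def)
    have C: "N' (\<Lambda> u - \<Lambda> v) \<le> \<epsilon>" if "u \<in> X" "v \<in> X" "N (u - v) \<le> \<delta>" for u v
    proof -
      have "N' (\<Lambda> u - \<Lambda> v) \<le> C * N (u - v)" using bd[of "u - v"] diff[of u v] that by simp
      also have "\<dots> \<le> (\<bar>C\<bar> + 1) * N (u - v)" using X.N_nonneg[of "u - v"] that by (intro mult_right_mono) auto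
      also have "\<dots> \<le> (\<bar>C\<bar> + 1) * \<delta>" using that by (intro mult_left_mono) auto
      also have "\<dots> = \<epsilon>" by (simp add: \<delta>_def)
      finally show ?thesis .
    qed
    obtain s where s: "simple_in M X s" "\<And>t. t \<in> space M \<Longrightarrow> N (f t - s t) \<le> \<delta>"
        "N (step_integral M s - I) \<le> \<delta>"
      using f \<delta> unfolding X.uniform_integral_def by meson
    show "\<exists>s. simple_in M Y s \<and> (\<forall>t\<in>space M. N' (\<Lambda> (f t) - s t) \<le> \<epsilon>) \<and>
             N' (step_integral M s - \<Lambda> I) \<le> \<epsilon>"
    proof (intro exI[of _ "\<lambda>t. \<Lambda> (s t)"] conjI ballI)
      show "simple_in M Y (\<lambda>t. \<Lambda> (s t))"
        using X.simple_integral_linear_on(1)[OF s(1) add sc] X.simple_in_mem[OF s(1)] mem by (auto simp: simple_in_def)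
      show "N' (\<Lambda> (f t) - \<Lambda> (s t)) \<le> \<epsilon>" if "t \<in> space M" for t
        using that s(2) by (intro C fX X.simple_in_mem[OF s(1)])
      show "N' (step_integral M (\<lambda>t. \<Lambda> (s t)) - \<Lambda> I) \<le> \<epsilon>"
      proof -
        have "step_integral M (\<lambda>t. \<Lambda> (s t)) = \<Lambda> (step_integral M s)"
          by (rule X.simple_integral_linear_on(2)[OF s(1)]) (use add sc in auto)
        then show ?thesis using C[OF X.simple_integral_mem[OF s(1)] I s(3)] by simp
      qed
    qed
  qed (use fX I mem in auto)
qed

section \<open>The space of square integrable functions\<close>

definition L2_ip :: "real \<Rightarrow> (real \<Rightarrow> real) \<Rightarrow> (real \<Rightarrow> real) \<Rightarrow> real" where
  "L2_ip L f g = (LINT x|interval_measure L. f x * g x)"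

lemma L2D: "f \<in> L2 L \<Longrightarrow> f \<in> borel_measurable (interval_measure L)"
  "f \<in> L2 L \<Longrightarrow> integrable (interval_measure L) (\<lambda>x. (f x)\<^sup>2)"
  by (auto simp: L2_def)

lemma L2_mult_integrable:
  assumes "f \<in> L2 L" "g \<in> L2 L"
  shows "integrable (interval_measure L) (\<lambda>x. f x * g x)"
proof (rule Bochner_Integration.integrable_bound)
  show "integrable (interval_measure L) (\<lambda>x. (f x)\<^sup>2 + (g x)\<^sup>2)"
    by (intro Bochner_Integration.integrable_add L2D(2) assms)
  show "(\<lambda>x. f x * g x) \<in> borel_measurable (interval_measure L)"
    using L2D(1)[OF assms(1)] L2D(1)[OF assms(2)] by measurable
  have "\<bar>f x * g x\<bar> \<le> (f x)\<^sup>2 + (g x)\<^sup>2" for x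
    using sum_squares_bound[of "\<bar>f x\<bar>" "\<bar>g x\<bar>"] mult_nonneg_nonneg[of "\<bar>f x\<bar>" "\<bar>g x\<bar>"]
    unfolding abs_mult power2_abs by linarith
  then show "AE x in interval_measure L. norm (f x * g x) \<le> norm ((f x)\<^sup>2 + (g x)\<^sup>2)" by auto
qed

lemma L2_bounded:
  assumes "f \<in> borel_measurable (interval_measure L)" "\<And>x. x \<in> {0<..<L} \<Longrightarrow> \<bar>f x\<bar> \<le> C"
  shows "f \<in> L2 L"
proof -
  interpret finite_measure "interval_measure L" by (rule finite_interval_measure)
  have "integrable (interval_measure L) (\<lambda>x. (f x)\<^sup>2)"
  proof (rule integrable_const_bound[of _ "C\<^sup>2"])
    have "(f x)\<^sup>2 \<le> C\<^sup>2" if "x \<in> {0<..<L}" for x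
      using power_mono[OF assms(2)[OF that], of 2] by simp
    then show "AE x in interval_measure L. norm ((f x)\<^sup>2) \<le> C\<^sup>2" by (intro AE_I2) simp
  qed (use assms(1) in measurable)
  then show ?thesis using assms(1) by (simp add: L2_def)
qed

lemma L2_const: "(\<lambda>x. c) \<in> L2 L"
  by (rule L2_bounded[of _ _ "\<bar>c\<bar>"]) auto

lemma L2_integrable: "f \<in> L2 L \<Longrightarrow> integrable (interval_measure L) f"
  using L2_mult_integrable[OF _ L2_const[of 1]] by simp

lemma continuous_on_measurable_interval:
  "continuous_on {0<..<L} f \<Longrightarrow> f \<in> borel_measurable (interval_measure L)" for f :: "real \<Rightarrow> real"
  by (rule continuous_imp_measurable_on_sets_lebesgue) simp_all

lemma L2_continuous:
  assumes "continuous_on {0..L} f"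
  shows "f \<in> L2 L"
proof -
  have "compact (f ` {0..L})" using assms by (intro compact_continuous_image) auto
  then obtain C where "\<And>y. y \<in> f ` {0..L} \<Longrightarrow> norm y \<le> C" by (meson bounded_pos compact_imp_bounded)
  then show ?thesis
    using continuous_on_subset[OF assms greaterThanLessThan_subseteq_atLeastAtMost_iff[THEN iffD2]]
    by (intro L2_bounded[of _ _ C] continuous_on_measurable_interval) auto
qed

lemma L2_smooth: "smooth \<theta> \<Longrightarrow> \<theta> \<in> L2 L"
  by (intro L2_continuous smooth_continuous_on)

lemma L2_add: "f \<in> L2 L \<Longrightarrow> g \<in> L2 L \<Longrightarrow> f + g \<in> L2 L"
proof -
  assume fg: "f \<in> L2 L" "g \<in> L2 L"
  have "integrable (interval_measure L) (\<lambda>x. (f x)\<^sup>2 + 2 * (f x * g x) + (g x)\<^sup>2)"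
    using fg L2D L2_mult_integrable by auto
  moreover have "(\<lambda>x. f x + g x) \<in> borel_measurable (interval_measure L)"
    using L2D(1)[OF fg(1)] L2D(1)[OF fg(2)] by measurable
  ultimately show ?thesis by (simp add: L2_def plus_fun_def power2_sum algebra_simps)
qed

lemma L2_scale: "f \<in> L2 L \<Longrightarrow> c *\<^sub>R f \<in> L2 L"
proof -
  assume f: "f \<in> L2 L"
  have "(\<lambda>x. c * f x) \<in> borel_measurable (interval_measure L)"
    using L2D(1)[OF f] by measurable
  moreover have "integrable (interval_measure L) (\<lambda>x. c\<^sup>2 * (f x)\<^sup>2)" using L2D(2)[OF f] by simp
  ultimately show ?thesis by (simp add: L2_def scaleR_fun_def power_mult_distrib)
qed

lemma subspace_L2: "subspace (L2 L)"
  using L2_add L2_scale L2_const[of 0] by (auto simp: subspace_def zero_fun_def)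

interpretation L2: semi_inner "L2 L" "L2_ip L" for L
proof
  show "subspace (L2 L)" by (rule subspace_L2)
  show "L2_ip L u v = L2_ip L v u" for u v by (simp add: L2_ip_def mult.commute)
qed (auto simp: L2_ip_def plus_fun_def scaleR_fun_def distrib_right L2_mult_integrable mult.assoc)

lemma L2_norm_eq: "L2_norm L f = sqrt (L2_ip L f f)"
  by (simp add: L2_norm_def L2_ip_def power2_eq_square)

lemma L2_ip_cong_AE:
  assumes "f \<in> L2 L" "f' \<in> L2 L" "g \<in> L2 L" "AE x in interval_measure L. f x = f' x"
  shows "L2_ip L f g = L2_ip L f' g"
  unfolding L2_ip_def using assms L2_mult_integrable[of _ L g]
  by (intro integral_cong_AE) (auto intro: borel_measurable_integrable)

lemma L2_ip_self_eq_0_iff: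
  assumes "f \<in> L2 L"
  shows "L2_ip L f f = 0 \<longleftrightarrow> (AE x in interval_measure L. f x = 0)"
  unfolding L2_ip_def using L2_mult_integrable[OF assms assms]
  by (subst integral_nonneg_eq_0_iff_AE) auto

lemma L2_abs_integral_le:
  assumes f: "f \<in> L2 L" and L: "0 \<le> L"
  shows "(LINT x|interval_measure L. \<bar>f x\<bar>) \<le> sqrt L * sqrt (L2_ip L f f)"
proof -
  have a: "(\<lambda>x. \<bar>f x\<bar>) \<in> L2 L" using L2D[OF f] by (simp add: L2_def)
  have "\<bar>L2_ip L (\<lambda>x. \<bar>f x\<bar>) (\<lambda>x. 1)\<bar> \<le> sqrt (L2.sq L (\<lambda>x. \<bar>f x\<bar>)) * sqrt (L2.sq L (\<lambda>x. 1))"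
    by (rule L2.abs_ip_le[OF a L2_const])
  moreover have "L2.sq L (\<lambda>x. 1) = L" using L by (simp add: L2_ip_def measure_restrict_space)
  ultimately show ?thesis by (simp add: L2_ip_def mult.commute abs_le_iff)
qed

text \<open>Riesz--Fischer: on a set of finite measure an \<open>L\<^sup>2\<close>-Cauchy sequence is \<open>L\<^sup>1\<close>-Cauchy, so a
  subsequence converges almost everywhere, and Fatou's lemma turns this into convergence in \<open>L\<^sup>2\<close>.\<close>

interpretation L2: semi_hilbert "L2 L" "L2_ip L" for L
proof
  fix s :: "nat \<Rightarrow> real \<Rightarrow> real"
  assume s: "\<And>i. s i \<in> L2 L"
    and cauchy: "\<And>\<epsilon>. \<epsilon> > 0 \<Longrightarrow> \<exists>N. \<forall>i\<ge>N. \<forall>j\<ge>N. L2.sq L (s i - s j) < \<epsilon>"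
  define M where "M = interval_measure L"
  have sm [measurable]: "s i \<in> borel_measurable M" for i unfolding M_def using L2D(1)[OF s] .
  have d: "s i - s j \<in> L2 L" for i j using s by auto
  obtain r where r: "strict_mono r" "AE x in M. Cauchy (\<lambda>i. s (r i) x)"
  proof (rule cauchy_L1_AE_cauchy_subseq[of M s])
    show "integrable M (s n)" for n unfolding M_def using L2_integrable[OF s] .
    fix e :: real assume "e > 0"
    \<comment> \<open>The summand 1 makes K positive also if L is 0.\<close>
    define K where "K = \<bar>L\<bar> + 1"
    obtain N where N: "\<And>i j. i \<ge> N \<Longrightarrow> j \<ge> N \<Longrightarrow> L2.sq L (s i - s j) < (e / sqrt K)\<^sup>2"
      using cauchy[of "(e / sqrt K)\<^sup>2"] \<open>e > 0\<close> unfolding K_def by (metis abs_ge_zero add_nonneg_pos divide_pos_pos real_sqrt_gt_zero zero_less_one zero_less_power)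
    have "(LINT x|M. norm (s i x - s j x)) < e" if "i \<ge> N" "j \<ge> N" for i j
    proof (cases "0 \<le> L")
      case True
      have "(LINT x|M. norm (s i x - s j x)) \<le> sqrt L * sqrt (L2.sq L (s i - s j))"
        using L2_abs_integral_le[OF d True, of i j] by (simp add: M_def)
      also have "\<dots> \<le> sqrt K * sqrt (L2.sq L (s i - s j))"
        using True L2.nonneg[OF d] by (intro mult_right_mono) (auto simp: K_def)
      also have "\<dots> < sqrt K * (e / sqrt K)"
      proof (rule mult_strict_left_mono)
        show "sqrt (L2.sq L (s i - s j)) < e / sqrt K"
          using N[OF that] \<open>e > 0\<close> by (intro real_less_lsqrt) (auto simp: K_def)
      qed (simp add: K_def)
      also have "\<dots> = e" by (simp add: K_def)
      finally show ?thesis .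
    next
      case False
      then have "{0<..<L} = {}" by auto
      then show ?thesis using \<open>e > 0\<close> by (simp add: M_def)
    qed
    then show "\<exists>N. \<forall>i\<ge>N. \<forall>j\<ge>N. (LINT x|M. norm (s i x - s j x)) < e" by blast
  qed blast
  define f where "f x = lim (\<lambda>i. s (r i) x)" for x
  have fm [measurable]: "f \<in> borel_measurable M" unfolding f_def by measurable
  have lim: "AE x in M. (\<lambda>i. s (r i) x) \<longlonglongrightarrow> f x"
    using r(2) by eventually_elim (simp add: f_def Cauchy_convergent_iff convergent_LIMSEQ_iff)
  have nn: "(\<integral>\<^sup>+x. ennreal ((s i x - s j x)\<^sup>2) \<partial>M) = ennreal (L2.sq L (s i - s j))" for i j
    using nn_integral_eq_integral[OF L2D(2)[OF d[of i j]]] by (simp add: M_def L2_ip_def power2_eq_square)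
  have fatou: "(\<integral>\<^sup>+x. ennreal ((s i x - f x)\<^sup>2) \<partial>M) \<le> ennreal \<epsilon>"
    if N: "\<And>j. j \<ge> N \<Longrightarrow> L2.sq L (s i - s j) < \<epsilon>" for i N \<epsilon>
  proof -
    have "(\<integral>\<^sup>+x. ennreal ((s i x - f x)\<^sup>2) \<partial>M) = (\<integral>\<^sup>+x. liminf (\<lambda>k. ennreal ((s i x - s (r k) x)\<^sup>2)) \<partial>M)"
    proof (rule nn_integral_cong_AE)
      show "AE x in M. ennreal ((s i x - f x)\<^sup>2) = liminf (\<lambda>k. ennreal ((s i x - s (r k) x)\<^sup>2))"
        using lim
      proof eventually_elim
        case (elim x)
        have "(\<lambda>k. ennreal ((s i x - s (r k) x)\<^sup>2)) \<longlonglongrightarrow> ennreal ((s i x - f x)\<^sup>2)"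
          by (intro tendsto_intros tendsto_ennrealI elim)
        then show ?case by (metis lim_imp_Liminf sequentially_bot)
      qed
    qed
    also have "\<dots> \<le> liminf (\<lambda>k. \<integral>\<^sup>+x. ennreal ((s i x - s (r k) x)\<^sup>2) \<partial>M)"
      by (rule nn_integral_liminf) measurable
    also have "\<dots> \<le> liminf (\<lambda>k. ennreal \<epsilon>)"
    proof (rule Liminf_mono)
      show "\<forall>\<^sub>F k in sequentially. (\<integral>\<^sup>+x. ennreal ((s i x - s (r k) x)\<^sup>2) \<partial>M) \<le> ennreal \<epsilon>"
        using eventually_ge_at_top[of N]
      proof eventually_elim
        fix k assume "N \<le> k"
        then have "N \<le> r k" using seq_suble[OF r(1), of k] by linarith
        then show "(\<integral>\<^sup>+x. ennreal ((s i x - s (r k) x)\<^sup>2) \<partial>M) \<le> ennreal \<epsilon>"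
          unfolding nn using N by (intro ennreal_leI) (simp add: less_imp_le)
      qed
    qed
    also have "\<dots> = ennreal \<epsilon>" by (simp add: Liminf_const)
    finally show ?thesis .
  qed
  have dfL2: "s i - f \<in> L2 L" if "\<And>j. j \<ge> N \<Longrightarrow> L2.sq L (s i - s j) < \<epsilon>" for i N \<epsilon>
  proof -
    have "integrable M (\<lambda>x. (s i x - f x)\<^sup>2)"
      using fatou[of N i \<epsilon>, OF that] by (intro integrableI_bounded) (auto simp: le_less_trans)
    moreover have "(\<lambda>x. s i x - f x) \<in> borel_measurable M" by measurable
    ultimately show ?thesis unfolding L2_def M_def by (simp add: fun_diff_def)
  qed
  obtain N0 where N0: "\<And>i j. i \<ge> N0 \<Longrightarrow> j \<ge> N0 \<Longrightarrow> L2.sq L (s i - s j) < 1"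
    using cauchy[of 1] by auto
  have "s N0 - f \<in> L2 L" by (rule dfL2[of N0]) (use N0 in auto)
  then have "s N0 - (s N0 - f) \<in> L2 L" using s by blast
  then have f: "f \<in> L2 L" by simp
  have "(\<lambda>i. L2.sq L (s i - f)) \<longlonglongrightarrow> 0"
  proof (rule LIMSEQ_I)
    fix e :: real assume "e > 0"
    then obtain N where N: "\<And>i j. i \<ge> N \<Longrightarrow> j \<ge> N \<Longrightarrow> L2.sq L (s i - s j) < e / 2"
      using cauchy[of "e / 2"] by auto
    have "norm (L2.sq L (s i - f) - 0) < e" if "i \<ge> N" for i
    proof -
      have df: "s i - f \<in> L2 L" using s f by auto
      have "ennreal (L2.sq L (s i - f)) = (\<integral>\<^sup>+x. ennreal ((s i x - f x)\<^sup>2) \<partial>M)"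
        using nn_integral_eq_integral[OF L2D(2)[OF df]] by (simp add: M_def L2_ip_def power2_eq_square)
      also have "\<dots> \<le> ennreal (e / 2)" by (rule fatou[of N]) (use N that in auto)
      finally have "L2.sq L (s i - f) \<le> e / 2" using \<open>e > 0\<close> by (simp add: ennreal_le_iff)
      then show ?thesis using L2.nonneg[OF df] \<open>e > 0\<close> by simp
    qed
    then show "\<exists>no. \<forall>n\<ge>no. norm (L2.sq L (s n - f) - 0) < e" by blast
  qed
  then show "\<exists>p\<in>L2 L. (\<lambda>i. L2.sq L (s i - p)) \<longlonglongrightarrow> 0" using f by blast
qed

section \<open>The fundamental lemma of the calculus of variations\<close>

text \<open>The sets on which the integral vanishes form a Dynkin system that contains the intervals, and
  every Lebesgue set is a Borel set up to a null set.\<close>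

lemma integral_zero_if_interval_integrals_zero:
  fixes f :: "real \<Rightarrow> real"
  assumes f: "integrable lebesgue f" and zero: "\<And>a b. (LINT x|lebesgue. indicator {a<..<b} x * f x) = 0"
    and total: "(LINT x|lebesgue. f x) = 0" and A: "A \<in> sets lebesgue"
  shows "(LINT x|lebesgue. indicator A x * f x) = 0"
proof -
  have ind: "integrable lebesgue (\<lambda>x. indicator B x * f x)" if "B \<in> sets lebesgue" for B
    using integrable_mult_indicator[OF that f] by simp
  have borel: "(LINT x|lebesgue. indicator B x * f x) = 0" if "B \<in> sets borel" for B
  proof -
    have BS: "B \<in> sigma_sets UNIV (range (\<lambda>(a, b). box a b))"
      using that by (simp add: borel_eq_box sets_measure_of)
    have st: "Int_stable (range (\<lambda>(a, b :: real). box a b))"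
    proof (rule Int_stableI, safe)
      fix a b a' b' :: real
      have "box a b \<inter> box a' b' = box (max a a') (min b b')" by auto
      then show "box a b \<inter> box a' b' \<in> range (\<lambda>(a, b). box a b)" by auto
    qed
    have cl: "range (\<lambda>(a, b :: real). box a b) \<subseteq> Pow UNIV" by simp
    show ?thesis using st cl BS
    proof (induction rule: sigma_sets_induct_disjoint)
      case (basic B)
      then show ?case using zero by auto
    next
      case (compl B)
      then have B: "B \<in> sets lebesgue" using borel_eq_box by (metis sets_completionI_sets sets_lborel sets_measure_of top_greatest Pow_UNIV)
      have "(LINT x|lebesgue. indicator (UNIV - B) x * f x) = (LINT x|lebesgue. f x - indicator B x * f x)"
        by (intro Bochner_Integration.integral_cong) (auto simp: indicator_def)
      also have "\<dots> = 0" using compl total f ind[OF B] by simp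
      finally show ?case .
    next
      case (union B)
      have B: "B i \<in> sets lebesgue" for i
        using union(2) borel_eq_box by (metis rangeI subsetD sets_completionI_sets sets_lborel sets_measure_of top_greatest Pow_UNIV)
      have "(LINT x:(\<Union>i. B i)|lebesgue. f x) = (\<Sum>i. (LINT x:(B i)|lebesgue. f x))"
      proof (rule lebesgue_integral_countable_add)
        show "set_integrable lebesgue (\<Union>i. B i) f"
          unfolding set_integrable_def using ind[of "\<Union>i. B i"] B by (simp add: sets.countable_UN)
      qed (use B union(1) in \<open>auto simp: disjoint_family_on_def\<close>)
      then show ?case using union(3) by (simp add: set_lebesgue_integral_def)
    qed simp
  qed
  obtain S N N' where SN: "A = S \<union> N" "N \<subseteq> N'" "N' \<in> null_sets lborel" "S \<in> sets lborel"
    using A by (rule sets_completionE) blast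
  have N'0: "AE x in lebesgue. x \<notin> N'"
    using SN(3) AE_completion[OF AE_not_in[OF SN(3)]] by simp
  have "(LINT x|lebesgue. indicator A x * f x) = (LINT x|lebesgue. indicator S x * f x)"
  proof (rule integral_cong_AE)
    show "AE x in lebesgue. indicator A x * f x = indicator S x * f x"
      using N'0 by eventually_elim (use SN in \<open>auto simp: indicator_def\<close>)
    show "(\<lambda>x. indicat_real A x * f x) \<in> borel_measurable lebesgue"
      using ind[OF A] by simp
    show "(\<lambda>x. indicat_real S x * f x) \<in> borel_measurable lebesgue"
      using ind[of S] SN(4) by simp
  qed
  also have "\<dots> = 0" using borel[of S] SN(4) by simp
  finally show ?thesis .
qed

lemma integrable_mult_bounded:
  fixes f g :: "real \<Rightarrow> real"
  assumes f: "integrable M f" and g: "g \<in> borel_measurable M" "\<And>x. x \<in> space M \<Longrightarrow> \<bar>g x\<bar> \<le> C"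
  shows "integrable M (\<lambda>x. f x * g x)"
proof (rule Bochner_Integration.integrable_bound)
  show "integrable M (\<lambda>x. C * f x)" using f by simp
  show "(\<lambda>x. f x * g x) \<in> borel_measurable M" using borel_measurable_integrable[OF f] g(1) by measurable
  show "AE x in M. norm (f x * g x) \<le> norm (C * f x)"
  proof (rule AE_I2)
    fix x assume "x \<in> space M"
    then have "\<bar>g x\<bar> \<le> \<bar>C\<bar>" using g(2)[of x] by linarith
    then have "\<bar>f x\<bar> * \<bar>g x\<bar> \<le> \<bar>f x\<bar> * \<bar>C\<bar>" by (rule mult_left_mono) simp
    then show "norm (f x * g x) \<le> norm (C * f x)" by (simp add: abs_mult mult.commute)
  qed
qed

lemma smooth_measurable: "smooth g \<Longrightarrow> g \<in> borel_measurable (lebesgue_on (S :: real set))"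
  by (rule measurable_restrict_space1) (simp add: borel_measurable_continuous_onI smooth_continuous_on measurable_completion)

lemma integrable_mult_test:
  assumes f: "integrable (lebesgue_on S) f" and \<theta>: "test_function_on U \<theta>"
  shows "integrable (lebesgue_on S) (\<lambda>x. f x * \<theta> x)"
proof -
  obtain C where "\<And>x. \<bar>\<theta> x\<bar> \<le> C" using test_function_bounded[OF \<theta>] by blast
  then show ?thesis by (intro integrable_mult_bounded[OF f smooth_measurable[OF test_function_smooth[OF \<theta>]]])
qed

lemma integral_bump_tendsto:
  assumes f: "integrable (lebesgue_on S) f"
  shows "(\<lambda>i. LINT x|lebesgue_on S. f x * bump c d i x) \<longlonglongrightarrow> (LINT x|lebesgue_on S. f x * indicator {c<..<d} x)"
proof (rule integral_dominated_convergence)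
  show "integrable (lebesgue_on S) (\<lambda>x. \<bar>f x\<bar>)" using f by simp
  show "(\<lambda>x. f x * indicator {c<..<d} x) \<in> borel_measurable (lebesgue_on S)"
    by (rule borel_measurable_times[OF borel_measurable_integrable[OF f] measurable_restrict_space1])
      (rule borel_measurable_indicator, simp)
  show "(\<lambda>x. f x * bump c d i x) \<in> borel_measurable (lebesgue_on S)" for i
    using borel_measurable_integrable[OF f] smooth_measurable[OF smooth_bump] by (intro borel_measurable_times)
  show "AE x in lebesgue_on S. (\<lambda>i. f x * bump c d i x) \<longlonglongrightarrow> f x * indicator {c<..<d} x"
    by (intro AE_I2 tendsto_intros bump_tendsto)
  show "AE x in lebesgue_on S. norm (f x * bump c d i x) \<le> \<bar>f x\<bar>" for i
    using bump_range[of c d i] by (intro AE_I2) (simp add: abs_mult mult_left_le)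
qed

text \<open>By dominated convergence the bump functions can be replaced by indicators of intervals, so the
  integral of \<open>f\<close> over every measurable set vanishes.\<close>

theorem fundamental_lemma:
  assumes f: "integrable (interval_measure L) f"
    and zero: "\<And>\<theta>. test_function_on {0<..<L} \<theta> \<Longrightarrow> (LINT x|interval_measure L. f x * \<theta> x) = 0"
  shows "AE x in interval_measure L. f x = 0"
proof -
  define f0 where "f0 x = indicator {0<..<L} x * f x" for x
  have f0: "integrable lebesgue f0"
    unfolding f0_def using f by (simp add: integrable_restrict_space)
  have zero': "(LINT x|lebesgue. indicator {a<..<b} x * f0 x) = 0" for a b
  proof -
    define c d where "c = max a 0" and "d = min b L"
    have "(LINT x|lebesgue. indicator {a<..<b} x * f0 x) = (LINT x|interval_measure L. f x * indicator {c<..<d} x)"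
      by (subst integral_restrict_space)
         (auto simp: f0_def c_def d_def indicator_def intro!: Bochner_Integration.integral_cong)
    also have "\<dots> = 0"
    proof (rule LIMSEQ_unique[OF integral_bump_tendsto[OF f]])
      have "test_function_on {0<..<L} (bump c d i)" for i
        by (rule test_function_bump) (auto simp: c_def d_def)
      then show "(\<lambda>i. LINT x|interval_measure L. f x * bump c d i x) \<longlonglongrightarrow> 0" using zero by simp
    qed
    finally show ?thesis .
  qed
  have "(LINT x|lebesgue. f0 x) = (LINT x|lebesgue. indicator {0<..<L} x * f0 x)"
    by (intro Bochner_Integration.integral_cong) (auto simp: f0_def indicator_def)
  then have total: "(LINT x|lebesgue. f0 x) = 0" using zero' by simp
  interpret finite_measure "interval_measure L" by (rule finite_interval_measure)
  show ?thesis
  proof (rule density_zero[OF f])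
    fix A assume "A \<in> sets (interval_measure L)"
    then have A: "A \<in> sets lebesgue" by (simp add: sets_restrict_space_iff)
    have "set_lebesgue_integral (interval_measure L) A f = (LINT x|lebesgue. indicator A x * f0 x)"
      unfolding set_lebesgue_integral_def
      by (subst integral_restrict_space) (auto simp: f0_def mult.left_commute intro!: Bochner_Integration.integral_cong)
    also have "\<dots> = 0" using f0 zero' total A by (rule integral_zero_if_interval_integrals_zero)
    finally show "set_lebesgue_integral (interval_measure L) A f = 0" .
  qed
qed

lemma integral_interval_continuous:
  fixes f :: "real \<Rightarrow> real"
  assumes "continuous_on {0..T} f"
  shows "integrable (interval_measure T) f" "(LINT x|interval_measure T. f x) = integral {0..T} f"
proof -
  show i: "integrable (interval_measure T) f"
    using L2_integrable[OF L2_continuous[OF assms]] .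
  show "(LINT x|interval_measure T. f x) = integral {0..T} f"
    using lebesgue_integral_eq_integral[OF i] by (simp add: integral_open_interval_real)
qed

text \<open>Integration by parts; the boundary terms vanish as the test function does at both ends.\<close>

lemma has_weak_deriv_classical:
  assumes T: "0 < T" and Y: "\<And>t. t \<in> {0..T} \<Longrightarrow> (Y has_real_derivative Z t) (at t within {0..T})"
    and Z: "continuous_on {0..T} Z"
  shows "has_weak_deriv T Y Z"
  unfolding has_weak_deriv_def
proof (intro allI impI)
  fix \<theta> assume \<theta>: "test_function_on {0<..<T} \<theta>"
  have s: "smooth \<theta>" "smooth (deriv \<theta>)" using \<theta> by (auto intro: test_function_smooth test_function_deriv)
  have Yc: "continuous_on {0..T} Y" using Y by (meson DERIV_continuous continuous_on_eq_continuous_within)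
  have c: "continuous_on {0..T} (\<lambda>x. Y x * deriv \<theta> x)" "continuous_on {0..T} (\<lambda>x. Z x * \<theta> x)"
    by (intro continuous_on_mult Yc Z smooth_continuous_on s)+
  have "((\<lambda>x. Y x * deriv \<theta> x + Z x * \<theta> x) has_integral (Y T * \<theta> T - Y 0 * \<theta> 0)) {0..T}"
  proof (rule fundamental_theorem_of_calculus)
    fix x assume x: "x \<in> {0..T}"
    have "((\<lambda>x. Y x * \<theta> x) has_real_derivative (Z x * \<theta> x + deriv \<theta> x * Y x)) (at x within {0..T})"
      using Y[OF x] has_field_derivative_at_within[OF smooth_DERIV[OF s(1)]] by (rule DERIV_mult)
    then show "((\<lambda>x. Y x * \<theta> x) has_vector_derivative (Y x * deriv \<theta> x + Z x * \<theta> x)) (at x within {0..T})"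
      by (simp add: has_real_derivative_iff_has_vector_derivative algebra_simps)
  qed (use T in simp)
  moreover have "\<theta> 0 = 0" "\<theta> T = 0" using test_function_outside[OF \<theta>] by auto
  ultimately have "integral {0..T} (\<lambda>x. Y x * deriv \<theta> x + Z x * \<theta> x) = 0" by (simp add: integral_unique)
  then have "integral {0..T} (\<lambda>x. Y x * deriv \<theta> x) + integral {0..T} (\<lambda>x. Z x * \<theta> x) = 0"
    using c by (subst (asm) integral_add) (auto intro: integrable_continuous_interval)
  then show "(LINT x|interval_measure T. Y x * deriv \<theta> x) = - (LINT x|interval_measure T. Z x * \<theta> x)"
    using integral_interval_continuous(2)[OF c(1)] integral_interval_continuous(2)[OF c(2)] by simp
qed

lemma has_weak_deriv_smooth: "0 < L \<Longrightarrow> smooth \<theta> \<Longrightarrow> has_weak_deriv L \<theta> (deriv \<theta>)"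
  by (rule has_weak_deriv_classical)
     (auto intro: has_field_derivative_at_within smooth_DERIV smooth_continuous_on smooth_deriv)

text \<open>The integral from 0 vanishes to the left of the support of \<open>q\<close>, and to the right of it because
  \<open>q\<close> has mean zero.\<close>

lemma test_function_antiderivative:
  assumes q: "test_function_on {0<..<T} q" and zero: "(LINT x|interval_measure T. q x) = 0" and T: "0 < T"
  shows "\<exists>\<theta>. test_function_on {0<..<T} \<theta> \<and> deriv \<theta> = q"
proof (cases "\<forall>x. q x = 0")
  case True
  then have "q = (\<lambda>x. 0)" by auto
  moreover have "deriv (\<lambda>x. 0 :: real) = (\<lambda>x. 0 :: real)" by (rule ext) simp
  ultimately show ?thesis using test_function_zero by (intro exI[of _ "\<lambda>x. 0"]) auto
next
  case False
  obtain c d where cd: "0 < c" "c \<le> d" "d < T" and out: "\<And>x. x \<notin> {c..d} \<Longrightarrow> q x = 0"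
    by (rule test_function_support[OF q]) (use False in auto)
  have qc: "continuous_on S q" for S using q by (intro smooth_continuous_on test_function_smooth)
  define \<theta> where "\<theta> x = (if x \<in> {0..T} then integral {0..x} q else 0)" for x
  have left: "\<theta> x = 0" if "x < c" for x
  proof -
    have "integral {0..x} q = integral {0..x} (\<lambda>x. 0)" using out that by (intro integral_cong) auto
    then show ?thesis by (simp add: \<theta>_def)
  qed
  have right: "\<theta> x = 0" if "x > d" for x
  proof (cases "x \<in> {0..T}")
    case True
    have "integral {0..x} q + integral {x..T} q = integral {0..T} q"
      using True by (intro Henstock_Kurzweil_Integration.integral_combine integrable_continuous_interval qc) auto
    moreover have "integral {x..T} q = integral {x..T} (\<lambda>x. 0)" using out that by (intro integral_cong) auto
    moreover have "integral {0..T} q = 0" using zero integral_interval_continuous(2)[OF qc] by simp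
    ultimately show ?thesis using True by (simp add: \<theta>_def)
  next
    case False
    then show ?thesis unfolding \<theta>_def by (rule if_not_P)
  qed
  have D: "(\<theta> has_real_derivative q x) (at x)" for x
  proof -
    consider "x < c" | "x > d" | "x \<in> {0<..<T}" using cd by force
    then show ?thesis
    proof cases
      case 1
      have "((\<lambda>_. 0) has_real_derivative 0) (at x)" by simp
      then have "(\<theta> has_real_derivative 0) (at x)"
        by (rule has_field_derivative_transform_within_open[where S = "{..<c}"]) (use 1 left in auto)
      then show ?thesis using out[of x] 1 by auto
    next
      case 2
      have "((\<lambda>_. 0) has_real_derivative 0) (at x)" by simp
      then have "(\<theta> has_real_derivative 0) (at x)"
        by (rule has_field_derivative_transform_within_open[where S = "{d<..}"]) (use 2 right in auto)
      then show ?thesis using out[of x] 2 by auto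
    next
      case 3
      have "((\<lambda>x. integral {0..x} q) has_real_derivative q x) (at x within {0..T})"
        using integral_has_real_derivative[OF qc, of x 0 T] 3 by auto
      then have "((\<lambda>x. integral {0..x} q) has_real_derivative q x) (at x)"
        using 3 at_within_Icc_at[of 0 x T] by simp
      then show ?thesis
        by (rule has_field_derivative_transform_within_open[where S = "{0<..<T}"]) (use 3 in \<open>auto simp: \<theta>_def\<close>)
    qed
  qed
  have "smooth \<theta>" using D test_function_smooth[OF q] by (rule smooth_if_deriv)
  then have "test_function_on {0<..<T} \<theta>"
    unfolding test_function_on_def smooth_def[symmetric]
    using cd left right by (intro conjI exI[of _ "{c..d}"]) (auto simp: not_le)
  moreover have "deriv \<theta> = q" using D by (auto intro: DERIV_imp_deriv)
  ultimately show ?thesis by blast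
qed

text \<open>Fix a bump \<open>\<rho>\<close>. Subtracting a multiple of \<open>\<rho>\<close> from a test function \<open>\<eta>\<close> gives it mean zero, hence makes it
  the derivative of a test function. So \<open>f\<close> pairs with \<open>\<eta>\<close> like the constant that is its normalised
  pairing with \<open>\<rho>\<close>, and the fundamental lemma applies.\<close>

theorem du_bois_reymond:
  assumes f: "integrable (interval_measure T) f" and T: "0 < T"
    and zero: "\<And>\<theta>. test_function_on {0<..<T} \<theta> \<Longrightarrow> (LINT x|interval_measure T. f x * deriv \<theta> x) = 0"
  shows "\<exists>c. AE x in interval_measure T. f x = c"
proof -
  define M where "M = interval_measure T"
  interpret M: finite_measure M unfolding M_def by (rule finite_interval_measure)
  have one: "integrable M (\<lambda>x. 1 :: real)" by simp
  have "(\<lambda>i. LINT x|M. 1 * bump 0 T i x) \<longlonglongrightarrow> (LINT x|M. 1 * indicator {0<..<T} x)"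
    unfolding M_def by (rule integral_bump_tendsto[OF one[unfolded M_def]])
  moreover have "(LINT x|M. 1 * indicator {0<..<T} x :: real) = (LINT x|M. 1)"
    by (intro Bochner_Integration.integral_cong) (auto simp: M_def)
  moreover have "(LINT x|M. (1::real)) = T" using T by (simp add: M_def measure_restrict_space)
  ultimately have "(\<lambda>i. LINT x|M. bump 0 T i x) \<longlonglongrightarrow> T" by simp
  from order_tendstoD(1)[OF this T] obtain i where i: "(LINT x|M. bump 0 T i x) > 0"
    by (auto simp: eventually_sequentially)
  define \<rho> where "\<rho> = bump 0 T i"
  define R where "R = (LINT x|M. \<rho> x)"
  have R: "R > 0" using i by (simp add: R_def \<rho>_def)
  have \<rho>: "test_function_on {0<..<T} \<rho>" unfolding \<rho>_def by (rule test_function_bump) simp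
  have int1: "integrable M \<theta>" if "test_function_on {0<..<T} \<theta>" for \<theta>
    using integrable_mult_test[OF one[unfolded M_def] that] by (simp add: M_def)
  have intf: "integrable M (\<lambda>x. f x * \<theta> x)" if "test_function_on {0<..<T} \<theta>" for \<theta>
    using integrable_mult_test[OF f that] by (simp add: M_def)
  define c where "c = (LINT x|M. f x * \<rho> x) / R"
  have "AE x in M. f x - c = 0"
    unfolding M_def
  proof (rule fundamental_lemma)
    show "integrable (interval_measure T) (\<lambda>x. f x - c)" using f M.integrable_const[of c] by (simp add: M_def)
    fix \<eta> assume \<eta>: "test_function_on {0<..<T} \<eta>"
    define \<kappa> where "\<kappa> = (LINT x|M. \<eta> x) / R"
    define q where "q x = \<eta> x + (- \<kappa>) * \<rho> x" for x
    have q: "test_function_on {0<..<T} q"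
      unfolding q_def by (intro test_function_add test_function_scale \<eta> \<rho>)
    have "(LINT x|M. q x) = 0"
      unfolding q_def using int1[OF \<eta>] int1[OF \<rho>] R by (simp add: \<kappa>_def R_def)
    then obtain \<theta> where "test_function_on {0<..<T} \<theta>" "deriv \<theta> = q"
      using test_function_antiderivative[OF q _ T] by (auto simp: M_def)
    then have "(LINT x|M. f x * q x) = 0" using zero by (auto simp: M_def)
    moreover have "(LINT x|M. f x * q x) = (LINT x|M. f x * \<eta> x - \<kappa> * (f x * \<rho> x))"
      by (intro Bochner_Integration.integral_cong) (auto simp: q_def algebra_simps)
    ultimately have "(LINT x|M. f x * \<eta> x) = \<kappa> * (LINT x|M. f x * \<rho> x)"
      using intf[OF \<eta>] intf[OF \<rho>] by simp
    also have "\<dots> = c * (LINT x|M. \<eta> x)" by (simp add: c_def \<kappa>_def)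
    finally show "(LINT x|interval_measure T. (f x - c) * \<eta> x) = 0"
      using intf[OF \<eta>] int1[OF \<eta>] by (simp add: M_def[symmetric] left_diff_distrib)
  qed
  then show ?thesis unfolding M_def by (auto intro: exI[of _ c])
qed

lemma continuous_AE_eq_imp_eq:
  fixes f g :: "real \<Rightarrow> real"
  assumes f: "continuous_on {0<..<T} f" and g: "continuous_on {0<..<T} g"
    and eq: "AE x in interval_measure T. f x = g x" and x: "x \<in> {0<..<T}"
  shows "f x = g x"
proof (rule ccontr)
  assume ne: "f x \<noteq> g x"
  define U where "U = {x \<in> {0<..<T}. f x - g x \<in> - {0}}"
  have "open U" unfolding U_def
    by (rule continuous_open_preimage[unfolded Int_def vimage_def, simplified])
       (use f g in \<open>auto intro!: continuous_intros simp: open_delete\<close>)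
  moreover have "x \<in> U" using ne x by (simp add: U_def)
  ultimately have "\<not> negligible U" using open_not_negligible by blast
  moreover have "AE x in lebesgue. x \<notin> U"
    using eq by (subst (asm) AE_restrict_space_iff) (auto simp: U_def elim!: eventually_mono)
  then have "negligible U"
    by (simp add: AE_iff_null negligible_iff_null_sets \<open>open U\<close> Compl_eq[symmetric] null_sets_def) 
  ultimately show False by blast
qed

text \<open>The difference between \<open>Y\<close> and the primitive of \<open>Z\<close> has weak derivative zero; it is almost everywhere
  constant and continuous, hence constant.\<close>

lemma weak_deriv_continuous_imp_integral:
  assumes T: "0 < T" and Y: "continuous_on {0..T} Y" and Z: "continuous_on {0..T} Z"
    and w: "has_weak_deriv T Y Z" and t: "t \<in> {0..T}"
  shows "Y t = Y 0 + integral {0..t} Z"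
proof -
  define W where "W x = integral {0..x} Z" for x
  have WD: "(W has_real_derivative Z t) (at t within {0..T})" if "t \<in> {0..T}" for t
    unfolding W_def using Z that by (rule integral_has_real_derivative)
  then have Wc: "continuous_on {0..T} W" by (meson DERIV_continuous continuous_on_eq_continuous_within)
  have ww: "has_weak_deriv T W Z" using T WD Z by (rule has_weak_deriv_classical)
  have YW: "continuous_on {0..T} (\<lambda>x. Y x - W x)" using Y Wc by (intro continuous_intros)
  have "\<exists>c. AE x in interval_measure T. Y x - W x = c"
  proof (rule du_bois_reymond)
    show "integrable (interval_measure T) (\<lambda>x. Y x - W x)" using integral_interval_continuous(1)[OF YW] .
    fix \<theta> assume \<theta>: "test_function_on {0<..<T} \<theta>"
    have i: "integrable (interval_measure T) (\<lambda>x. Y x * deriv \<theta> x)" "integrable (interval_measure T) (\<lambda>x. W x * deriv \<theta> x)"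
      using integral_interval_continuous(1) Y Wc by (auto intro!: integrable_mult_test test_function_deriv \<theta>)
    then show "(LINT x|interval_measure T. (Y x - W x) * deriv \<theta> x) = 0"
      using w ww \<theta> by (simp add: left_diff_distrib has_weak_deriv_def)
  qed (rule T)
  then obtain c where c: "AE x in interval_measure T. Y x - W x = c" by blast
  have "Y x - W x = c" if "x \<in> {0<..<T}" for x
  proof (rule continuous_AE_eq_imp_eq[OF _ _ c that])
    show "continuous_on {0<..<T} (\<lambda>x. Y x - W x)" by (rule continuous_on_subset[OF YW]) auto
  qed simp
  then have "Y x - W x = c" if "x \<in> {0..T}" for x
    using continuous_constant_on_closure[of "{0<..<T}" "\<lambda>x. Y x - W x" c x] T YW that by simp
  from this[of t] this[of 0] t T show ?thesis by (simp add: W_def)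
qed

section \<open>Weak derivatives\<close>

lemma has_weak_deriv_iff:
  "has_weak_deriv L f g \<longleftrightarrow> (\<forall>\<theta>. test_function_on {0<..<L} \<theta> \<longrightarrow> L2_ip L f (deriv \<theta>) = - L2_ip L g \<theta>)"
  by (simp add: has_weak_deriv_def L2_ip_def)

lemma test_function_L2: "test_function_on S \<theta> \<Longrightarrow> \<theta> \<in> L2 L" "test_function_on S \<theta> \<Longrightarrow> deriv \<theta> \<in> L2 L"
  by (auto intro!: L2_smooth intro: test_function_smooth smooth_deriv)

lemma has_weak_deriv_unique:
  assumes "has_weak_deriv L f g" "has_weak_deriv L f g'" "g \<in> L2 L" "g' \<in> L2 L"
  shows "AE x in interval_measure L. g x = g' x"
proof -
  have d: "g - g' \<in> L2 L" using assms by auto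
  have "AE x in interval_measure L. (g - g') x = 0"
  proof (rule fundamental_lemma[OF L2_integrable[OF d]])
    fix \<theta> assume \<theta>: "test_function_on {0<..<L} \<theta>"
    have "L2_ip L (g - g') \<theta> = 0"
      using assms \<theta> test_function_L2(1)[OF \<theta>] by (simp add: L2.diff_left has_weak_deriv_iff)
    then show "(LINT x|interval_measure L. (g - g') x * \<theta> x) = 0" by (simp add: L2_ip_def)
  qed
  then show ?thesis by (simp add: fun_diff_def)
qed

lemma H1D:
  assumes "f \<in> H1 L"
  shows "f \<in> L2 L" "weak_deriv L f \<in> L2 L" "has_weak_deriv L f (weak_deriv L f)"
proof -
  have "\<exists>g. g \<in> L2 L \<and> has_weak_deriv L f g" using assms by (auto simp: H1_def)
  then show "weak_deriv L f \<in> L2 L" "has_weak_deriv L f (weak_deriv L f)"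
    unfolding weak_deriv_def by (auto dest!: someI_ex)
qed (use assms in \<open>simp add: H1_def\<close>)

lemma H1I: "f \<in> L2 L \<Longrightarrow> g \<in> L2 L \<Longrightarrow> has_weak_deriv L f g \<Longrightarrow> f \<in> H1 L"
  by (auto simp: H1_def)

lemma weak_deriv_ip:
  assumes "f \<in> L2 L" "g \<in> L2 L" "has_weak_deriv L f g" "h \<in> L2 L"
  shows "L2_ip L (weak_deriv L f) h = L2_ip L g h"
  using H1D[OF H1I[OF assms(1-3)]] assms has_weak_deriv_unique by (intro L2_ip_cong_AE) blast+

lemma has_weak_deriv_add:
  assumes "f \<in> H1 L" "g \<in> H1 L"
  shows "has_weak_deriv L (f + g) (weak_deriv L f + weak_deriv L g)"
  using H1D[OF assms(1)] H1D[OF assms(2)] test_function_L2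
  unfolding has_weak_deriv_iff by (auto simp: L2.add_left)

lemma has_weak_deriv_scale:
  assumes "f \<in> H1 L"
  shows "has_weak_deriv L (c *\<^sub>R f) (c *\<^sub>R weak_deriv L f)"
  using H1D[OF assms(1)] test_function_L2
  unfolding has_weak_deriv_iff by (auto simp: L2.scale_left)

lemma weak_deriv_add_ip:
  assumes "f \<in> H1 L" "g \<in> H1 L" "h \<in> L2 L"
  shows "L2_ip L (weak_deriv L (f + g)) h = L2_ip L (weak_deriv L f) h + L2_ip L (weak_deriv L g) h"
  using weak_deriv_ip[OF _ _ has_weak_deriv_add[OF assms(1,2)] assms(3)] H1D[OF assms(1)] H1D[OF assms(2)] assms(3)
  by (simp add: L2.add_left)

lemma weak_deriv_scale_ip:
  assumes "f \<in> H1 L" "h \<in> L2 L"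
  shows "L2_ip L (weak_deriv L (c *\<^sub>R f)) h = c * L2_ip L (weak_deriv L f) h"
  using weak_deriv_ip[OF _ _ has_weak_deriv_scale[OF assms(1)] assms(2)] H1D[OF assms(1)] assms(2)
  by (simp add: L2.scale_left)

lemma subspace_H1: "subspace (H1 L)"
proof -
  have "has_weak_deriv L 0 0" by (simp add: has_weak_deriv_def)
  then have "0 \<in> H1 L" by (intro H1I[of _ _ 0]) auto
  moreover have "f + g \<in> H1 L" if "f \<in> H1 L" "g \<in> H1 L" for f g
    by (rule H1I[OF _ _ has_weak_deriv_add[OF that]]) (use H1D that in auto)
  moreover have "c *\<^sub>R f \<in> H1 L" if "f \<in> H1 L" for f c
    by (rule H1I[OF _ _ has_weak_deriv_scale[OF that]]) (use H1D that in auto)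
  ultimately show ?thesis by (simp add: subspace_def)
qed

definition dirichlet :: "real \<Rightarrow> (real \<Rightarrow> real) \<Rightarrow> (real \<Rightarrow> real) \<Rightarrow> real" where
  "dirichlet L f g = L2_ip L (weak_deriv L f) (weak_deriv L g)"

definition H1_ip :: "real \<Rightarrow> (real \<Rightarrow> real) \<Rightarrow> (real \<Rightarrow> real) \<Rightarrow> real" where
  "H1_ip L f g = L2_ip L f g + dirichlet L f g"

interpretation D: semi_inner "H1 L" "dirichlet L" for L
proof
  show "subspace (H1 L)" by (rule subspace_H1)
  fix u v w and c :: real assume u: "u \<in> H1 L" 
  show "0 \<le> dirichlet L u u" unfolding dirichlet_def using H1D[OF u] L2.nonneg by blast
  assume v: "v \<in> H1 L"
  show "dirichlet L u v = dirichlet L v u" unfolding dirichlet_def using H1D[OF u] H1D[OF v] L2.commute by blast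
  show "dirichlet L (c *\<^sub>R u) v = c * dirichlet L u v" unfolding dirichlet_def
    using u H1D[OF v] by (simp add: weak_deriv_scale_ip)
  assume w: "w \<in> H1 L"
  show "dirichlet L (u + v) w = dirichlet L u w + dirichlet L v w" unfolding dirichlet_def
    using u v H1D[OF w] by (simp add: weak_deriv_add_ip)
qed

interpretation H1: semi_inner "H1 L" "H1_ip L" for L
proof
  show "subspace (H1 L)" by (rule subspace_H1)
  fix u v w and c :: real assume u: "u \<in> H1 L" 
  show "0 \<le> H1_ip L u u" using L2.nonneg[OF H1D(1)[OF u]] D.nonneg[OF u] by (simp add: H1_ip_def)
  assume v: "v \<in> H1 L"
  show "H1_ip L u v = H1_ip L v u"
    using D.commute[OF u v] L2.commute[OF H1D(1)[OF u] H1D(1)[OF v]] by (simp add: H1_ip_def)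
  show "H1_ip L (c *\<^sub>R u) v = c * H1_ip L u v"
    using D.scale_left[OF u v] L2.scale_left[OF H1D(1)[OF u] H1D(1)[OF v]] by (simp add: H1_ip_def distrib_left)
  assume w: "w \<in> H1 L"
  show "H1_ip L (u + v) w = H1_ip L u w + H1_ip L v w"
    using D.add_left[OF u v w] L2.add_left[OF H1D(1)[OF u] H1D(1)[OF v] H1D(1)[OF w]] by (simp add: H1_ip_def)
qed

lemma H1_norm_eq: "f \<in> H1 L \<Longrightarrow> H1_norm L f = sqrt (H1_ip L f f)"
  unfolding H1_norm_def H1_ip_def dirichlet_def L2_norm_eq using H1D[of f L] L2.nonneg by simp

lemma H1_norm_sq: "f \<in> H1 L \<Longrightarrow> (H1_norm L f)\<^sup>2 = H1_ip L f f"
  using H1.nonneg by (simp add: H1_norm_eq)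

lemma L2_le_H1: "f \<in> H1 L \<Longrightarrow> L2_ip L f f \<le> H1_ip L f f"
  using D.nonneg[of f L] by (simp add: H1_ip_def)

lemma dirichlet_le_H1: "f \<in> H1 L \<Longrightarrow> dirichlet L f f \<le> H1_ip L f f"
  using L2.nonneg[OF H1D(1)[of f L]] by (simp add: H1_ip_def)

lemma dirichlet_eq:
  assumes "f \<in> L2 L" "g \<in> L2 L" "has_weak_deriv L f g"
  shows "dirichlet L f f = L2_ip L g g"
proof -
  have w: "weak_deriv L f \<in> L2 L" using H1D(2)[OF H1I[OF assms]] .
  have "dirichlet L f f = L2_ip L g (weak_deriv L f)" unfolding dirichlet_def by (rule weak_deriv_ip[OF assms w])
  also have "\<dots> = L2_ip L (weak_deriv L f) g" using w assms by (intro L2.commute)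
  also have "\<dots> = L2_ip L g g" by (rule weak_deriv_ip[OF assms assms(2)])
  finally show ?thesis .
qed

lemma weak_deriv_diff_ip:
  assumes "f \<in> H1 L" "g \<in> H1 L" "h \<in> L2 L"
  shows "L2_ip L (weak_deriv L (f - g)) h = L2_ip L (weak_deriv L f - weak_deriv L g) h"
  using weak_deriv_add_ip[of "f - g" L g h] assms H1D[OF assms(1)] H1D[OF assms(2)] by (simp add: L2.diff_left)

lemma dirichlet_diff:
  assumes "f \<in> H1 L" "g \<in> H1 L"
  shows "dirichlet L (f - g) (f - g) = L2.sq L (weak_deriv L f - weak_deriv L g)"
proof -
  have fg: "f - g \<in> H1 L" and w: "weak_deriv L f - weak_deriv L g \<in> L2 L" "weak_deriv L (f - g) \<in> L2 L"
    using assms H1D by (auto intro!: H1D(2))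
  have "dirichlet L (f - g) (f - g) = L2_ip L (weak_deriv L f - weak_deriv L g) (weak_deriv L (f - g))"
    unfolding dirichlet_def using weak_deriv_diff_ip[OF assms w(2)] .
  also have "\<dots> = L2_ip L (weak_deriv L (f - g)) (weak_deriv L f - weak_deriv L g)" using w by (intro L2.commute)
  also have "\<dots> = L2.sq L (weak_deriv L f - weak_deriv L g)"
    by (rule weak_deriv_diff_ip[OF assms w(1)])
  finally show ?thesis .
qed

interpretation H1: semi_hilbert "H1 L" "H1_ip L" for L
proof
  fix s :: "nat \<Rightarrow> real \<Rightarrow> real"
  assume s: "\<And>i. s i \<in> H1 L"
    and cauchy: "\<And>\<epsilon>. \<epsilon> > 0 \<Longrightarrow> \<exists>N. \<forall>i\<ge>N. \<forall>j\<ge>N. H1.sq L (s i - s j) < \<epsilon>"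
  define g where "g i = weak_deriv L (s i)" for i
  have sL: "s i \<in> L2 L" and gL: "g i \<in> L2 L" and sg: "has_weak_deriv L (s i) (g i)" for i
    using H1D[OF s] by (auto simp: g_def)
  have "\<exists>p\<in>L2 L. (\<lambda>i. L2.sq L (s i - p)) \<longlonglongrightarrow> 0"
  proof (rule L2.complete[OF sL])
    show "\<exists>N. \<forall>i\<ge>N. \<forall>j\<ge>N. L2.sq L (s i - s j) < \<epsilon>" if "\<epsilon> > 0" for \<epsilon>
      using cauchy[OF that] L2_le_H1[of "s _ - s _" L] s by (meson D.closed(3) le_less_trans)
  qed
  then obtain f where f: "f \<in> L2 L" "(\<lambda>i. L2.sq L (s i - f)) \<longlonglongrightarrow> 0" by blast
  have "\<exists>p\<in>L2 L. (\<lambda>i. L2.sq L (g i - p)) \<longlonglongrightarrow> 0"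
  proof (rule L2.complete[OF gL])
    show "\<exists>N. \<forall>i\<ge>N. \<forall>j\<ge>N. L2.sq L (g i - g j) < \<epsilon>" if "\<epsilon> > 0" for \<epsilon>
    proof -
      have "L2.sq L (g i - g j) \<le> H1.sq L (s i - s j)" for i j
        using dirichlet_diff[OF s s, of i j] dirichlet_le_H1[of "s i - s j" L] s by (simp add: g_def)
      then show ?thesis using cauchy[OF that] by (meson le_less_trans)
    qed
  qed
  then obtain h where h: "h \<in> L2 L" "(\<lambda>i. L2.sq L (g i - h)) \<longlonglongrightarrow> 0" by blast
  have fh: "has_weak_deriv L f h"
    unfolding has_weak_deriv_iff
  proof (intro allI impI)
    fix \<theta> assume \<theta>: "test_function_on {0<..<L} \<theta>"
    have "(\<lambda>i. L2_ip L (s i) (deriv \<theta>)) \<longlonglongrightarrow> L2_ip L f (deriv \<theta>)"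
      by (rule L2.ip_tendsto[OF sL f(1) test_function_L2(2)[OF \<theta>] f(2)])
    moreover have "(\<lambda>i. - L2_ip L (g i) \<theta>) \<longlonglongrightarrow> - L2_ip L h \<theta>"
      by (intro tendsto_minus L2.ip_tendsto[OF gL h(1) test_function_L2(1)[OF \<theta>] h(2)])
    moreover have "L2_ip L (s i) (deriv \<theta>) = - L2_ip L (g i) \<theta>" for i
      using sg \<theta> by (simp add: has_weak_deriv_iff)
    ultimately show "L2_ip L f (deriv \<theta>) = - L2_ip L h \<theta>" by (simp add: LIMSEQ_unique)
  qed
  have fH1: "f \<in> H1 L" by (rule H1I[OF f(1) h(1) fh])
  have "dirichlet L (s i - f) (s i - f) = L2.sq L (g i - h)" for i
  proof (rule dirichlet_eq)
    show "has_weak_deriv L (s i - f) (g i - h)"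
      using sg[of i] fh sL[of i] gL[of i] f(1) h(1) test_function_L2
      unfolding has_weak_deriv_iff by (auto simp: L2.diff_left)
  qed (use sL gL f h in auto)
  then have "(\<lambda>i. H1.sq L (s i - f)) \<longlonglongrightarrow> 0"
    using tendsto_add[OF f(2) h(2)] by (simp add: H1_ip_def)
  then show "\<exists>p\<in>H1 L. (\<lambda>i. H1.sq L (s i - p)) \<longlonglongrightarrow> 0" using fH1 by blast
qed

section \<open>The space \<open>H\<^sub>0\<^sup>1\<close>\<close>

lemma test_function_H1: "0 < L \<Longrightarrow> test_function_on S \<theta> \<Longrightarrow> \<theta> \<in> H1 L"
  by (rule H1I[OF _ _ has_weak_deriv_smooth]) (auto intro: test_function_L2 test_function_smooth)

text \<open>Approximation up to every \<open>\<epsilon>\<close> in the squared norm replaces approximating sequences of test functions.\<close>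

lemma H10_iff:
  assumes L: "0 < L"
  shows "f \<in> H10 L \<longleftrightarrow> f \<in> H1 L \<and> (\<forall>\<epsilon>>0. \<exists>\<theta>. test_function_on {0<..<L} \<theta> \<and> H1.sq L (f - \<theta>) < \<epsilon>)"
proof safe
  assume "f \<in> H10 L"
  then obtain \<theta> where f: "f \<in> H1 L" and \<theta>: "\<And>i::nat. test_function_on {0<..<L} (\<theta> i)"
    and lim: "(\<lambda>i. H1_norm L (f - \<theta> i)) \<longlonglongrightarrow> 0" by (auto simp: H10_def)
  show "f \<in> H1 L" by (rule f)
  fix \<epsilon> :: real assume \<epsilon>: "\<epsilon> > 0"
  have d: "f - \<theta> i \<in> H1 L" for i using f test_function_H1[OF L \<theta>] by auto
  have "(\<lambda>i. (H1_norm L (f - \<theta> i))\<^sup>2) \<longlonglongrightarrow> 0" using tendsto_power[OF lim, of 2] by simp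
  then have "(\<lambda>i. H1.sq L (f - \<theta> i)) \<longlonglongrightarrow> 0" using H1_norm_sq[OF d] by simp
  from order_tendstoD(2)[OF this \<epsilon>] show "\<exists>\<theta>. test_function_on {0<..<L} \<theta> \<and> H1.sq L (f - \<theta>) < \<epsilon>"
    using \<theta> by (auto simp: eventually_sequentially)
next
  assume f: "f \<in> H1 L" and ap: "\<forall>\<epsilon>>0. \<exists>\<theta>. test_function_on {0<..<L} \<theta> \<and> H1.sq L (f - \<theta>) < \<epsilon>"
  have "\<exists>\<theta>. test_function_on {0<..<L} \<theta> \<and> H1.sq L (f - \<theta>) < inverse (real (Suc i))" for i
    using ap by (auto dest: spec[of _ "inverse (real (Suc i))"])
  then obtain \<theta> where \<theta>: "\<And>i. test_function_on {0<..<L} (\<theta> i)"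
    and lt: "\<And>i. H1.sq L (f - \<theta> i) < inverse (real (Suc i))" by metis
  have d: "f - \<theta> i \<in> H1 L" for i using f test_function_H1[OF L \<theta>] by auto
  have "(\<lambda>i. H1.sq L (f - \<theta> i)) \<longlonglongrightarrow> 0"
    by (rule tendsto_sandwich[OF _ _ tendsto_const LIMSEQ_inverse_real_of_nat])
       (use H1.nonneg[OF d] lt in \<open>auto intro!: always_eventually less_imp_le\<close>)
  then have "(\<lambda>i. H1_norm L (f - \<theta> i)) \<longlonglongrightarrow> 0"
    using tendsto_real_sqrt H1_norm_eq[OF d] by fastforce
  then show "f \<in> H10 L" using f \<theta> by (auto simp: H10_def)
qed

lemma H10_H1: "f \<in> H10 L \<Longrightarrow> f \<in> H1 L"
  by (simp add: H10_def)

lemma H10_closed: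
  assumes L: "0 < L" and f: "f \<in> H1 L" and ap: "\<And>\<epsilon>. \<epsilon> > 0 \<Longrightarrow> \<exists>g\<in>H10 L. H1.sq L (f - g) < \<epsilon>"
  shows "f \<in> H10 L"
  unfolding H10_iff[OF L]
proof (intro conjI allI impI)
  fix \<epsilon> :: real assume "\<epsilon> > 0"
  define \<delta> where "\<delta> = sqrt \<epsilon> / 2"
  have \<delta>: "\<delta> > 0" using \<open>\<epsilon> > 0\<close> by (simp add: \<delta>_def)
  obtain g where g: "g \<in> H10 L" "H1.sq L (f - g) < \<delta>\<^sup>2" using ap[of "\<delta>\<^sup>2"] \<delta> by auto
  obtain \<theta> where \<theta>: "test_function_on {0<..<L} \<theta>" "H1.sq L (g - \<theta>) < \<delta>\<^sup>2"
    using g(1) \<delta> unfolding H10_iff[OF L] by (meson zero_less_power)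
  have mem: "f - g \<in> H1 L" "g - \<theta> \<in> H1 L" "f - \<theta> \<in> H1 L"
    using f g(1) test_function_H1[OF L \<theta>(1)] by (auto dest: H10_H1)
  have "sqrt (H1.sq L (f - \<theta>)) \<le> sqrt (H1.sq L (f - g)) + sqrt (H1.sq L (g - \<theta>))"
    using H1.triangle[OF mem(1,2)] by simp
  also have "\<dots> < \<delta> + \<delta>"
    using g(2) \<theta>(2) \<delta> by (intro add_strict_mono real_less_lsqrt) auto
  also have "\<dots> = sqrt \<epsilon>" by (simp add: \<delta>_def)
  finally have "H1.sq L (f - \<theta>) < \<epsilon>" by simp
  then show "\<exists>\<theta>. test_function_on {0<..<L} \<theta> \<and> H1.sq L (f - \<theta>) < \<epsilon>" using \<theta>(1) by blast
qed (rule f)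

lemma test_function_H10: "0 < L \<Longrightarrow> test_function_on {0<..<L} \<theta> \<Longrightarrow> \<theta> \<in> H10 L"
  by (auto simp: H10_iff test_function_H1 intro!: exI[of _ \<theta>])

lemma subspace_H10:
  assumes L: "0 < L"
  shows "subspace (H10 L)"
proof -
  note mem = H10_H1 test_function_H1[OF L]
  have "f + g \<in> H10 L" if f: "f \<in> H10 L" and g: "g \<in> H10 L" for f g
    unfolding H10_iff[OF L]
  proof (intro conjI allI impI)
    fix \<epsilon> :: real assume "\<epsilon> > 0"
    then have e: "\<epsilon> / 4 > 0" by simp
    obtain \<theta> where \<theta>: "test_function_on {0<..<L} \<theta>" "H1.sq L (f - \<theta>) < \<epsilon> / 4"
      using f e unfolding H10_iff[OF L] by blast
    obtain \<eta> where \<eta>: "test_function_on {0<..<L} \<eta>" "H1.sq L (g - \<eta>) < \<epsilon> / 4"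
      using g e unfolding H10_iff[OF L] by blast
    have "test_function_on {0<..<L} (\<theta> + \<eta>)" using test_function_add[OF \<theta>(1) \<eta>(1)] by (simp add: plus_fun_def)
    moreover have "H1.sq L (f + g - (\<theta> + \<eta>)) < \<epsilon>"
      using H1.sq_add_le[of "f - \<theta>" L "g - \<eta>"] mem(1)[OF f] mem(1)[OF g] mem(2)[OF \<theta>(1)] mem(2)[OF \<eta>(1)] \<theta>(2) \<eta>(2)
      by (simp add: add_diff_add)
    ultimately show "\<exists>\<theta>. test_function_on {0<..<L} \<theta> \<and> H1.sq L (f + g - \<theta>) < \<epsilon>" by blast
  qed (use f g mem(1) in auto)
  moreover have "c *\<^sub>R f \<in> H10 L" if f: "f \<in> H10 L" for f c
    unfolding H10_iff[OF L]
  proof (intro conjI allI impI)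
    fix \<epsilon> :: real assume \<epsilon>: "\<epsilon> > 0"
    have c: "c\<^sup>2 + 1 > 0" by (simp add: add_nonneg_pos)
    then obtain \<theta> where \<theta>: "test_function_on {0<..<L} \<theta>" "H1.sq L (f - \<theta>) < \<epsilon> / (c\<^sup>2 + 1)"
      using f \<epsilon> unfolding H10_iff[OF L] by (meson divide_pos_pos)
    have d: "f - \<theta> \<in> H1 L" using mem(1)[OF f] mem(2)[OF \<theta>(1)] by auto
    have "H1.sq L (c *\<^sub>R f - c *\<^sub>R \<theta>) = c\<^sup>2 * H1.sq L (f - \<theta>)"
      using H1.sq_scale[OF d] by (simp add: scaleR_diff_right)
    also have "\<dots> \<le> (c\<^sup>2 + 1) * H1.sq L (f - \<theta>)" using H1.nonneg[OF d] by (simp add: distrib_right)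
    also have "\<dots> < \<epsilon>" using \<theta>(2) c by (simp add: field_simps)
    finally have "H1.sq L (c *\<^sub>R f - c *\<^sub>R \<theta>) < \<epsilon>" .
    moreover have "test_function_on {0<..<L} (c *\<^sub>R \<theta>)"
      using test_function_scale[OF \<theta>(1), of c] by (simp add: scaleR_fun_def)
    ultimately show "\<exists>\<theta>. test_function_on {0<..<L} \<theta> \<and> H1.sq L (c *\<^sub>R f - \<theta>) < \<epsilon>" by blast
  qed (use f mem(1) in auto)
  moreover have "0 \<in> H10 L" using test_function_H10[OF L test_function_zero] by (simp add: zero_fun_def)
  ultimately show ?thesis by (simp add: subspace_def)
qed

section \<open>Primitives\<close>

text \<open>The integral of \<open>g\<close> over \<open>(0, x)\<close>. As an inner product it is visibly linear and continuous in
  \<open>g\<close>, and depends on \<open>g\<close> only up to null sets.\<close>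

definition primitive :: "real \<Rightarrow> (real \<Rightarrow> real) \<Rightarrow> real \<Rightarrow> real" where
  "primitive L g x = L2_ip L g (indicator {0<..<x})"

lemma indicator_L2: "indicator {x<..<y} \<in> L2 L"
proof (rule L2_bounded)
  have "(indicator {x<..<y} :: real \<Rightarrow> real) \<in> borel_measurable lebesgue"
    by (rule borel_measurable_indicator) simp
  then show "(indicator {x<..<y} :: real \<Rightarrow> real) \<in> borel_measurable (interval_measure L)" by (rule measurable_restrict_space1)
  show "\<bar>indicator {x<..<y} z :: real\<bar> \<le> 1" for z by (simp add: indicator_def)
qed

lemma primitive_diff: "g \<in> L2 L \<Longrightarrow> h \<in> L2 L \<Longrightarrow> primitive L (g - h) x = primitive L g x - primitive L h x"
  by (simp add: primitive_def L2.diff_left indicator_L2)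

text \<open>Cauchy--Schwarz against the indicator of \<open>(x, y)\<close>, whose \<open>L\<^sup>2\<close>-norm is \<open>\<surd>(y - x)\<close>.\<close>

lemma primitive_hoelder:
  assumes g: "g \<in> L2 L" and x: "x \<in> {0..L}" "y \<in> {0..L}"
  shows "\<bar>primitive L g x - primitive L g y\<bar> \<le> sqrt \<bar>x - y\<bar> * sqrt (L2_ip L g g)"
  using x
proof (induction x y rule: linorder_wlog)
  case (le x y)
  have "primitive L g y - primitive L g x = L2_ip L g (indicator {0<..<y} - indicator {0<..<x})"
    using g by (simp add: primitive_def L2.diff_right indicator_L2)
  also have "\<dots> = L2_ip L g (indicator {x<..<y})"
  proof -
    have "AE z in lebesgue. z \<noteq> x" by (rule AE_completion, rule AE_lborel_singleton)
    then have "AE z in interval_measure L. (indicator {0<..<y} - indicator {0<..<x}) z = (indicator {x<..<y} z :: real)"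
      using le by (subst AE_restrict_space_iff) (auto elim!: eventually_mono simp: indicator_def fun_diff_def)
    then have "L2_ip L (indicator {0<..<y} - indicator {0<..<x}) g = L2_ip L (indicator {x<..<y}) g"
      using g by (intro L2_ip_cong_AE) (auto intro: indicator_L2)
    then show ?thesis using g by (simp add: L2.commute[of g] indicator_L2)
  qed
  finally have eq: "\<bar>primitive L g x - primitive L g y\<bar> = \<bar>L2_ip L g (indicator {x<..<y})\<bar>"
    by (simp add: abs_minus_commute)
  have "L2.sq L (indicator {x<..<y}) = (LINT z|interval_measure L. indicator {x<..<y} z)"
    unfolding L2_ip_def by (intro Bochner_Integration.integral_cong) (auto simp: indicator_def)
  also have "\<dots> = (LINT z|lebesgue. indicator {x<..<y} z)"
  proof -
    have "indicator {0<..<L} z *\<^sub>R indicator {x<..<y} z = (indicator {x<..<y} z :: real)" for z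
      using le by (auto simp: indicator_def)
    moreover have "{0<..<L} \<inter> space lebesgue \<in> sets lebesgue" by simp
    ultimately show ?thesis by (simp only: integral_restrict_space)
  qed
  also have "\<dots> = y - x" using le by simp
  finally have ind: "L2.sq L (indicator {x<..<y}) = y - x" .
  show ?case using L2.abs_ip_le[OF g indicator_L2, of x y] le unfolding eq ind by (simp add: mult.commute)
qed (simp add: abs_minus_commute)

lemma primitive_0 [simp]: "primitive L g 0 = 0"
  by (simp add: primitive_def L2_ip_def)

lemma primitive_bound:
  assumes g: "g \<in> L2 L" and x: "x \<in> {0..L}"
  shows "\<bar>primitive L g x\<bar> \<le> sqrt L * sqrt (L2_ip L g g)"
proof -
  have "\<bar>primitive L g x\<bar> \<le> sqrt x * sqrt (L2_ip L g g)" using primitive_hoelder[OF g x, of 0] x by simp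
  also have "\<dots> \<le> sqrt L * sqrt (L2_ip L g g)" using x L2.nonneg[OF g] by (intro mult_right_mono) auto
  finally show ?thesis .
qed

lemma primitive_continuous:
  assumes g: "g \<in> L2 L"
  shows "continuous_on {0..L} (primitive L g)"
  unfolding continuous_on_def
proof
  fix x assume x: "x \<in> {0..L}"
  have "((\<lambda>y. primitive L g y - primitive L g x) \<longlongrightarrow> 0) (at x within {0..L})"
  proof (rule Lim_null_comparison)
    show "\<forall>\<^sub>F y in at x within {0..L}. norm (primitive L g y - primitive L g x) \<le> sqrt \<bar>y - x\<bar> * sqrt (L2_ip L g g)"
      using primitive_hoelder[OF g _ x] by (auto simp: eventually_at_filter)
    have "((\<lambda>y. sqrt \<bar>y - x\<bar> * sqrt (L2_ip L g g)) \<longlongrightarrow> sqrt \<bar>x - x\<bar> * sqrt (L2_ip L g g)) (at x within {0..L})"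
      by (intro tendsto_intros)
    then show "((\<lambda>y. sqrt \<bar>y - x\<bar> * sqrt (L2_ip L g g)) \<longlongrightarrow> 0) (at x within {0..L})" by simp
  qed
  then show "(primitive L g \<longlongrightarrow> primitive L g x) (at x within {0..L})" by (simp add: LIM_zero_iff)
qed

lemma primitive_L2: "g \<in> L2 L \<Longrightarrow> primitive L g \<in> L2 L"
  by (rule L2_continuous[OF primitive_continuous])

lemma L2_ip_le_sup:
  assumes L: "0 < L" and f: "f \<in> L2 L" and b: "AE x in interval_measure L. \<bar>f x\<bar> \<le> K"
  shows "L2_ip L f f \<le> L * K\<^sup>2"
proof -
  have "L2_ip L f f \<le> (LINT x|interval_measure L. K\<^sup>2)"
    unfolding L2_ip_def
  proof (rule integral_mono_AE)
    show "integrable (interval_measure L) (\<lambda>x. K\<^sup>2)" using L2_integrable[OF L2_const] .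
    show "AE x in interval_measure L. f x * f x \<le> K\<^sup>2"
      using b by eventually_elim (metis abs_ge_zero abs_mult_self_eq mult_mono' power2_eq_square)
  qed (use L2_mult_integrable[OF f f] in simp)
  then show ?thesis using L by (simp add: measure_restrict_space)
qed

lemma primitive_test_function:
  assumes L: "0 < L" and \<theta>: "test_function_on {0<..<L} \<theta>" and x: "x \<in> {0<..<L}"
  shows "\<theta> x = primitive L (deriv \<theta>) x"
proof -
  have s: "smooth \<theta>" using \<theta> by (rule test_function_smooth)
  have c: "continuous_on S (deriv \<theta>)" for S using s by (intro smooth_continuous_on smooth_deriv)
  have "(deriv \<theta> has_integral (\<theta> x - \<theta> 0)) {0..x}"
    by (rule fundamental_theorem_of_calculus)
       (use x smooth_DERIV[OF s] in \<open>auto simp: has_real_derivative_iff_has_vector_derivative[symmetric] intro: has_field_derivative_at_within\<close>)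
  then have "\<theta> x = integral {0..x} (deriv \<theta>)" using test_function_outside[OF \<theta>, of 0] by (simp add: integral_unique)
  also have "\<dots> = (LINT z|interval_measure x. deriv \<theta> z)" using integral_interval_continuous(2)[OF c] by simp
  also have "\<dots> = primitive L (deriv \<theta>) x"
    unfolding primitive_def L2_ip_def
    by (subst (1 2) integral_restrict_space) (use x in \<open>auto intro!: Bochner_Integration.integral_cong simp: indicator_def\<close>)
  finally show ?thesis .
qed

text \<open>For test functions this is the fundamental theorem of calculus. Both sides are continuous in the
  \<open>H\<^sup>1\<close>-norm with values in \<open>L\<^sup>2\<close>, so the equation passes to the closure.\<close>

lemma H10_eq_primitive:
  assumes L: "0 < L" and f: "f \<in> H10 L"
  shows "AE x in interval_measure L. f x = primitive L (weak_deriv L f) x"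
proof -
  have fH1: "f \<in> H1 L" using f by (rule H10_H1)
  define g where "g = weak_deriv L f"
  have mem: "f \<in> L2 L" "g \<in> L2 L" using H1D[OF fH1] by (auto simp: g_def)
  define F where "F = primitive L g"
  have F: "F \<in> L2 L" unfolding F_def by (rule primitive_L2[OF mem(2)])
  have bound: "sqrt (L2.sq L (f - F)) \<le> (1 + L) * sqrt \<epsilon>" if \<epsilon>: "\<epsilon> > 0" for \<epsilon>
  proof -
    obtain \<theta> where \<theta>: "test_function_on {0<..<L} \<theta>" "H1.sq L (f - \<theta>) < \<epsilon>"
      using f \<epsilon> unfolding H10_iff[OF L] by blast
    have \<theta>L: "\<theta> \<in> L2 L" "deriv \<theta> \<in> L2 L" "\<theta> \<in> H1 L" "has_weak_deriv L \<theta> (deriv \<theta>)"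
      using test_function_L2[OF \<theta>(1)] test_function_H1[OF L \<theta>(1)] has_weak_deriv_smooth[OF L test_function_smooth[OF \<theta>(1)]] by auto
    have dL: "deriv \<theta> - g \<in> L2 L" using \<theta>L mem by auto
    have "has_weak_deriv L (f - \<theta>) (g - deriv \<theta>)"
      using \<theta>L mem H1D(3)[OF fH1] test_function_L2 unfolding g_def[symmetric] has_weak_deriv_iff
      by (auto simp: L2.diff_left)
    then have "dirichlet L (f - \<theta>) (f - \<theta>) = L2.sq L (g - deriv \<theta>)"
      using \<theta>L mem by (intro dirichlet_eq) auto
    also have "\<dots> = L2.sq L (deriv \<theta> - g)" using \<theta>L mem by (intro L2.sq_minus_commute)
    finally have D: "L2.sq L (deriv \<theta> - g) \<le> \<epsilon>"
      using dirichlet_le_H1[of "f - \<theta>" L] \<theta>(2) \<theta>L(3) fH1 by simp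
    have "L2.sq L (\<theta> - F) \<le> L * (sqrt L * sqrt \<epsilon>)\<^sup>2"
    proof (rule L2_ip_le_sup[OF L])
      show "AE x in interval_measure L. \<bar>(\<theta> - F) x\<bar> \<le> sqrt L * sqrt \<epsilon>"
      proof (rule AE_I2)
        fix x assume "x \<in> space (interval_measure L)"
        then have x: "x \<in> {0<..<L}" by simp
        have "\<bar>(\<theta> - F) x\<bar> = \<bar>primitive L (deriv \<theta> - g) x\<bar>"
          using primitive_test_function[OF L \<theta>(1) x] \<theta>L mem by (simp add: F_def primitive_diff)
        also have "\<dots> \<le> sqrt L * sqrt (L2.sq L (deriv \<theta> - g))"
          using x by (intro primitive_bound dL) auto
        also have "\<dots> \<le> sqrt L * sqrt \<epsilon>" using D L by (intro mult_left_mono) auto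
        finally show "\<bar>(\<theta> - F) x\<bar> \<le> sqrt L * sqrt \<epsilon>" .
      qed
    qed (use \<theta>L F in auto)
    also have "\<dots> = (L * sqrt \<epsilon>)\<^sup>2" using L by (simp add: power2_eq_square)
    finally have 1: "sqrt (L2.sq L (\<theta> - F)) \<le> L * sqrt \<epsilon>" using L \<epsilon> by (intro real_le_lsqrt) auto
    have "L2.sq L (f - \<theta>) \<le> \<epsilon>" using L2_le_H1[of "f - \<theta>" L] \<theta>(2) \<theta>L(3) fH1 by simp
    then have 2: "sqrt (L2.sq L (f - \<theta>)) \<le> sqrt \<epsilon>" by simp
    have "sqrt (L2.sq L (f - F)) \<le> sqrt (L2.sq L (f - \<theta>)) + sqrt (L2.sq L (\<theta> - F))"
      using L2.triangle[of "f - \<theta>" L "\<theta> - F"] mem \<theta>L F by simp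
    also have "\<dots> \<le> sqrt \<epsilon> + L * sqrt \<epsilon>" by (rule add_mono[OF 2 1])
    finally show ?thesis by (simp add: distrib_right)
  qed
  have dF: "f - F \<in> L2 L" using mem F by auto
  have "sqrt (L2.sq L (f - F)) \<le> 0"
  proof (rule field_le_epsilon)
    fix e :: real assume "e > 0"
    then show "sqrt (L2.sq L (f - F)) \<le> 0 + e"
      using bound[of "(e / (1 + L))\<^sup>2"] L by simp
  qed
  then have "L2.sq L (f - F) = 0" using L2.nonneg[OF dF] by simp
  then have "AE x in interval_measure L. (f - F) x = 0" using L2_ip_self_eq_0_iff[OF dF] by simp
  then show ?thesis by (simp add: F_def g_def)
qed

lemma cont_rep_eq_primitive:
  assumes L: "0 < L" and f: "f \<in> H10 L" and x: "x \<in> {0<..<L}"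
  shows "cont_rep L f x = primitive L (weak_deriv L f) x"
proof -
  define F where "F = primitive L (weak_deriv L f)"
  have cF: "continuous_on {0<..<L} F" unfolding F_def
    by (rule continuous_on_subset[OF primitive_continuous[OF H1D(2)[OF H10_H1[OF f]]]]) auto
  have eF: "AE x in interval_measure L. F x = f x"
    using H10_eq_primitive[OF L f] by (auto simp: F_def elim: eventually_mono)
  have "continuous_on {0<..<L} (cont_rep L f) \<and> (AE x in interval_measure L. cont_rep L f x = f x)"
    unfolding cont_rep_def by (rule someI[of _ F]) (use cF eF in blast)
  then have c: "continuous_on {0<..<L} (cont_rep L f)" "AE x in interval_measure L. cont_rep L f x = f x" by auto
  have "AE x in interval_measure L. cont_rep L f x = F x" using c(2) eF by eventually_elim simp
  then show ?thesis using continuous_AE_eq_imp_eq[OF c(1) cF _ x] by (simp add: F_def)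
qed

lemma cont_rep_linear:
  assumes L: "0 < L" and f: "f \<in> H10 L" and x: "x \<in> {0<..<L}"
  shows "g \<in> H10 L \<Longrightarrow> cont_rep L (f + g) x = cont_rep L f x + cont_rep L g x"
    and "cont_rep L (c *\<^sub>R f) x = c * cont_rep L f x"
proof -
  have sc: "c *\<^sub>R f \<in> H10 L" using subspace_H10[OF L] f by (rule subspace_scale)
  show "cont_rep L (c *\<^sub>R f) x = c * cont_rep L f x"
    using cont_rep_eq_primitive[OF L f x] cont_rep_eq_primitive[OF L sc x] H10_H1[OF f]
    by (simp add: primitive_def weak_deriv_scale_ip indicator_L2)
  assume g: "g \<in> H10 L"
  have ad: "f + g \<in> H10 L" using subspace_H10[OF L] f g by (rule subspace_add)
  show "cont_rep L (f + g) x = cont_rep L f x + cont_rep L g x"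
    using cont_rep_eq_primitive[OF L f x] cont_rep_eq_primitive[OF L g x] cont_rep_eq_primitive[OF L ad x] H10_H1[OF f] H10_H1[OF g]
    by (simp add: primitive_def weak_deriv_add_ip indicator_L2)
qed

lemma cont_rep_bound:
  assumes L: "0 < L" and f: "f \<in> H10 L" and x: "x \<in> {0<..<L}"
  shows "(cont_rep L f x)\<^sup>2 \<le> L * dirichlet L f f"
proof -
  have w: "weak_deriv L f \<in> L2 L" using H1D(2)[OF H10_H1[OF f]] .
  have "\<bar>cont_rep L f x\<bar> \<le> sqrt L * sqrt (dirichlet L f f)"
    using primitive_bound[OF w, of x] x cont_rep_eq_primitive[OF L f x] by (simp add: dirichlet_def)
  then have "(cont_rep L f x)\<^sup>2 \<le> (sqrt L * sqrt (dirichlet L f f))\<^sup>2" by (metis abs_ge_zero power2_abs power_mono)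
  then show ?thesis using L D.nonneg[OF H10_H1[OF f]] by (simp add: power_mult_distrib)
qed

lemma poincare:
  assumes L: "0 < L" and f: "f \<in> H10 L"
  shows "L2_ip L f f \<le> L\<^sup>2 * dirichlet L f f"
proof -
  have w: "weak_deriv L f \<in> L2 L" "f \<in> L2 L" using H1D[OF H10_H1[OF f]] by auto
  have "L2_ip L f f \<le> L * (sqrt L * sqrt (dirichlet L f f))\<^sup>2"
  proof (rule L2_ip_le_sup[OF L w(2)])
    show "AE x in interval_measure L. \<bar>f x\<bar> \<le> sqrt L * sqrt (dirichlet L f f)"
      using H10_eq_primitive[OF L f] AE_space
    proof eventually_elim
      case (elim x)
      then show ?case using primitive_bound[OF w(1), of x] by (simp add: dirichlet_def)
    qed
  qed
  also have "\<dots> = L\<^sup>2 * dirichlet L f f"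
    using L D.nonneg[OF H10_H1[OF f]] unfolding power_mult_distrib
    by (simp add: power2_eq_square[of L])
  finally show ?thesis .
qed

lemma dirichlet_null:
  assumes f: "f \<in> H1 L" and z: "L2_ip L f f = 0"
  shows "dirichlet L f f = 0"
proof -
  have "L2_ip L f h = 0" if "h \<in> L2 L" for h using L2.ip_eq_0_if_sq_eq_0[OF H1D(1)[OF f] that z] .
  then have "has_weak_deriv L f 0" unfolding has_weak_deriv_iff using test_function_L2 by auto
  then show ?thesis using dirichlet_eq[of f L 0] H1D(1)[OF f] by simp
qed

lemma H10_complete:
  assumes L: "0 < L" and s: "\<And>i::nat. s i \<in> H10 L"
    and cauchy: "\<And>\<epsilon>. \<epsilon> > 0 \<Longrightarrow> \<exists>N. \<forall>i\<ge>N. \<forall>j\<ge>N. H1.sq L (s i - s j) < \<epsilon>"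
  shows "\<exists>p\<in>H10 L. (\<lambda>i. H1.sq L (s i - p)) \<longlonglongrightarrow> 0"
proof -
  obtain p where p: "p \<in> H1 L" "(\<lambda>i. H1.sq L (s i - p)) \<longlonglongrightarrow> 0"
    using H1.complete[OF H10_H1[OF s] cauchy] by blast
  have "p \<in> H10 L"
  proof (rule H10_closed[OF L p(1)])
    fix \<epsilon> :: real assume "\<epsilon> > 0"
    from order_tendstoD(2)[OF p(2) this] obtain i where "H1.sq L (s i - p) < \<epsilon>"
      by (auto simp: eventually_sequentially)
    then show "\<exists>g\<in>H10 L. H1.sq L (p - g) < \<epsilon>"
      using s[of i] H1.sq_minus_commute[OF p(1) H10_H1[OF s[of i]]] by (intro bexI[of _ "s i"]) auto
  qed
  then show ?thesis using p(2) by blast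
qed

text \<open>The continuous representatives are uniformly bounded and Hoelder continuous with exponent 1/2, so the
  theorem of Arzela and Ascoli gives a uniformly convergent subsequence.\<close>

lemma H10_compact:
  assumes L: "0 < L" and s: "\<And>i::nat. s i \<in> H10 L" and M: "\<And>i. dirichlet L (s i) (s i) \<le> M"
  shows "\<exists>r::nat \<Rightarrow> nat. strict_mono r \<and>
    (\<forall>\<epsilon>>0. \<exists>N. \<forall>i\<ge>N. \<forall>j\<ge>N. L2.sq L (s (r i) - s (r j)) < \<epsilon>)"
proof -
  define F where "F i = primitive L (weak_deriv L (s i))" for i
  have w: "weak_deriv L (s i) \<in> L2 L" "s i \<in> L2 L" for i using H1D[OF H10_H1[OF s]] by auto
  have M0: "M \<ge> 0" using M[of 0] D.nonneg[OF H10_H1[OF s[of 0]]] by simp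
  have wM: "sqrt (L2.sq L (weak_deriv L (s i))) \<le> sqrt M" for i
    using M[of i] by (simp add: dirichlet_def)
  obtain G r where r: "strict_mono (r :: nat \<Rightarrow> nat)"
    and lim: "\<And>e. 0 < e \<Longrightarrow> \<exists>N. \<forall>n x. n \<ge> N \<and> x \<in> {0..L} \<longrightarrow> norm (F (r n) x - G x) < e"
  proof (rule Arzela_Ascoli[of "{0..L}" F "sqrt L * sqrt M"])
    show "norm (F n x) \<le> sqrt L * sqrt M" if "x \<in> {0..L}" for n x
    proof -
      have "norm (F n x) \<le> sqrt L * sqrt (L2.sq L (weak_deriv L (s n)))"
        using primitive_bound[OF w(1) that] by (simp add: F_def)
      also have "\<dots> \<le> sqrt L * sqrt M" using L by (intro mult_left_mono wM) auto
      finally show ?thesis .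
    qed
    show "\<exists>d>0. \<forall>n y. y \<in> {0..L} \<and> norm (x - y) < d \<longrightarrow> norm (F n x - F n y) < e"
      if x: "x \<in> {0..L}" and e: "0 < e" for x e
    proof (intro exI[of _ "(e / (sqrt M + 1))\<^sup>2"] conjI allI impI)
      have M1: "0 < sqrt M + 1" using M0 by (smt (verit) real_sqrt_ge_zero)
      then show "0 < (e / (sqrt M + 1))\<^sup>2" using e by simp
      fix n y assume y: "y \<in> {0..L} \<and> norm (x - y) < (e / (sqrt M + 1))\<^sup>2"
      have "norm (F n x - F n y) \<le> sqrt \<bar>x - y\<bar> * sqrt (L2.sq L (weak_deriv L (s n)))"
        using primitive_hoelder[OF w(1) x, of y n] y by (simp add: F_def)
      also have "\<dots> \<le> sqrt \<bar>x - y\<bar> * (sqrt M + 1)" using order_trans[OF wM[of n], of "sqrt M + 1"] by (intro mult_left_mono) simp_all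
      also have "\<dots> < e / (sqrt M + 1) * (sqrt M + 1)"
        using y M1 e by (intro mult_strict_right_mono real_less_lsqrt) auto
      finally show "norm (F n x - F n y) < e" using M1 by simp
    qed
  qed (simp, blast)
  have "\<exists>N. \<forall>i\<ge>N. \<forall>j\<ge>N. L2.sq L (s (r i) - s (r j)) < \<epsilon>" if \<epsilon>: "\<epsilon> > 0" for \<epsilon>
  proof -
    \<comment> \<open>Two functions within e of the same limit are within 2 e of each other, and L (2 e)^2 is half of the prescribed bound.\<close>
    define e where "e = sqrt (\<epsilon> / (2 * L)) / 2"
    have e: "e > 0" using \<epsilon> L by (simp add: e_def)
    obtain N where N: "\<And>n x. n \<ge> N \<Longrightarrow> x \<in> {0..L} \<Longrightarrow> norm (F (r n) x - G x) < e" using lim[OF e] by blast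
    have "L2.sq L (s (r i) - s (r j)) < \<epsilon>" if ij: "i \<ge> N" "j \<ge> N" for i j
    proof -
      have "L2.sq L (s (r i) - s (r j)) \<le> L * (2 * e)\<^sup>2"
      proof (rule L2_ip_le_sup[OF L])
        show "s (r i) - s (r j) \<in> L2 L" using w by auto
        show "AE x in interval_measure L. \<bar>(s (r i) - s (r j)) x\<bar> \<le> 2 * e"
          using H10_eq_primitive[OF L s[of "r i"]] H10_eq_primitive[OF L s[of "r j"]] AE_space
        proof eventually_elim
          case (elim x)
          then have "x \<in> {0..L}" by simp
          then show ?case using N[OF ij(1)] N[OF ij(2)] elim(1,2) unfolding F_def[symmetric] by (simp add: abs_le_iff) (smt (verit))
        qed
      qed
      also have "\<dots> = \<epsilon> / 2" using \<epsilon> L by (simp add: e_def)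
      finally show ?thesis using \<epsilon> by simp
    qed
    then show ?thesis by blast
  qed
  then show ?thesis using r by blast
qed

section \<open>The energy form\<close>

interpretation L2n: seminormed "L2 L" "L2_norm L" for L
proof
  show "subspace (L2 L)" by (rule subspace_L2)
qed (simp_all add: L2_norm_eq L2.triangle L2.sq_scale real_sqrt_mult)

lemma scaleR_fun_apply: "(c *\<^sub>R f) x = c *\<^sub>R f x"
  by (simp add: scaleR_fun_def)

lemma L2_functional_eq: "L2_functional L f v = L2_ip L f v"
  by (simp add: L2_functional_def L2_ip_def)

lemma L2_norm_le_H1_norm: "v \<in> H1 L \<Longrightarrow> L2_norm L v \<le> H1_norm L v"
  by (simp add: L2_norm_eq H1_norm_eq L2_le_H1)

locale loaded_string =
  fixes a L :: real and n :: nat and \<beta> x :: "nat \<Rightarrow> real"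
  assumes a: "a > 0" and L: "L > 0"
    and \<beta>: "\<And>k. k \<in> {1..n} \<Longrightarrow> \<beta> k > 0"
    and x: "\<And>k. k \<in> {1..n} \<Longrightarrow> x k \<in> {0<..<L}"
begin

abbreviation E :: "(real \<Rightarrow> real) \<Rightarrow> (real \<Rightarrow> real) \<Rightarrow> real" where
  "E \<equiv> B_form a L n \<beta> x"

lemma E_eq: "E u v = a\<^sup>2 * dirichlet L u v + (\<Sum>k=1..n. L * \<beta> k * cont_rep L u (x k) * cont_rep L v (x k))"
  by (simp add: B_form_def dirichlet_def L2_ip_def mult.assoc)

lemma cont_rep_add: "u \<in> H10 L \<Longrightarrow> v \<in> H10 L \<Longrightarrow> k \<in> {1..n} \<Longrightarrow> cont_rep L (u + v) (x k) = cont_rep L u (x k) + cont_rep L v (x k)"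
  and cont_rep_scale: "u \<in> H10 L \<Longrightarrow> k \<in> {1..n} \<Longrightarrow> cont_rep L (c *\<^sub>R u) (x k) = c * cont_rep L u (x k)"
  using cont_rep_linear[OF L] x by blast+

text \<open>\<open>K\<close> and \<open>\<kappa>\<close> are the constants in the equivalence of the energy with the squared \<open>H\<^sup>1\<close>-norm on
  \<open>H\<^sub>0\<^sup>1\<close>.\<close>

definition K :: real where "K = a\<^sup>2 + (\<Sum>k=1..n. L * \<beta> k * L)"

lemma K_pos: "K > 0"
  unfolding K_def using a L \<beta> by (intro add_pos_nonneg sum_nonneg) (auto simp: less_imp_le)

text \<open>The point loads contribute a nonnegative amount.\<close>

lemma E_lower: "a\<^sup>2 * dirichlet L u u \<le> E u u"
  unfolding E_eq using L \<beta> by (auto intro!: sum_nonneg simp: mult.assoc less_imp_le)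

text \<open>The point loads are controlled by the bound of point values in terms of the Dirichlet integral.\<close>

lemma E_upper:
  assumes u: "u \<in> H10 L"
  shows "E u u \<le> K * dirichlet L u u"
proof -
  have "(\<Sum>k=1..n. L * \<beta> k * cont_rep L u (x k) * cont_rep L u (x k)) \<le> (\<Sum>k=1..n. L * \<beta> k * (L * dirichlet L u u))"
  proof (rule sum_mono)
    fix k assume k: "k \<in> {1..n}"
    have "L * \<beta> k * (cont_rep L u (x k))\<^sup>2 \<le> L * \<beta> k * (L * dirichlet L u u)"
      using cont_rep_bound[OF L u x[OF k]] L \<beta>[OF k] by (intro mult_left_mono) auto
    then show "L * \<beta> k * cont_rep L u (x k) * cont_rep L u (x k) \<le> L * \<beta> k * (L * dirichlet L u u)"
      by (simp add: power2_eq_square mult.assoc)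
  qed
  then show ?thesis unfolding E_eq K_def by (simp add: distrib_right sum_distrib_right mult.assoc)
qed

lemma E_semi_inner: "semi_inner (H10 L) E"
proof
  show "subspace (H10 L)" by (rule subspace_H10[OF L])
  fix u v w and c :: real assume u: "u \<in> H10 L"
  show "0 \<le> E u u" using E_lower[of u] D.nonneg[OF H10_H1[OF u]] a by (meson mult_nonneg_nonneg order_trans zero_le_power2)
  assume v: "v \<in> H10 L"
  show "E u v = E v u" unfolding E_eq using D.commute[OF H10_H1[OF u] H10_H1[OF v]] by (simp add: mult.assoc mult.commute[of "cont_rep L u _"])
  have "(\<Sum>k=1..n. L * \<beta> k * cont_rep L (c *\<^sub>R u) (x k) * cont_rep L v (x k)) =
    (\<Sum>k=1..n. c * (L * \<beta> k * cont_rep L u (x k) * cont_rep L v (x k)))"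
    using u by (intro sum.cong) (auto simp: cont_rep_scale)
  then show "E (c *\<^sub>R u) v = c * E u v" unfolding E_eq
    using D.scale_left[OF H10_H1[OF u] H10_H1[OF v]] by (simp add: distrib_left sum_distrib_left)
  assume w: "w \<in> H10 L"
  have "(\<Sum>k=1..n. L * \<beta> k * cont_rep L (u + v) (x k) * cont_rep L w (x k)) =
    (\<Sum>k=1..n. L * \<beta> k * cont_rep L u (x k) * cont_rep L w (x k) + L * \<beta> k * cont_rep L v (x k) * cont_rep L w (x k))"
    using u v by (intro sum.cong) (auto simp: cont_rep_add algebra_simps)
  then show "E (u + v) w = E u w + E v w" unfolding E_eq
    using D.add_left[OF H10_H1[OF u] H10_H1[OF v] H10_H1[OF w]] by (simp add: distrib_left sum.distrib)
qed

definition \<kappa> :: real where "\<kappa> = (1 + L\<^sup>2) / a\<^sup>2"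

lemma \<kappa>_nonneg: "0 \<le> \<kappa>" by (simp add: \<kappa>_def)

lemma H1_le_E:
  assumes u: "u \<in> H10 L"
  shows "H1_ip L u u \<le> \<kappa> * E u u"
proof -
  have "H1_ip L u u \<le> (1 + L\<^sup>2) * dirichlet L u u"
    using poincare[OF L u] by (simp add: H1_ip_def distrib_right)
  also have "\<dots> = \<kappa> * (a\<^sup>2 * dirichlet L u u)" using a by (simp add: \<kappa>_def)
  also have "\<dots> \<le> \<kappa> * E u u" by (intro mult_left_mono E_lower \<kappa>_nonneg)
  finally show ?thesis .
qed

lemma E_le_H1:
  assumes u: "u \<in> H10 L"
  shows "E u u \<le> K * H1_ip L u u"
  using E_upper[OF u] mult_left_mono[OF dirichlet_le_H1[OF H10_H1[OF u]], of K] K_pos by linarith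

sublocale EF: semi_hilbert "H10 L" E
proof (intro semi_hilbert.intro semi_hilbert_axioms.intro E_semi_inner)
  interpret semi_inner "H10 L" E by (rule E_semi_inner)
  fix s :: "nat \<Rightarrow> real \<Rightarrow> real"
  assume s: "\<And>i. s i \<in> H10 L" and cauchy: "\<And>\<epsilon>. \<epsilon> > 0 \<Longrightarrow> \<exists>N. \<forall>i\<ge>N. \<forall>j\<ge>N. E (s i - s j) (s i - s j) < \<epsilon>"
  have d: "s i - s j \<in> H10 L" for i j using s by auto
  have "\<exists>p\<in>H10 L. (\<lambda>i. H1.sq L (s i - p)) \<longlonglongrightarrow> 0"
  proof (rule H10_complete[OF L s])
    fix \<epsilon> :: real assume \<epsilon>: "\<epsilon> > 0"
    obtain N where N: "\<And>i j. i \<ge> N \<Longrightarrow> j \<ge> N \<Longrightarrow> E (s i - s j) (s i - s j) < \<epsilon> / (\<kappa> + 1)"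
      using cauchy[of "\<epsilon> / (\<kappa> + 1)"] \<epsilon> \<kappa>_nonneg by auto
    have "H1.sq L (s i - s j) < \<epsilon>" if "i \<ge> N" "j \<ge> N" for i j
    proof -
      have "H1.sq L (s i - s j) \<le> (\<kappa> + 1) * E (s i - s j) (s i - s j)"
        using H1_le_E[OF d, of i j] nonneg[OF d, of i j] by (simp add: distrib_right)
      also have "\<dots> < (\<kappa> + 1) * (\<epsilon> / (\<kappa> + 1))" using N[OF that] \<kappa>_nonneg by (intro mult_strict_left_mono) auto
      finally show ?thesis using \<kappa>_nonneg by simp
    qed
    then show "\<exists>N. \<forall>i\<ge>N. \<forall>j\<ge>N. H1.sq L (s i - s j) < \<epsilon>" by blast
  qed
  then obtain p where p: "p \<in> H10 L" "(\<lambda>i. H1.sq L (s i - p)) \<longlonglongrightarrow> 0" by blast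
  have dp: "s i - p \<in> H10 L" for i using s p by auto
  have "(\<lambda>i. E (s i - p) (s i - p)) \<longlonglongrightarrow> 0"
    by (rule tendsto_sandwich[OF _ _ tendsto_const tendsto_mult_right_zero[OF p(2), of K]])
       (use nonneg[OF dp] E_le_H1[OF dp] in auto)
  then show "\<exists>p\<in>H10 L. (\<lambda>i. E (s i - p) (s i - p)) \<longlonglongrightarrow> 0" using p(1) by blast
qed

sublocale compact_pair "L2 L" "L2_ip L" "H10 L" E "L\<^sup>2 / a\<^sup>2"
proof unfold_locales
  show "H10 L \<subseteq> L2 L" using H1D(1)[OF H10_H1] by blast
  show "0 \<le> L\<^sup>2 / a\<^sup>2" by simp
  show "L2_ip L u u \<le> L\<^sup>2 / a\<^sup>2 * E u u" if u: "u \<in> H10 L" for u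
  proof -
    have "L2_ip L u u \<le> L\<^sup>2 / a\<^sup>2 * (a\<^sup>2 * dirichlet L u u)" using poincare[OF L u] a by simp
    also have "\<dots> \<le> L\<^sup>2 / a\<^sup>2 * E u u" by (intro mult_left_mono E_lower) simp
    finally show ?thesis .
  qed
  show "E u u = 0" if u: "u \<in> H10 L" and z: "L2_ip L u u = 0" for u
    using E_upper[OF u] EF.nonneg[OF u] dirichlet_null[OF H10_H1[OF u] z] by simp
  fix s :: "nat \<Rightarrow> real \<Rightarrow> real" and M
  assume s: "\<And>i. s i \<in> H10 L" and M: "\<And>i. E (s i) (s i) \<le> M"
  show "\<exists>r::nat \<Rightarrow> nat. strict_mono r \<and>
    (\<forall>\<epsilon>>0. \<exists>N. \<forall>i\<ge>N. \<forall>j\<ge>N. L2.sq L (s (r i) - s (r j)) < \<epsilon>)"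
  proof (rule H10_compact[OF L s])
    show "dirichlet L (s i) (s i) \<le> M / a\<^sup>2" for i
      using order_trans[OF E_lower M[of i]] a by (simp add: field_simps)
  qed
qed

section \<open>The dual space\<close>

lemma sqrt_E_le_H1_norm: "u \<in> H10 L \<Longrightarrow> sqrt (E u u) \<le> sqrt K * H1_norm L u"
  using E_le_H1[of u] by (simp add: H1_norm_eq H10_H1 real_sqrt_mult[symmetric])

lemma H1_norm_le_E: "u \<in> H10 L \<Longrightarrow> H1_norm L u \<le> sqrt \<kappa> * sqrt (E u u)"
  using H1_le_E[of u] by (simp add: H1_norm_eq H10_H1 real_sqrt_mult[symmetric])

sublocale H10n: seminormed "H10 L" "H1_norm L"
proof
  show "subspace (H10 L)" by (rule subspace_H10[OF L])
  show "H1_norm L (u + v) \<le> H1_norm L u + H1_norm L v" if "u \<in> H10 L" "v \<in> H10 L" for u v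
    using that H1.triangle[OF H10_H1 H10_H1] by (simp add: H1_norm_eq H10_H1)
  show "H1_norm L (c *\<^sub>R u) = \<bar>c\<bar> * H1_norm L u" if "u \<in> H10 L" for c u
    using that H1.sq_scale[OF H10_H1] by (simp add: H1_norm_eq H10_H1 real_sqrt_mult)
qed

lemma H_minus1D:
  assumes "F \<in> H_minus1 L"
  shows "u \<in> H10 L \<Longrightarrow> v \<in> H10 L \<Longrightarrow> F (u + v) = F u + F v" "u \<in> H10 L \<Longrightarrow> F (c *\<^sub>R u) = c * F u"
    "\<exists>C\<ge>0. \<forall>v\<in>H10 L. \<bar>F v\<bar> \<le> C * H1_norm L v"
proof -
  obtain C where C: "\<And>v. v \<in> H10 L \<Longrightarrow> \<bar>F v\<bar> \<le> C * H1_norm L v"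
    using assms unfolding H_minus1_def by blast
  have "\<bar>F v\<bar> \<le> \<bar>C\<bar> * H1_norm L v" if "v \<in> H10 L" for v
    using order_trans[OF C[OF that] mult_right_mono[OF abs_ge_self H10n.N_nonneg[OF that]]] .
  then show "\<exists>C\<ge>0. \<forall>v\<in>H10 L. \<bar>F v\<bar> \<le> C * H1_norm L v" by (intro exI[of _ "\<bar>C\<bar>"]) auto
qed (use assms in \<open>auto simp: H_minus1_def\<close>)

lemma H_minus1_norm_le:
  assumes "0 \<le> C" "\<And>v. v \<in> H10 L \<Longrightarrow> \<bar>F v\<bar> \<le> C * H1_norm L v"
  shows "H_minus1_norm L F \<le> C"
  unfolding H_minus1_norm_def
proof (rule cSUP_least)
  show "{v \<in> H10 L. H1_norm L v \<le> 1} \<noteq> {}" using H10n.closed(1) H10n.N_zero by force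
  fix v assume "v \<in> {v \<in> H10 L. H1_norm L v \<le> 1}"
  then show "\<bar>F v\<bar> \<le> C" using assms(2)[of v] mult_left_mono[of "H1_norm L v" 1 C] assms(1) by auto
qed

lemma H_minus1_norm_upper:
  assumes F: "F \<in> H_minus1 L" and v: "v \<in> H10 L" "H1_norm L v \<le> 1"
  shows "\<bar>F v\<bar> \<le> H_minus1_norm L F"
  unfolding H_minus1_norm_def
proof (rule cSUP_upper)
  obtain C where C: "C \<ge> 0" "\<And>v. v \<in> H10 L \<Longrightarrow> \<bar>F v\<bar> \<le> C * H1_norm L v" using H_minus1D(3)[OF F] by blast
  show "bdd_above ((\<lambda>v. \<bar>F v\<bar>) ` {v \<in> H10 L. H1_norm L v \<le> 1})"
  proof (rule bdd_aboveI2)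
    fix v assume "v \<in> {v \<in> H10 L. H1_norm L v \<le> 1}"
    then show "\<bar>F v\<bar> \<le> C" using C(2)[of v] mult_left_mono[of "H1_norm L v" 1 C] C(1) by auto
  qed
qed (use v in simp)

lemma H_minus1_norm_bound:
  assumes F: "F \<in> H_minus1 L" and v: "v \<in> H10 L"
  shows "\<bar>F v\<bar> \<le> H_minus1_norm L F * H1_norm L v"
proof (cases "H1_norm L v = 0")
  case True
  then show ?thesis using H_minus1D(3)[OF F] v by auto
next
  case False
  then have pos: "H1_norm L v > 0" using H10n.N_nonneg[OF v] by simp
  define w where "w = (1 / H1_norm L v) *\<^sub>R v"
  have "w \<in> H10 L" "H1_norm L w \<le> 1" using v pos by (simp_all add: w_def H10n.scale)
  then have "\<bar>F w\<bar> \<le> H_minus1_norm L F" by (rule H_minus1_norm_upper[OF F])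
  moreover have "\<bar>F w\<bar> = \<bar>F v\<bar> / H1_norm L v"
    unfolding w_def H_minus1D(2)[OF F v] using pos by (simp add: abs_mult)
  ultimately show ?thesis using pos by (simp add: field_simps)
qed

lemma H_minus1_norm_nonneg: "F \<in> H_minus1 L \<Longrightarrow> 0 \<le> H_minus1_norm L F"
proof -
  assume F: "F \<in> H_minus1 L"
  have "H1_norm L 0 \<le> 1" unfolding H10n.N_zero by simp
  from H_minus1_norm_upper[OF F H10n.closed(1) this] show ?thesis by linarith
qed

lemma H_minus1I:
  assumes "\<And>u v. u \<in> H10 L \<Longrightarrow> v \<in> H10 L \<Longrightarrow> F (u + v) = F u + F v"
    "\<And>c u. u \<in> H10 L \<Longrightarrow> F (c *\<^sub>R u) = c * F u" "\<And>v. v \<in> H10 L \<Longrightarrow> \<bar>F v\<bar> \<le> C * H1_norm L v"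
  shows "F \<in> H_minus1 L"
  using assms unfolding H_minus1_def by blast

lemma H_minus1_add:
  assumes F: "F \<in> H_minus1 L" and G: "G \<in> H_minus1 L"
  shows "F + G \<in> H_minus1 L" "H_minus1_norm L (F + G) \<le> H_minus1_norm L F + H_minus1_norm L G"
proof -
  have b: "\<bar>(F + G) v\<bar> \<le> (H_minus1_norm L F + H_minus1_norm L G) * H1_norm L v" if "v \<in> H10 L" for v
    using H_minus1_norm_bound[OF F that] H_minus1_norm_bound[OF G that] by (simp add: distrib_right)
  show "F + G \<in> H_minus1 L"
    by (rule H_minus1I[OF _ _ b]) (use H_minus1D[OF F] H_minus1D[OF G] in \<open>auto simp: distrib_left\<close>)
  show "H_minus1_norm L (F + G) \<le> H_minus1_norm L F + H_minus1_norm L G"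
    by (rule H_minus1_norm_le[OF _ b]) (use H_minus1_norm_nonneg F G in auto)
qed

lemma H_minus1_scale:
  assumes F: "F \<in> H_minus1 L"
  shows "c *\<^sub>R F \<in> H_minus1 L" "H_minus1_norm L (c *\<^sub>R F) \<le> \<bar>c\<bar> * H_minus1_norm L F"
proof -
  have b: "\<bar>(c *\<^sub>R F) v\<bar> \<le> (\<bar>c\<bar> * H_minus1_norm L F) * H1_norm L v" if "v \<in> H10 L" for v
    using mult_left_mono[OF H_minus1_norm_bound[OF F that] abs_ge_zero[of c]]
    by (simp add: scaleR_fun_def abs_mult mult.assoc)
  show "c *\<^sub>R F \<in> H_minus1 L"
    by (rule H_minus1I[OF _ _ b]) (use H_minus1D[OF F] in \<open>auto simp: scaleR_fun_def distrib_left\<close>)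
  show "H_minus1_norm L (c *\<^sub>R F) \<le> \<bar>c\<bar> * H_minus1_norm L F"
    by (rule H_minus1_norm_le[OF _ b]) (use H_minus1_norm_nonneg F in auto)
qed

sublocale Hm: seminormed "H_minus1 L" "H_minus1_norm L"
proof
  have "0 \<in> H_minus1 L" by (rule H_minus1I[of _ 0]) auto
  then show "subspace (H_minus1 L)" using H_minus1_add(1) H_minus1_scale(1) by (simp add: subspace_def)
  show "H_minus1_norm L (c *\<^sub>R F) = \<bar>c\<bar> * H_minus1_norm L F" if F: "F \<in> H_minus1 L" for c F
  proof (cases "c = 0")
    case True
    then show ?thesis using H_minus1_scale[OF F, of 0] H_minus1_norm_nonneg[of "0 *\<^sub>R F"] by simp
  next
    case False
    have "H_minus1_norm L F \<le> \<bar>1 / c\<bar> * H_minus1_norm L (c *\<^sub>R F)"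
      using H_minus1_scale(2)[OF H_minus1_scale(1)[OF F, of c], of "1 / c"] False by simp
    then have "\<bar>c\<bar> * H_minus1_norm L F \<le> H_minus1_norm L (c *\<^sub>R F)" using False by (simp add: field_simps)
    then show ?thesis using H_minus1_scale(2)[OF F, of c] by simp
  qed
qed (rule H_minus1_add(2))

lemma H_minus1_norm_eq_0:
  assumes "F \<in> H_minus1 L" "\<And>v. v \<in> H10 L \<Longrightarrow> F v = 0"
  shows "H_minus1_norm L F = 0"
  using H_minus1_norm_le[of 0 F] H_minus1_norm_nonneg[OF assms(1)] assms(2) by simp

lemma L2_functional_bound:
  assumes "f \<in> L2 L" "v \<in> H10 L"
  shows "\<bar>L2_ip L f v\<bar> \<le> L2_norm L f * H1_norm L v"
proof -
  have "\<bar>L2_ip L f v\<bar> \<le> L2_norm L f * L2_norm L v"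
    using L2.abs_ip_le[OF assms(1) VW[OF assms(2)]] by (simp add: L2_norm_eq)
  also have "\<dots> \<le> L2_norm L f * H1_norm L v"
    using L2_norm_le_H1_norm[OF H10_H1[OF assms(2)]] L2n.N_nonneg[OF assms(1)] by (rule mult_left_mono)
  finally show ?thesis .
qed

lemma L2_functional_H_minus1: "f \<in> L2 L \<Longrightarrow> L2_functional L f \<in> H_minus1 L"
proof (rule H_minus1I[where C = "L2_norm L f"])
  assume f: "f \<in> L2 L"
  show "\<bar>L2_functional L f v\<bar> \<le> L2_norm L f * H1_norm L v" if "v \<in> H10 L" for v
    using L2_functional_bound[OF f that] by (simp add: L2_functional_eq)
qed (auto simp: L2_functional_eq L2.bilinear)

lemma L2_functional_diff_norm:
  assumes f: "f \<in> L2 L" and g: "g \<in> L2 L"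
  shows "H_minus1_norm L (L2_functional L f - L2_functional L g) \<le> L2_norm L (f - g)"
proof (rule H_minus1_norm_le)
  have fg: "f - g \<in> L2 L" using f g by auto
  show "0 \<le> L2_norm L (f - g)" by (rule L2n.N_nonneg[OF fg])
  show "\<bar>(L2_functional L f - L2_functional L g) v\<bar> \<le> L2_norm L (f - g) * H1_norm L v" if v: "v \<in> H10 L" for v
    using L2_functional_bound[OF fg v] L2.diff_left[OF f g VW[OF v]] by (simp add: L2_functional_eq)
qed

text \<open>Outside \<open>H\<^sub>0\<^sup>1\<close> the integral and the form are not linear, so the two embeddings into
  \<open>H\<^sup>-\<^sup>1\<close> are cut off there to become linear maps.\<close>

definition L2_embed :: "(real \<Rightarrow> real) \<Rightarrow> (real \<Rightarrow> real) \<Rightarrow> real" where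
  "L2_embed f v = (if v \<in> H10 L then L2_ip L f v else 0)"

definition E_embed :: "(real \<Rightarrow> real) \<Rightarrow> (real \<Rightarrow> real) \<Rightarrow> real" where
  "E_embed w v = (if v \<in> H10 L then - E w v else 0)"

lemma L2_embed_H_minus1:
  assumes "f \<in> L2 L"
  shows "L2_embed f \<in> H_minus1 L" "H_minus1_norm L (L2_embed f) \<le> 1 * L2_norm L f"
proof -
  have b: "\<bar>L2_embed f v\<bar> \<le> 1 * L2_norm L f * H1_norm L v" if "v \<in> H10 L" for v
    using L2_functional_bound[OF assms that] that by (simp add: L2_embed_def)
  show "L2_embed f \<in> H_minus1 L"
    by (rule H_minus1I[OF _ _ b]) (use assms in \<open>auto simp: L2_embed_def L2.bilinear\<close>)
  show "H_minus1_norm L (L2_embed f) \<le> 1 * L2_norm L f"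
    by (rule H_minus1_norm_le[OF _ b]) (use L2n.N_nonneg[OF assms] in auto)
qed

lemma L2_embed_linear:
  "f \<in> L2 L \<Longrightarrow> g \<in> L2 L \<Longrightarrow> L2_embed (f + g) = L2_embed f + L2_embed g"
  "f \<in> L2 L \<Longrightarrow> L2_embed (c *\<^sub>R f) = c *\<^sub>R L2_embed f"
  by (auto simp: L2_embed_def fun_eq_iff L2.bilinear scaleR_fun_apply)

lemma E_embed_H_minus1:
  assumes w: "w \<in> H10 L"
  shows "E_embed w \<in> H_minus1 L" "H_minus1_norm L (E_embed w) \<le> K * H1_norm L w"
proof -
  have b: "\<bar>E_embed w v\<bar> \<le> K * H1_norm L w * H1_norm L v" if v: "v \<in> H10 L" for v
  proof -
    have "\<bar>E_embed w v\<bar> \<le> sqrt (E w w) * sqrt (E v v)" using EF.abs_ip_le[OF w v] v by (simp add: E_embed_def)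
    also have "\<dots> \<le> (sqrt K * H1_norm L w) * (sqrt K * H1_norm L v)"
      using sqrt_E_le_H1_norm[OF w] sqrt_E_le_H1_norm[OF v] EF.nonneg[OF v] H10n.N_nonneg[OF w] K_pos
      by (intro mult_mono) auto
    also have "\<dots> = K * H1_norm L w * H1_norm L v"
      using K_pos by (metis (no_types, opaque_lifting) less_imp_le mult.assoc mult.left_commute real_sqrt_mult_self abs_of_nonneg)
    finally show ?thesis .
  qed
  show "E_embed w \<in> H_minus1 L"
    by (rule H_minus1I[OF _ _ b]) (use w in \<open>auto simp: E_embed_def EF.bilinear\<close>)
  show "H_minus1_norm L (E_embed w) \<le> K * H1_norm L w"
    by (rule H_minus1_norm_le[OF _ b]) (use H10n.N_nonneg[OF w] K_pos in auto)
qed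

lemma E_embed_linear:
  "u \<in> H10 L \<Longrightarrow> v \<in> H10 L \<Longrightarrow> E_embed (u + v) = E_embed u + E_embed v"
  "u \<in> H10 L \<Longrightarrow> E_embed (c *\<^sub>R u) = c *\<^sub>R E_embed u"
  by (auto simp: E_embed_def fun_eq_iff EF.bilinear scaleR_fun_apply)

text \<open>Such an \<open>f\<close> is orthogonal to \<open>H\<^sub>0\<^sup>1\<close>, in which the span of the eigenvectors is dense, hence to all
  test functions; the fundamental lemma concludes.\<close>

lemma L2_null_if_orthogonal:
  assumes f: "f \<in> L2 L" and orth0: "\<And>k. L2_ip L f (eig k) = 0"
  shows "L2_ip L f f = 0"
proof -
  have "L2_ip L f v = 0" if v: "v \<in> H10 L" for v
    using eig_determines[OF f EF.closed(1) _ v] orth0 v by simp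
  then have "AE x in interval_measure L. f x = 0"
    using test_function_H10[OF L] by (intro fundamental_lemma[OF L2_integrable[OF f]]) (auto simp: L2_ip_def)
  then show ?thesis using L2_ip_self_eq_0_iff[OF f] by simp
qed

end

section \<open>The eigenfunction series\<close>

locale loaded_string_data = loaded_string +
  fixes T :: real and \<phi> \<psi> :: "real \<Rightarrow> real"
  assumes T: "T > 0" and \<phi>: "\<phi> \<in> H10 L" and \<psi>: "\<psi> \<in> L2 L"
begin

definition \<omega> :: "nat \<Rightarrow> real" where "\<omega> k = sqrt (ev k)"

text \<open>The solution of \<open>y'' = - ev k * y\<close> whose value and derivative at 0 are the coefficients of \<open>\<phi>\<close>
  and \<open>\<psi>\<close>; \<open>z\<close> is its derivative.\<close>

definition y :: "nat \<Rightarrow> real \<Rightarrow> real" where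
  "y k t = L2_ip L \<phi> (eig k) * cos (\<omega> k * t) + L2_ip L \<psi> (eig k) / \<omega> k * sin (\<omega> k * t)"

definition z :: "nat \<Rightarrow> real \<Rightarrow> real" where
  "z k t = L2_ip L \<psi> (eig k) * cos (\<omega> k * t) - L2_ip L \<phi> (eig k) * \<omega> k * sin (\<omega> k * t)"

definition mode_energy :: "nat \<Rightarrow> real" where
  "mode_energy k = ev k * (L2_ip L \<phi> (eig k))\<^sup>2 + (L2_ip L \<psi> (eig k))\<^sup>2"

abbreviation tail :: "nat \<Rightarrow> real" where "tail m \<equiv> (\<Sum>k. mode_energy (k + m))"

lemma \<omega>_pos: "\<omega> k > 0" by (simp add: \<omega>_def ev_pos)

lemma \<omega>_sq: "\<omega> k * \<omega> k = ev k" "(\<omega> k)\<^sup>2 = ev k" using ev_pos[of k] by (simp_all add: \<omega>_def)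

lemma y_deriv: "(y k has_real_derivative z k t) (at t within A)"
  unfolding y_def[abs_def] z_def using \<omega>_pos[of k]
  by (auto intro!: derivative_eq_intros)

lemma z_deriv: "(z k has_real_derivative - ev k * y k t) (at t within A)"
  unfolding z_def[abs_def] y_def \<omega>_sq(1)[symmetric] using \<omega>_pos[of k]
  by (auto intro!: derivative_eq_intros simp: algebra_simps)

lemma y_isCont: "isCont (y k) t" using DERIV_isCont[OF y_deriv] .

lemma z_isCont: "isCont (z k) t" using DERIV_isCont[OF z_deriv] .

lemma summable_mode_energy: "summable mode_energy"
  unfolding mode_energy_def[abs_def] by (intro summable_add bessel_B \<phi> bessel_H \<psi>)

lemma tail_0: "tail \<longlonglongrightarrow> 0" by (rule tail_tendsto_0[OF summable_mode_energy])

text \<open>A point of the plane does not leave its circle under rotation. In the coordinates \<open>\<omega> y\<close> and \<open>y'\<close>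
  this is conservation of energy, from which \<open>z_bound\<close> and \<open>\<omega>y_bound\<close> follow.\<close>

lemma rotation_bound:
  fixes p q s :: real
  shows "(p * cos s + q * sin s)\<^sup>2 \<le> p\<^sup>2 + q\<^sup>2"
proof -
  have "p\<^sup>2 + q\<^sup>2 = (p\<^sup>2 + q\<^sup>2) * ((sin s)\<^sup>2 + (cos s)\<^sup>2)" by simp
  also have "\<dots> = (p * cos s + q * sin s)\<^sup>2 + (p * sin s - q * cos s)\<^sup>2"
    by (simp only: power2_eq_square algebra_simps)
  finally show ?thesis by simp
qed

lemma z_bound: "(z k t)\<^sup>2 \<le> mode_energy k"
  using rotation_bound[of "L2_ip L \<psi> (eig k)" "\<omega> k * t" "- (L2_ip L \<phi> (eig k) * \<omega> k)"]
  unfolding z_def mode_energy_def by (simp add: power_mult_distrib \<omega>_sq mult.commute)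

lemma \<omega>y_bound: "(\<omega> k * y k t)\<^sup>2 \<le> mode_energy k"
proof -
  have "\<omega> k * y k t = L2_ip L \<phi> (eig k) * \<omega> k * cos (\<omega> k * t) + L2_ip L \<psi> (eig k) * sin (\<omega> k * t)"
    using \<omega>_pos[of k] by (simp add: y_def distrib_left)
  then show ?thesis
    using rotation_bound[of "L2_ip L \<phi> (eig k) * \<omega> k" "\<omega> k * t" "L2_ip L \<psi> (eig k)"]
    unfolding mode_energy_def by (simp add: power_mult_distrib \<omega>_sq mult.commute)
qed

lemma y_bound: "ev k * (y k t)\<^sup>2 \<le> mode_energy k"
  using \<omega>y_bound[of k t] by (simp add: power_mult_distrib \<omega>_sq)

lemma mode_energy_nonneg: "0 \<le> mode_energy k"
  using z_bound[of k 0] by (meson order_trans zero_le_power2)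

text \<open>The factors 1 are the weight and the constant that \<open>series_integral\<close> takes in this case.\<close>

lemma L2_series:
  assumes "\<And>k. 1 * (c k)\<^sup>2 \<le> M k" and M: "summable M"
  shows "\<exists>p\<in>L2 L. (\<forall>k. L2_ip L p (eig k) = c k * L2.sq L (eig k)) \<and>
    (\<forall>m. L2_norm L (p - (\<Sum>k<m. c k *\<^sub>R eig k)) \<le> 1 * sqrt (\<Sum>k. M (k + m)))"
proof -
  obtain p where p: "p \<in> L2 L" and le: "\<And>m. L2.sq L (p - (\<Sum>k<m. c k *\<^sub>R eig k)) \<le> (\<Sum>k. M (k + m))"
    using H_series[of c M] assms by auto
  have "(\<lambda>m. L2.sq L (p - (\<Sum>k<m. c k *\<^sub>R eig k))) \<longlonglongrightarrow> 0"
    by (rule tendsto_sandwich[OF _ _ tendsto_const tail_tendsto_0[OF M]])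
       (use p le in \<open>auto intro!: always_eventually L2.nonneg\<close>)
  then show ?thesis using p le H_series_coeff[OF p] by (auto simp: L2_norm_eq)
qed

lemma H10_series:
  assumes "\<And>k. ev k * (c k)\<^sup>2 \<le> M k" and M: "summable M"
  shows "\<exists>p\<in>H10 L. (\<forall>k. L2_ip L p (eig k) = c k * L2.sq L (eig k)) \<and>
    (\<forall>m. H1_norm L (p - (\<Sum>k<m. c k *\<^sub>R eig k)) \<le> sqrt \<kappa> * sqrt (\<Sum>k. M (k + m)))"
proof -
  obtain p where p: "p \<in> H10 L" and le: "\<And>m. EF.sq (p - (\<Sum>k<m. c k *\<^sub>R eig k)) \<le> (\<Sum>k. M (k + m))"
    using B_series[of c M] assms by auto
  have d: "p - (\<Sum>k<m. c k *\<^sub>R eig k) \<in> H10 L" for m using p by auto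
  have "(\<lambda>m. EF.sq (p - (\<Sum>k<m. c k *\<^sub>R eig k))) \<longlonglongrightarrow> 0"
    by (rule tendsto_sandwich[OF _ _ tendsto_const tail_tendsto_0[OF M]])
       (use d le in \<open>auto intro!: always_eventually EF.nonneg\<close>)
  then have "L2_ip L p (eig k) = c k * L2.sq L (eig k)" for k
    by (intro H_series_coeff[OF VW[OF p] H_tendsto_0[OF d]])
  moreover have "H1_norm L (p - (\<Sum>k<m. c k *\<^sub>R eig k)) \<le> sqrt \<kappa> * sqrt (\<Sum>k. M (k + m))" for m
    using H1_norm_le_E[OF d] mult_left_mono[OF real_sqrt_le_mono[OF le[of m]], of "sqrt \<kappa>"] \<kappa>_nonneg
    by (meson order_trans real_sqrt_ge_zero)
  ultimately show ?thesis using p by blast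
qed

abbreviation ysum :: "nat \<Rightarrow> real \<Rightarrow> real \<Rightarrow> real" where "ysum m t \<equiv> (\<Sum>k<m. y k t *\<^sub>R eig k)"

abbreviation zsum :: "nat \<Rightarrow> real \<Rightarrow> real \<Rightarrow> real" where "zsum m t \<equiv> (\<Sum>k<m. z k t *\<^sub>R eig k)"

text \<open>The sums of the two series, chosen together with their coefficients and an error bound for the partial
  sums that is independent of time.\<close>

definition u :: "real \<Rightarrow> real \<Rightarrow> real" where
  "u t = (SOME p. p \<in> H10 L \<and> (\<forall>k. L2_ip L p (eig k) = y k t * L2.sq L (eig k)) \<and>
    (\<forall>m. H1_norm L (p - ysum m t) \<le> sqrt \<kappa> * sqrt (tail m)))"

definition u1 :: "real \<Rightarrow> real \<Rightarrow> real" where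
  "u1 t = (SOME p. p \<in> L2 L \<and> (\<forall>k. L2_ip L p (eig k) = z k t * L2.sq L (eig k)) \<and>
    (\<forall>m. L2_norm L (p - zsum m t) \<le> 1 * sqrt (tail m)))"

definition u2 :: "real \<Rightarrow> (real \<Rightarrow> real) \<Rightarrow> real" where "u2 t = E_embed (u t)"

lemma u: "u t \<in> H10 L"
  and u_coeff: "L2_ip L (u t) (eig k) = y k t * L2.sq L (eig k)"
  and u_dist: "H1_norm L (u t - ysum m t) \<le> sqrt \<kappa> * sqrt (tail m)"
  using someI_ex[OF H10_series[of "\<lambda>k. y k t" mode_energy, OF y_bound summable_mode_energy, unfolded Bex_def], folded u_def]
  by blast+

lemma u1: "u1 t \<in> L2 L"
  and u1_coeff: "L2_ip L (u1 t) (eig k) = z k t * L2.sq L (eig k)"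
  and u1_dist: "L2_norm L (u1 t - zsum m t) \<le> 1 * sqrt (tail m)"
proof -
  have "1 * (z k t)\<^sup>2 \<le> mode_energy k" for k using z_bound by simp
  from someI_ex[OF L2_series[of "\<lambda>k. z k t" mode_energy, OF this summable_mode_energy, unfolded Bex_def], folded u1_def]
  show "u1 t \<in> L2 L" "L2_ip L (u1 t) (eig k) = z k t * L2.sq L (eig k)"
    "L2_norm L (u1 t - zsum m t) \<le> 1 * sqrt (tail m)" by blast+
qed

lemma sqrt_tail_0: "(\<lambda>m. C * sqrt (tail m)) \<longlonglongrightarrow> 0"
  using tendsto_mult_right_zero[OF tendsto_real_sqrt[OF tail_0, simplified]] by simp

section \<open>Time integrals of the series\<close>

lemma integral_bound_interval:
  fixes f :: "real \<Rightarrow> real"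
  assumes f: "continuous_on {0..T} f" and C: "\<And>t. t \<in> {0<..<T} \<Longrightarrow> \<bar>f t\<bar> \<le> C"
  shows "\<bar>LINT t|interval_measure T. f t\<bar> \<le> T * C"
proof -
  have i: "integrable (interval_measure T) f" by (rule integral_interval_continuous(1)[OF f])
  have "\<bar>LINT t|interval_measure T. f t\<bar> \<le> (LINT t|interval_measure T. \<bar>f t\<bar>)" by (rule integral_abs_bound)
  also have "\<dots> \<le> (LINT t|interval_measure T. C)"
    using i C L2_integrable[OF L2_const] by (intro integral_mono) auto
  also have "\<dots> = T * C" using T by (simp add: measure_restrict_space)
  finally show ?thesis .
qed

text \<open>Shared by \<open>u\<close> in \<open>H\<^sub>0\<^sup>1\<close>, with weights \<open>w = ev\<close>, and by \<open>u1\<close> in \<open>L\<^sup>2\<close>, with weights 1. The coefficients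
  of the integral are the integrals of the coefficients; they satisfy the energy bound up to the
  factor \<open>(T G)\<^sup>2\<close>, so the series of the integral converges as well.\<close>

lemma series_integral:
  assumes X: "seminormed X N" and e: "\<And>k. eig k \<in> X" and w: "\<And>k. 0 < w k" and C: "0 \<le> C"
    and f: "\<And>k t. isCont (f k) t" "\<And>k t. w k * (f k t)\<^sup>2 \<le> mode_energy k"
    and U: "\<And>t. U t \<in> X" "\<And>m t. N (U t - (\<Sum>k<m. f k t *\<^sub>R eig k)) \<le> C * sqrt (tail m)"
    and series: "\<And>c M. (\<And>k. w k * (c k)\<^sup>2 \<le> M k) \<Longrightarrow> summable M \<Longrightarrow>
      \<exists>p\<in>X. (\<forall>k. L2_ip L p (eig k) = c k * L2.sq L (eig k)) \<and>
        (\<forall>m. N (p - (\<Sum>k<m. c k *\<^sub>R eig k)) \<le> C * sqrt (\<Sum>k. M (k + m)))"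
    and g: "continuous_on {0..T} g" and G: "\<And>t. t \<in> {0<..<T} \<Longrightarrow> \<bar>g t\<bar> \<le> G"
  shows "\<exists>J\<in>X. (\<forall>k. L2_ip L J (eig k) = (LINT t|interval_measure T. g t * f k t) * L2.sq L (eig k)) \<and>
    seminormed.uniform_integral X N (interval_measure T) (\<lambda>t. g t *\<^sub>R U t) J"
proof -
  interpret X: seminormed X N by (rule X)
  have G0: "0 \<le> G" using G[of "T / 2"] T by force
  have cgf: "continuous_on {0..T} (\<lambda>t. g t * f k t)" for k
    by (intro continuous_on_mult g) (simp add: continuous_at_imp_continuous_on f(1))
  define c where "c k = (LINT t|interval_measure T. g t * f k t)" for k
  define b where "b k = sqrt (mode_energy k / w k)" for k
  have gf: "\<bar>g t * f k t\<bar> \<le> G * b k" if "t \<in> {0<..<T}" for k t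
  proof -
    have "(f k t)\<^sup>2 \<le> mode_energy k / w k" using f(2)[of k t] w[of k] by (simp add: field_simps)
    then have "\<bar>f k t\<bar> \<le> b k" unfolding b_def by (metis real_sqrt_abs real_sqrt_le_iff)
    then show ?thesis unfolding abs_mult using G[OF that] G0 by (intro mult_mono) auto
  qed
  define M where "M k = (T * G)\<^sup>2 * mode_energy k" for k
  have M: "summable M" unfolding M_def[abs_def] by (intro summable_mult summable_mode_energy)
  have "w k * (c k)\<^sup>2 \<le> M k" for k
  proof -
    have "\<bar>c k\<bar> \<le> T * (G * b k)" unfolding c_def by (rule integral_bound_interval[OF cgf gf])
    then have "\<bar>c k\<bar>\<^sup>2 \<le> (T * (G * b k))\<^sup>2" by (intro power_mono) auto
    then have "w k * (c k)\<^sup>2 \<le> w k * (T * (G * b k))\<^sup>2" using w[of k] by (intro mult_left_mono) auto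
    also have "\<dots> = M k" using mode_energy_nonneg[of k] w[of k] by (simp add: M_def b_def power_mult_distrib)
    finally show ?thesis .
  qed
  from series[OF this M] obtain J where J: "J \<in> X" "\<And>k. L2_ip L J (eig k) = c k * L2.sq L (eig k)"
    and JN: "\<And>m. N (J - (\<Sum>k<m. c k *\<^sub>R eig k)) \<le> C * sqrt (\<Sum>k. M (k + m))" by blast
  have "X.uniform_integral (interval_measure T) (\<lambda>t. g t *\<^sub>R U t) J"
  proof (rule X.uniform_integral_series[where x = eig and g = "\<lambda>k t. g t * f k t", OF finite_interval_measure])
    show "(\<lambda>t. g t * f k t) \<in> borel_measurable (interval_measure T)" for k
      using borel_measurable_integrable[OF integral_interval_continuous(1)[OF cgf]] .
    show "\<bar>g t * f k t\<bar> \<le> G * b k" if "t \<in> space (interval_measure T)" for k t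
      using gf that by simp
    show "N (g t *\<^sub>R U t - (\<Sum>k<m. (g t * f k t) *\<^sub>R eig k)) \<le> (G * C) * sqrt (tail m)"
      if t: "t \<in> space (interval_measure T)" for t m
    proof -
      have mem: "U t - (\<Sum>k<m. f k t *\<^sub>R eig k) \<in> X" using U(1) e by auto
      have "g t *\<^sub>R U t - (\<Sum>k<m. (g t * f k t) *\<^sub>R eig k) = g t *\<^sub>R (U t - (\<Sum>k<m. f k t *\<^sub>R eig k))"
        by (simp add: scaleR_diff_right scaleR_sum_right)
      then have "N (g t *\<^sub>R U t - (\<Sum>k<m. (g t * f k t) *\<^sub>R eig k)) = \<bar>g t\<bar> * N (U t - (\<Sum>k<m. f k t *\<^sub>R eig k))"
        using X.scale[OF mem] by simp
      also have "\<dots> \<le> G * (C * sqrt (tail m))"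
        using G[of t] t G0 U(2) X.N_nonneg[OF mem] by (intro mult_mono) auto
      finally show ?thesis by (simp add: mult.assoc)
    qed
    show "(\<lambda>m. (G * C) * sqrt (tail m)) \<longlonglongrightarrow> 0" by (rule sqrt_tail_0)
    show "(\<lambda>m. C * sqrt (\<Sum>k. M (k + m))) \<longlonglongrightarrow> 0"
      using tendsto_mult_right_zero[OF tendsto_real_sqrt[OF tail_tendsto_0[OF M], simplified]] by simp
  qed (use J JN U e in \<open>auto simp: c_def\<close>)
  then show ?thesis using J by (auto simp: c_def)
qed

lemma u_integral:
  assumes "continuous_on {0..T} g" "\<And>t. t \<in> {0<..<T} \<Longrightarrow> \<bar>g t\<bar> \<le> G"
  shows "\<exists>J\<in>H10 L. (\<forall>k. L2_ip L J (eig k) = (LINT t|interval_measure T. g t * y k t) * L2.sq L (eig k)) \<and>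
    H10n.uniform_integral (interval_measure T) (\<lambda>t. g t *\<^sub>R u t) J"
  by (rule series_integral[OF H10n.seminormed_axioms eig_V ev_pos _ y_isCont y_bound u u_dist H10_series assms])
     (simp add: \<kappa>_nonneg)

lemma u1_integral:
  assumes "continuous_on {0..T} g" "\<And>t. t \<in> {0<..<T} \<Longrightarrow> \<bar>g t\<bar> \<le> G"
  shows "\<exists>J\<in>L2 L. (\<forall>k. L2_ip L J (eig k) = (LINT t|interval_measure T. g t * z k t) * L2.sq L (eig k)) \<and>
    L2n.uniform_integral L (interval_measure T) (\<lambda>t. g t *\<^sub>R u1 t) J"
  by (rule series_integral[where w = "\<lambda>_. 1", OF L2n.seminormed_axioms VW[OF eig_V] zero_less_one zero_le_one z_isCont _ u1 u1_dist L2_series assms])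
     (simp_all add: z_bound)

section \<open>The series is a weak solution\<close>

lemma y_weak_deriv: "has_weak_deriv T (y k) (z k)"
  using T y_deriv by (rule has_weak_deriv_classical) (simp add: continuous_at_imp_continuous_on z_isCont)

lemma z_weak_deriv: "has_weak_deriv T (z k) (\<lambda>t. - ev k * y k t)"
  using T z_deriv by (rule has_weak_deriv_classical) (intro continuous_intros, simp add: continuous_at_imp_continuous_on y_isCont)

lemma u_bound: "H1_norm L (u t) \<le> sqrt \<kappa> * sqrt (tail 0)"
  using u_dist[of t 0] by simp

lemma u1_bound: "L2_norm L (u1 t) \<le> sqrt (tail 0)"
  using u1_dist[of t 0] by simp

lemma u_unit_integral: "\<exists>J. H10n.uniform_integral (interval_measure T) u J"
  using u_integral[of "\<lambda>_. 1" 1] by auto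

lemma u_time: "u \<in> L2_time T (H10 L) (H1_norm L)" "u \<in> Linf_time T (H10 L) (H1_norm L)"
proof -
  obtain J where J: "H10n.uniform_integral (interval_measure T) u J" using u_unit_integral by blast
  show "u \<in> L2_time T (H10 L) (H1_norm L)" "u \<in> Linf_time T (H10 L) (H1_norm L)"
    by (rule H10n.uniform_integral_time_spaces[OF J u_bound])+
qed

lemma u1_time: "u1 \<in> L2_time T (L2 L) (L2_norm L)"
  using u1_integral[of "\<lambda>_. 1" 1] L2n.uniform_integral_time_spaces(1)[OF _ u1_bound] by auto

lemma E_embed_integral:
  assumes "H10n.uniform_integral M f J"
  shows "Hm.uniform_integral M (\<lambda>t. E_embed (f t)) (E_embed J)"
  by (rule uniform_integral_linear_image[OF H10n.seminormed_axioms Hm.seminormed_axioms assms, where \<Lambda> = E_embed and C = K])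
     (use E_embed_linear E_embed_H_minus1 in auto)

lemma L2_embed_integral:
  assumes "L2n.uniform_integral L M f J"
  shows "Hm.uniform_integral M (\<lambda>t. L2_embed (f t)) (L2_embed J)"
  by (rule uniform_integral_linear_image[OF L2n.seminormed_axioms Hm.seminormed_axioms assms, where \<Lambda> = L2_embed and C = 1])
     (use L2_embed_linear L2_embed_H_minus1 in auto)

lemma u2_time: "u2 \<in> L2_time T (H_minus1 L) (H_minus1_norm L)"
proof -
  obtain J where J: "H10n.uniform_integral (interval_measure T) u J" using u_unit_integral by blast
  have "Hm.uniform_integral (interval_measure T) u2 (E_embed J)"
    using E_embed_integral[OF J] by (simp add: u2_def[abs_def])
  then show ?thesis
  proof (rule Hm.uniform_integral_time_spaces(1))
    show "H_minus1_norm L (u2 t) \<le> K * (sqrt \<kappa> * sqrt (tail 0))" for t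
      using order_trans[OF E_embed_H_minus1(2)[OF u] mult_left_mono[OF u_bound]] K_pos by (simp add: u2_def)
  qed
qed

lemma smooth_test_bound:
  assumes "test_function_on {0<..<T} \<theta>"
  obtains G where "\<And>t. \<bar>\<theta> t\<bar> \<le> G" "continuous_on {0..T} \<theta>"
  using test_function_bounded[OF assms] smooth_continuous_on[OF test_function_smooth[OF assms]] by metis

lemma u_integral_test:
  assumes "test_function_on {0<..<T} \<theta>"
  shows "\<exists>J\<in>H10 L. (\<forall>k. L2_ip L J (eig k) = (LINT t|interval_measure T. \<theta> t * y k t) * L2.sq L (eig k)) \<and>
    H10n.uniform_integral (interval_measure T) (\<lambda>t. \<theta> t *\<^sub>R u t) J"
proof -
  obtain G where "\<And>t. \<bar>\<theta> t\<bar> \<le> G" "continuous_on {0..T} \<theta>" 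
    using smooth_test_bound[OF assms] by blast
  then show ?thesis by (intro u_integral)
qed

lemma u1_integral_test:
  assumes "test_function_on {0<..<T} \<theta>"
  shows "\<exists>J\<in>L2 L. (\<forall>k. L2_ip L J (eig k) = (LINT t|interval_measure T. \<theta> t * z k t) * L2.sq L (eig k)) \<and>
    L2n.uniform_integral L (interval_measure T) (\<lambda>t. \<theta> t *\<^sub>R u1 t) J"
proof -
  obtain G where "\<And>t. \<bar>\<theta> t\<bar> \<le> G" "continuous_on {0..T} \<theta>" 
    using smooth_test_bound[OF assms] by blast
  then show ?thesis by (intro u1_integral)
qed

text \<open>Both integrals have the same coefficients up to sign, by scalar integration by parts.\<close>

lemma u_distr_deriv: "has_distr_deriv T (L2 L) (L2_norm L) u u1"
  unfolding has_distr_deriv_def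
proof (intro allI impI)
  fix \<theta> assume \<theta>: "test_function_on {0<..<T} \<theta>"
  have d\<theta>: "test_function_on {0<..<T} (deriv \<theta>)" by (rule test_function_deriv[OF \<theta>])
  obtain J where J: "J \<in> H10 L" "\<And>k. L2_ip L J (eig k) = (LINT t|interval_measure T. deriv \<theta> t * y k t) * L2.sq L (eig k)"
    and Ji: "H10n.uniform_integral (interval_measure T) (\<lambda>t. deriv \<theta> t *\<^sub>R u t) J"
    using u_integral_test[OF d\<theta>] by blast
  obtain J' where J': "J' \<in> L2 L" "\<And>k. L2_ip L J' (eig k) = (LINT t|interval_measure T. \<theta> t * z k t) * L2.sq L (eig k)"
    and J'i: "L2n.uniform_integral L (interval_measure T) (\<lambda>t. \<theta> t *\<^sub>R u1 t) J'"
    using u1_integral_test[OF \<theta>] by blast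
  have parts: "(LINT t|interval_measure T. deriv \<theta> t * y k t) = - (LINT t|interval_measure T. \<theta> t * z k t)" for k
    using y_weak_deriv[of k] \<theta> by (simp add: has_weak_deriv_def mult.commute)
  have JL: "J \<in> L2 L" using J(1) by auto
  have i1: "L2n.uniform_integral L (interval_measure T) (\<lambda>t. deriv \<theta> t *\<^sub>R u t) J"
    by (rule uniform_integral_linear_image[OF H10n.seminormed_axioms L2n.seminormed_axioms Ji, where \<Lambda> = "\<lambda>f. f" and C = 1])
       (use L2_norm_le_H1_norm H10_H1 in auto)
  have i2: "L2n.uniform_integral L (interval_measure T) (\<lambda>t. \<theta> t *\<^sub>R u1 t) (- J)"
  proof (rule L2n.uniform_integral_null[OF J'i])
    show mJ: "- J \<in> L2 L" using L2n.closed(4)[OF JL, of "-1"] by simp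
    have s: "J' + J \<in> L2 L" using J' JL by auto
    have "L2_ip L (J' + J) (eig k) = 0" for k
      using J'(2)[of k] J(2)[of k] parts[of k] L2.add_left[OF J'(1) JL VW[OF eig_V[of k]]] by simp
    then have "L2.sq L (J' + J) = 0" by (rule L2_null_if_orthogonal[OF s])
    then show "L2_norm L (J' - (- J)) = 0" by (simp add: L2_norm_eq)
    show "L2_norm L (\<theta> t *\<^sub>R u1 t - \<theta> t *\<^sub>R u1 t) = 0" for t using L2n.N_zero by simp
  qed (use u1 in auto)
  show "\<exists>I. has_integral_in (interval_measure T) (L2 L) (L2_norm L) (\<lambda>t. deriv \<theta> t *\<^sub>R u t) I \<and>
      has_integral_in (interval_measure T) (L2 L) (L2_norm L) (\<lambda>t. \<theta> t *\<^sub>R u1 t) (- I)"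
    using L2n.uniform_integral_has_integral_in[OF i1 finite_interval_measure]
      L2n.uniform_integral_has_integral_in[OF i2 finite_interval_measure] by blast
qed

text \<open>The two sides are the images in \<open>H\<^sup>-\<^sup>1\<close> of an integral in \<open>L\<^sup>2\<close> and of one in \<open>H\<^sub>0\<^sup>1\<close>. They agree on
  each eigenvector, because \<open>z\<close> has derivative \<open>- ev k * y\<close> and \<open>B\<close> multiplies by \<open>ev k\<close>, hence
  everywhere.\<close>

lemma u1_distr_deriv:
  "has_distr_deriv T (H_minus1 L) (H_minus1_norm L) (\<lambda>t. L2_functional L (u1 t)) u2"
  unfolding has_distr_deriv_def
proof (intro allI impI)
  fix \<theta> assume \<theta>: "test_function_on {0<..<T} \<theta>"
  have d\<theta>: "test_function_on {0<..<T} (deriv \<theta>)" by (rule test_function_deriv[OF \<theta>])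
  obtain J where J: "J \<in> H10 L" "\<And>k. L2_ip L J (eig k) = (LINT t|interval_measure T. \<theta> t * y k t) * L2.sq L (eig k)"
    and Ji: "H10n.uniform_integral (interval_measure T) (\<lambda>t. \<theta> t *\<^sub>R u t) J"
    using u_integral_test[OF \<theta>] by blast
  obtain J' where J': "J' \<in> L2 L" "\<And>k. L2_ip L J' (eig k) = (LINT t|interval_measure T. deriv \<theta> t * z k t) * L2.sq L (eig k)"
    and J'i: "L2n.uniform_integral L (interval_measure T) (\<lambda>t. deriv \<theta> t *\<^sub>R u1 t) J'"
    using u1_integral_test[OF d\<theta>] by blast
  have parts: "(LINT t|interval_measure T. deriv \<theta> t * z k t) = ev k * (LINT t|interval_measure T. \<theta> t * y k t)" for k
  proof -
    have "(LINT t|interval_measure T. deriv \<theta> t * z k t) = - (LINT t|interval_measure T. (- ev k * y k t) * \<theta> t)"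
      using z_weak_deriv[of k] \<theta> unfolding has_weak_deriv_def by (simp only: mult.commute[of "deriv \<theta> _"])
    also have "(\<lambda>t. (- ev k * y k t) * \<theta> t) = (\<lambda>t. (- ev k) * (\<theta> t * y k t))" by (simp add: mult.commute mult.left_commute)
    finally show ?thesis by simp
  qed
  have eigs: "L2_ip L J' (eig k) = E J (eig k)" for k
    using J'(2)[of k] J(2)[of k] parts[of k] EF.commute[OF J(1) eig_V[of k]] B_eig[OF J(1), of k] L2.commute[OF VW[OF J(1)] VW[OF eig_V[of k]]]
    by simp
  have eq: "L2_ip L J' v = E J v" if "v \<in> H10 L" for v
    by (rule eig_determines[OF J'(1) J(1) eigs that])
  have mem1: "L2_functional L J' \<in> H_minus1 L" by (rule L2_functional_H_minus1[OF J'(1)])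
  have i1: "Hm.uniform_integral (interval_measure T) (\<lambda>t. deriv \<theta> t *\<^sub>R L2_functional L (u1 t)) (L2_functional L J')"
  proof (rule Hm.uniform_integral_null[OF L2_embed_integral[OF J'i] mem1])
    show "H_minus1_norm L (L2_embed J' - L2_functional L J') = 0"
      by (rule H_minus1_norm_eq_0) (use mem1 L2_embed_H_minus1(1)[OF J'(1)] in \<open>auto simp: L2_embed_def L2_functional_eq\<close>)
    fix t
    have fm: "L2_functional L (u1 t) \<in> H_minus1 L" by (rule L2_functional_H_minus1[OF u1])
    then show "deriv \<theta> t *\<^sub>R L2_functional L (u1 t) \<in> H_minus1 L" by auto
    show "H_minus1_norm L (L2_embed (deriv \<theta> t *\<^sub>R u1 t) - deriv \<theta> t *\<^sub>R L2_functional L (u1 t)) = 0"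
      by (rule H_minus1_norm_eq_0) (use fm L2_embed_H_minus1(1)[OF L2.closed(4)[OF u1]] u1[of t] in
        \<open>auto simp: L2_embed_def L2_functional_eq scaleR_fun_apply L2.scale_left\<close>)
  qed
  have mem2: "- L2_functional L J' \<in> H_minus1 L" using Hm.closed(4)[OF mem1, of "-1"] by simp
  have i2: "Hm.uniform_integral (interval_measure T) (\<lambda>t. \<theta> t *\<^sub>R u2 t) (- L2_functional L J')"
  proof (rule Hm.uniform_integral_null[OF E_embed_integral[OF Ji] mem2])
    show "H_minus1_norm L (E_embed J - (- L2_functional L J')) = 0"
      by (rule H_minus1_norm_eq_0) (use Hm.closed(2)[OF E_embed_H_minus1(1)[OF J(1)] mem1] eq in
        \<open>auto simp: E_embed_def L2_functional_eq\<close>)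
    fix t
    show "\<theta> t *\<^sub>R u2 t \<in> H_minus1 L" using E_embed_H_minus1(1)[OF u] by (auto simp: u2_def)
    show "H_minus1_norm L (E_embed (\<theta> t *\<^sub>R u t) - \<theta> t *\<^sub>R u2 t) = 0"
      using E_embed_linear(2)[OF u] Hm.N_zero by (simp add: u2_def)
  qed
  show "\<exists>I. has_integral_in (interval_measure T) (H_minus1 L) (H_minus1_norm L) (\<lambda>t. deriv \<theta> t *\<^sub>R L2_functional L (u1 t)) I \<and>
      has_integral_in (interval_measure T) (H_minus1 L) (H_minus1_norm L) (\<lambda>t. \<theta> t *\<^sub>R u2 t) (- I)"
    using Hm.uniform_integral_has_integral_in[OF i1 finite_interval_measure]
      Hm.uniform_integral_has_integral_in[OF i2 finite_interval_measure] by blast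
qed

lemma u_initial: "has_initial_value T (L2 L) (L2_norm L) u \<phi>"
  unfolding has_initial_value_def
proof (intro exI[of _ u] conjI ballI)
  show "u t \<in> L2 L" for t using VW[OF u] .
  show "((\<lambda>s. L2_norm L (u s - u t)) \<longlongrightarrow> 0) (at t within {0..T})" for t
  proof (rule tendsto_sandwich[OF _ _ tendsto_const])
    show "((\<lambda>s. H1_norm L (u s - u t)) \<longlongrightarrow> 0) (at t within {0..T})"
      by (rule H10n.series_continuous[OF eig_V y_isCont u u_dist sqrt_tail_0])
    have d: "u s - u t \<in> H10 L" for s using u by auto
    show "\<forall>\<^sub>F s in at t within {0..T}. 0 \<le> L2_norm L (u s - u t)"
      using L2n.N_nonneg[OF VW[OF d]] by simp
    show "\<forall>\<^sub>F s in at t within {0..T}. L2_norm L (u s - u t) \<le> H1_norm L (u s - u t)"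
      using L2_norm_le_H1_norm[OF H10_H1[OF d]] by simp
  qed
  show "AE t in lebesgue_on {0<..<T}. L2_norm L (u t - u t) = 0" using L2n.N_zero by simp
  have mem: "u 0 \<in> L2 L" "\<phi> \<in> L2 L" using VW u \<phi> by auto
  have "L2_ip L (u 0 - \<phi>) (eig k) = 0" for k
    using L2.diff_left[OF mem VW[OF eig_V[of k]]] u_coeff[of 0 k] H_eig_mult_sq[OF mem(2), of k] by (simp add: y_def)
  then have "L2.sq L (u 0 - \<phi>) = 0" using mem by (intro L2_null_if_orthogonal) auto
  then show "L2_norm L (u 0 - \<phi>) = 0" by (simp add: L2_norm_eq)
qed

lemma u1_initial: "has_initial_value T (H_minus1 L) (H_minus1_norm L) (\<lambda>t. L2_functional L (u1 t)) (L2_functional L \<psi>)"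
  unfolding has_initial_value_def
proof (intro exI[of _ "\<lambda>t. L2_functional L (u1 t)"] conjI ballI)
  have nn: "0 \<le> H_minus1_norm L (L2_functional L f - L2_functional L g)" if "f \<in> L2 L" "g \<in> L2 L" for f g
    using that L2_functional_H_minus1 by (intro Hm.N_nonneg) auto
  show "L2_functional L (u1 t) \<in> H_minus1 L" for t by (rule L2_functional_H_minus1[OF u1])
  show "((\<lambda>s. H_minus1_norm L (L2_functional L (u1 s) - L2_functional L (u1 t))) \<longlongrightarrow> 0) (at t within {0..T})" for t
  proof (rule tendsto_sandwich[OF _ _ tendsto_const])
    show "((\<lambda>s. L2_norm L (u1 s - u1 t)) \<longlongrightarrow> 0) (at t within {0..T})"
      by (rule L2n.series_continuous[where x = eig and g = z and \<delta> = "\<lambda>m. 1 * sqrt (tail m)", OF VW[OF eig_V] z_isCont u1])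
         (use u1_dist in simp, rule sqrt_tail_0)
    show "\<forall>\<^sub>F s in at t within {0..T}. 0 \<le> H_minus1_norm L (L2_functional L (u1 s) - L2_functional L (u1 t))"
      using nn u1 by simp
    show "\<forall>\<^sub>F s in at t within {0..T}. H_minus1_norm L (L2_functional L (u1 s) - L2_functional L (u1 t)) \<le> L2_norm L (u1 s - u1 t)"
      using L2_functional_diff_norm[OF u1 u1] by simp
  qed
  show "AE t in lebesgue_on {0<..<T}. H_minus1_norm L (L2_functional L (u1 t) - L2_functional L (u1 t)) = 0"
    using Hm.N_zero by simp
  have "L2_ip L (u1 0 - \<psi>) (eig k) = 0" for k
    using L2.diff_left[OF u1 \<psi> VW[OF eig_V[of k]]] u1_coeff[of 0 k] H_eig_mult_sq[OF \<psi>, of k] by (simp add: z_def)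
  then have "L2.sq L (u1 0 - \<psi>) = 0" using u1[of 0] \<psi> by (intro L2_null_if_orthogonal) auto
  then have "L2_norm L (u1 0 - \<psi>) = 0" by (simp add: L2_norm_eq)
  then show "H_minus1_norm L (L2_functional L (u1 0) - L2_functional L \<psi>) = 0"
    using L2_functional_diff_norm[OF u1 \<psi>, of 0] nn[OF u1 \<psi>, of 0] by simp
qed

theorem series_weak_solution: "weak_solution a T L n \<beta> x \<phi> \<psi> u"
  unfolding weak_solution_def
proof (intro conjI exI[of _ u1] exI[of _ u2])
  show "\<forall>v\<in>H10 L. AE t in interval_measure T. u2 t v + E (u t) v = 0"
    by (simp add: u2_def E_embed_def)
qed (rule u_time(1) u_distr_deriv u1_time u1_distr_deriv u2_time u_initial u1_initial)+

end

section \<open>Uniqueness\<close>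

text \<open>Rotating \<open>(w Y, Z)\<close> back by the angle \<open>w t\<close> gives a pair \<open>(P, Q)\<close> with derivative zero.\<close>

lemma harmonic_oscillator_unique:
  assumes T: "0 < T" and w: "0 < w" and Y: "continuous_on {0..T} Y" and Z: "continuous_on {0..T} Z"
    and YZ: "has_weak_deriv T Y Z" and ZY: "has_weak_deriv T Z (\<lambda>t. - w\<^sup>2 * Y t)" and t: "t \<in> {0..T}"
  shows "Y t = Y 0 * cos (w * t) + Z 0 / w * sin (w * t)"
proof -
  have deriv: "(F has_real_derivative f s) (at s within {0..T})"
    if F: "continuous_on {0..T} F" and f: "continuous_on {0..T} f" and wd: "has_weak_deriv T F f" and s: "s \<in> {0..T}" for F f s
  proof -
    have "((\<lambda>s. integral {0..s} f) has_real_derivative f s) (at s within {0..T})"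
      using f s by (rule integral_has_real_derivative)
    then have "((\<lambda>s. F 0 + integral {0..s} f) has_real_derivative 0 + f s) (at s within {0..T})"
      by (rule DERIV_add[OF DERIV_const])
    then have "((\<lambda>s. F 0 + integral {0..s} f) has_real_derivative f s) (at s within {0..T})" by simp
    then show ?thesis
      by (rule has_field_derivative_transform_within[OF _ zero_less_one s])
         (rule weak_deriv_continuous_imp_integral[OF T F f wd, symmetric])
  qed
  have DY: "(Y has_real_derivative Z s) (at s within {0..T})" if "s \<in> {0..T}" for s
    by (rule deriv[OF Y Z YZ that])
  have DZ: "(Z has_real_derivative - w\<^sup>2 * Y s) (at s within {0..T})" if "s \<in> {0..T}" for s
    by (rule deriv[OF Z _ ZY that]) (intro continuous_intros Y)
  define P where "P s = w * Y s * cos (w * s) - Z s * sin (w * s)" for s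
  define Q where "Q s = w * Y s * sin (w * s) + Z s * cos (w * s)" for s
  have "(P has_real_derivative 0) (at s within {0..T})" if s: "s \<in> {0..T}" for s
    unfolding P_def[abs_def] using DY[OF s] DZ[OF s]
    by (auto intro!: derivative_eq_intros simp: power2_eq_square algebra_simps)
  then obtain p where p: "\<And>s. s \<in> {0..T} \<Longrightarrow> P s = p"
    using has_field_derivative_zero_constant[of "{0..T}" P] by auto
  have "(Q has_real_derivative 0) (at s within {0..T})" if s: "s \<in> {0..T}" for s
    unfolding Q_def[abs_def] using DY[OF s] DZ[OF s]
    by (auto intro!: derivative_eq_intros simp: power2_eq_square algebra_simps)
  then obtain q where q: "\<And>s. s \<in> {0..T} \<Longrightarrow> Q s = q"
    using has_field_derivative_zero_constant[of "{0..T}" Q] by auto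
  have "p = w * Y 0" "q = Z 0" using p[of 0] q[of 0] T by (auto simp: P_def Q_def)
  moreover have "P t * cos (w * t) + Q t * sin (w * t) = w * Y t * ((sin (w * t))\<^sup>2 + (cos (w * t))\<^sup>2)"
    unfolding P_def Q_def by (simp only: power2_eq_square algebra_simps)
  ultimately have "w * Y t = w * Y 0 * cos (w * t) + Z 0 * sin (w * t)"
    using p[OF t] q[OF t] by simp
  then show ?thesis using w by (simp add: field_simps)
qed

context seminormed
begin

text \<open>The functional turns the vector-valued continuous representative into a scalar one.\<close>

lemma initial_value_functional:
  assumes T: "0 < T" and iv: "has_initial_value T X N f f0" and f0: "f0 \<in> X"
    and f: "AE t in interval_measure T. f t \<in> X"
    and diff: "\<And>u v. u \<in> X \<Longrightarrow> v \<in> X \<Longrightarrow> \<bar>\<Lambda> u - \<Lambda> v\<bar> \<le> C * N (u - v)"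
  shows "\<exists>Y. continuous_on {0..T} Y \<and> (AE t in interval_measure T. Y t = \<Lambda> (f t)) \<and> Y 0 = (\<Lambda> f0 :: real)"
proof -
  obtain w where w: "\<And>t. t \<in> {0..T} \<Longrightarrow> w t \<in> X"
    and lim: "\<And>t. t \<in> {0..T} \<Longrightarrow> ((\<lambda>s. N (w s - w t)) \<longlongrightarrow> 0) (at t within {0..T})"
    and ae: "AE t in interval_measure T. N (w t - f t) = 0" and w0: "N (w 0 - f0) = 0"
    using iv unfolding has_initial_value_def by blast
  have null: "\<Lambda> u = \<Lambda> v" if "u \<in> X" "v \<in> X" "N (u - v) = 0" for u v
    using diff[OF that(1,2)] that(3) by simp
  have "continuous_on {0..T} (\<lambda>t. \<Lambda> (w t))"
    unfolding continuous_on_def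
  proof
    fix t assume t: "t \<in> {0..T}"
    have "((\<lambda>s. \<Lambda> (w s) - \<Lambda> (w t)) \<longlongrightarrow> 0) (at t within {0..T})"
    proof (rule Lim_null_comparison)
      show "((\<lambda>s. C * N (w s - w t)) \<longlongrightarrow> 0) (at t within {0..T})" using tendsto_mult_right_zero[OF lim[OF t]] .
      show "\<forall>\<^sub>F s in at t within {0..T}. norm (\<Lambda> (w s) - \<Lambda> (w t)) \<le> C * N (w s - w t)"
        unfolding eventually_at_filter using diff[OF w w[OF t]] by (intro always_eventually) simp
    qed
    then show "((\<lambda>t. \<Lambda> (w t)) \<longlongrightarrow> \<Lambda> (w t)) (at t within {0..T})" by (simp add: LIM_zero_iff)
  qed
  moreover have "AE t in interval_measure T. \<Lambda> (w t) = \<Lambda> (f t)"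
    using ae f AE_space by eventually_elim (rule null, auto intro: w)
  moreover have "\<Lambda> (w 0) = \<Lambda> f0" using w0 w[of 0] T f0 by (intro null) auto
  ultimately show ?thesis by (intro exI[of _ "\<lambda>t. \<Lambda> (w t)"]) auto
qed

lemma distr_deriv_functional:
  assumes d: "has_distr_deriv T X N f g"
    and f: "AE t in interval_measure T. f t \<in> X" and g: "AE t in interval_measure T. g t \<in> X"
    and add: "\<And>u v. u \<in> X \<Longrightarrow> v \<in> X \<Longrightarrow> \<Lambda> (u + v) = \<Lambda> u + \<Lambda> v"
    and sc: "\<And>c u. u \<in> X \<Longrightarrow> \<Lambda> (c *\<^sub>R u) = c * \<Lambda> u"
    and bd: "\<And>u. u \<in> X \<Longrightarrow> \<bar>\<Lambda> u\<bar> \<le> C * N u"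
    and Y: "continuous_on {0..T} Y" "AE t in interval_measure T. Y t = \<Lambda> (f t)"
    and Z: "continuous_on {0..T} Z" "AE t in interval_measure T. Z t = (\<Lambda> (g t) :: real)"
  shows "has_weak_deriv T Y Z"
  unfolding has_weak_deriv_def
proof (intro allI impI)
  fix \<theta> assume \<theta>: "test_function_on {0<..<T} \<theta>"
  have d\<theta>: "test_function_on {0<..<T} (deriv \<theta>)" by (rule test_function_deriv[OF \<theta>])
  obtain I where I: "has_integral_in (interval_measure T) X N (\<lambda>t. deriv \<theta> t *\<^sub>R f t) I"
    "has_integral_in (interval_measure T) X N (\<lambda>t. \<theta> t *\<^sub>R g t) (- I)"
    using d \<theta> unfolding has_distr_deriv_def by blast
  have IX: "I \<in> X" using I(1) by (simp add: has_integral_in_def)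
  have step: "(LINT t|interval_measure T. F t * \<eta> t) = \<Lambda> J"
    if J: "has_integral_in (interval_measure T) X N (\<lambda>t. \<eta> t *\<^sub>R h t) J" and \<eta>: "test_function_on {0<..<T} \<eta>"
      and h: "AE t in interval_measure T. h t \<in> X"
      and F: "continuous_on {0..T} F" "AE t in interval_measure T. F t = \<Lambda> (h t)" for F \<eta> h J
  proof -
    have hb: "has_bochner_integral (interval_measure T) (\<lambda>t. \<Lambda> (\<eta> t *\<^sub>R h t)) (\<Lambda> J)"
      by (rule has_integral_in_functional[OF _ J add sc bd]) auto
    have c: "continuous_on {0..T} (\<lambda>t. F t * \<eta> t)"
      using F(1) smooth_continuous_on[OF test_function_smooth[OF \<eta>]] by (rule continuous_on_mult)
    have "(LINT t|interval_measure T. F t * \<eta> t) = (LINT t|interval_measure T. \<Lambda> (\<eta> t *\<^sub>R h t))"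
    proof (rule integral_cong_AE)
      show "(\<lambda>t. F t * \<eta> t) \<in> borel_measurable (interval_measure T)"
        using borel_measurable_integrable[OF integral_interval_continuous(1)[OF c]] .
      show "(\<lambda>t. \<Lambda> (\<eta> t *\<^sub>R h t)) \<in> borel_measurable (interval_measure T)"
        using borel_measurable_has_bochner_integral[OF hb] .
      show "AE t in interval_measure T. F t * \<eta> t = \<Lambda> (\<eta> t *\<^sub>R h t)"
        using h F(2) by eventually_elim (simp add: sc)
    qed
    then show ?thesis using has_bochner_integral_integral_eq[OF hb] by simp
  qed
  have "\<Lambda> (- I) = - \<Lambda> I" using sc[OF IX, of "-1"] by simp
  then show "(LINT t|interval_measure T. Y t * deriv \<theta> t) = - (LINT t|interval_measure T. Z t * \<theta> t)"
    using step[OF I(1) d\<theta> f Y] step[OF I(2) \<theta> g Z] by simp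
qed

end

context loaded_string_data
begin

lemma y_mult_sq: "y k t * L2.sq L (eig k) = y k t"
proof -
  have "L2_ip L \<phi> (eig k) * L2.sq L (eig k) = L2_ip L \<phi> (eig k)"
    "L2_ip L \<psi> (eig k) * L2.sq L (eig k) = L2_ip L \<psi> (eig k)"
    by (rule H_eig_mult_sq[OF VW[OF \<phi>]], rule H_eig_mult_sq[OF \<psi>])
  then show ?thesis using eig_sq[of k] by (auto simp: y_def)
qed

text \<open>The functionals pairing with \<open>eig k\<close> on \<open>L\<^sup>2\<close> and on \<open>H\<^sup>-\<^sup>1\<close> turn (H1)--(H3) into the oscillator
  equation with its initial values.\<close>

lemma weak_solution_coeff:
  assumes w: "weak_solution a T L n \<beta> x \<phi> \<psi> w"
  shows "AE t in interval_measure T. L2_ip L (w t) (eig k) = y k t"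
proof -
  obtain w1 w2 where wL2: "w \<in> L2_time T (H10 L) (H1_norm L)"
    and d1: "has_distr_deriv T (L2 L) (L2_norm L) w w1" and w1: "w1 \<in> L2_time T (L2 L) (L2_norm L)"
    and d2: "has_distr_deriv T (H_minus1 L) (H_minus1_norm L) (\<lambda>t. L2_functional L (w1 t)) w2"
    and w2: "w2 \<in> L2_time T (H_minus1 L) (H_minus1_norm L)"
    and eq: "\<And>v. v \<in> H10 L \<Longrightarrow> AE t in interval_measure T. w2 t v + E (w t) v = 0"
    and i0: "has_initial_value T (L2 L) (L2_norm L) w \<phi>"
    and i1: "has_initial_value T (H_minus1 L) (H_minus1_norm L) (\<lambda>t. L2_functional L (w1 t)) (L2_functional L \<psi>)"
    using w unfolding weak_solution_def by blast
  have wH: "AE t in interval_measure T. w t \<in> H10 L" using wL2 by (simp add: L2_time_def strongly_measurable_def)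
  then have wW: "AE t in interval_measure T. w t \<in> L2 L" by (rule eventually_mono) (rule VW)
  have w1W: "AE t in interval_measure T. w1 t \<in> L2 L" using w1 by (simp add: L2_time_def strongly_measurable_def)
  then have fw1: "AE t in interval_measure T. L2_functional L (w1 t) \<in> H_minus1 L"
    by (rule eventually_mono) (rule L2_functional_H_minus1)
  have w2H: "AE t in interval_measure T. w2 t \<in> H_minus1 L" using w2 by (simp add: L2_time_def strongly_measurable_def)
  define e where "e = eig k"
  have e: "e \<in> H10 L" "e \<in> L2 L" by (auto simp: e_def)
  have b1: "\<bar>L2_ip L f e\<bar> \<le> L2_norm L e * L2_norm L f" if "f \<in> L2 L" for f
    using L2.abs_ip_le[OF that e(2)] by (simp add: L2_norm_eq mult.commute)
  have b2: "\<bar>F e\<bar> \<le> H1_norm L e * H_minus1_norm L F" if "F \<in> H_minus1 L" for F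
    using H_minus1_norm_bound[OF that e(1)] by (simp add: mult.commute)
  obtain Y where Y: "continuous_on {0..T} Y" "AE t in interval_measure T. Y t = L2_ip L (w t) e" "Y 0 = L2_ip L \<phi> e"
  proof -
    have "\<bar>L2_ip L f e - L2_ip L g e\<bar> \<le> L2_norm L e * L2_norm L (f - g)" if "f \<in> L2 L" "g \<in> L2 L" for f g
      using b1[of "f - g"] that e by (simp add: L2.diff_left)
    from L2n.initial_value_functional[where \<Lambda> = "\<lambda>f. L2_ip L f e", OF T i0 VW[OF \<phi>] wW this] show ?thesis using that by blast
  qed
  obtain Z where Z: "continuous_on {0..T} Z" "AE t in interval_measure T. Z t = L2_functional L (w1 t) e"
    "Z 0 = L2_functional L \<psi> e"
  proof -
    have "\<bar>F e - G e\<bar> \<le> H1_norm L e * H_minus1_norm L (F - G)" if "F \<in> H_minus1 L" "G \<in> H_minus1 L" for F G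
      using b2[of "F - G"] Hm.closed(3)[OF that] by simp
    from Hm.initial_value_functional[where \<Lambda> = "\<lambda>F. F e", OF T i1 L2_functional_H_minus1[OF \<psi>] fw1 this] show ?thesis using that by blast
  qed
  have YZ: "has_weak_deriv T Y Z"
  proof (rule L2n.distr_deriv_functional[where \<Lambda> = "\<lambda>f. L2_ip L f e", OF d1 wW w1W _ _ b1 Y(1,2) Z(1)])
    show "AE t in interval_measure T. Z t = L2_ip L (w1 t) e" using Z(2) by (simp add: L2_functional_eq)
  qed (use e in \<open>auto simp: L2.add_left L2.scale_left\<close>)
  have ZY: "has_weak_deriv T Z (\<lambda>t. - (\<omega> k)\<^sup>2 * Y t)"
  proof (rule Hm.distr_deriv_functional[where \<Lambda> = "\<lambda>F. F e", OF d2 fw1 w2H _ _ b2 Z(1,2)])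
    show "continuous_on {0..T} (\<lambda>t. - (\<omega> k)\<^sup>2 * Y t)" by (intro continuous_intros Y(1))
    show "AE t in interval_measure T. - (\<omega> k)\<^sup>2 * Y t = w2 t e"
      using eq[OF e(1)] wH Y(2)
    proof eventually_elim
      case (elim t)
      have "E (w t) e = ev k * L2_ip L (w t) e"
        using B_eig[OF elim(2), of k] EF.commute[OF elim(2) e(1)] L2.commute[OF VW[OF elim(2)] e(2)] by (simp add: e_def)
      then show ?case using elim by (simp add: \<omega>_sq)
    qed
  qed (auto simp: scaleR_fun_apply)
  have "AE t in interval_measure T. Y t = y k t"
  proof (rule AE_I2)
    fix t assume "t \<in> space (interval_measure T)"
    then have t: "t \<in> {0..T}" by simp
    show "Y t = y k t"
      using harmonic_oscillator_unique[OF T \<omega>_pos Y(1) Z(1) YZ ZY t] Y(3) Z(3)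
      by (simp add: y_def e_def L2_functional_eq)
  qed
  then show ?thesis using Y(2) by eventually_elim (simp add: e_def)
qed

theorem weak_solution_unique:
  assumes w: "weak_solution a T L n \<beta> x \<phi> \<psi> w"
  shows "AE t in interval_measure T. H1_norm L (w t - u t) = 0"
proof -
  have "w \<in> L2_time T (H10 L) (H1_norm L)" using w unfolding weak_solution_def by blast
  then have wH: "AE t in interval_measure T. w t \<in> H10 L" by (simp add: L2_time_def strongly_measurable_def)
  have "AE t in interval_measure T. \<forall>k. L2_ip L (w t) (eig k) = y k t"
    using weak_solution_coeff[OF w] by (simp add: AE_all_countable)
  then show ?thesis using wH
  proof eventually_elim
    case (elim t)
    have d: "w t - u t \<in> H10 L" using elim(2) u[of t] by auto
    have "L2_ip L (w t - u t) (eig k) = 0" for k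
      using elim(1) u_coeff[of t k] y_mult_sq[of k t] L2.diff_left[OF VW[OF elim(2)] VW[OF u[of t]] VW[OF eig_V[of k]]] by simp
    then have z: "L2.sq L (w t - u t) = 0" by (rule eig_complete[OF d])
    then show ?case using dirichlet_null[OF H10_H1[OF d] z] by (simp add: H1_norm_eq[OF H10_H1[OF d]] H1_ip_def)
  qed
qed

end

theorem theorem3p1:
  fixes a T L :: real and n :: nat and \<beta> x :: "nat \<Rightarrow> real" and \<phi> \<psi> :: "real \<Rightarrow> real"
  assumes "a > 0" and "T > 0" and "L > 0" and "n \<ge> 1"
    and "\<And>k. k \<in> {1..n} \<Longrightarrow> \<beta> k > 0"
    and "\<And>k. k \<in> {1..n} \<Longrightarrow> x k \<in> {0<..<L}"
    and "\<phi> \<in> H10 L" and "\<psi> \<in> L2 L"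
  shows "\<exists>u. weak_solution a T L n \<beta> x \<phi> \<psi> u \<and> u \<in> Linf_time T (H10 L) (H1_norm L) \<and>
    (\<forall>w. weak_solution a T L n \<beta> x \<phi> \<psi> w \<longrightarrow>
      (AE t in lebesgue_on {0<..<T}. H1_norm L (w t - u t) = 0))"
proof -
  interpret loaded_string_data a L n \<beta> x T \<phi> \<psi>
    by unfold_locales (use assms in auto)
  show ?thesis
    using series_weak_solution u_time(2) weak_solution_unique by (intro exI[of _ u]) blast
qed

end
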